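(* Let $1\le k<n$, $r=n-k$, $E=\mathbb C^n$, $X=G(k,n)$. Let $d\ge 0$ be an integer and let $\lambda,\mu,\nu$ be partitions contained in the $k\times r$ rectangle with $|\lambda|+|\mu|+|\nu|=kr+nd$. Let $F_\bullet,G_\bullet,H_\bullet$ be complete flags of $E$ in general position. Then the map $f\mapsto(\operatorname{Ker}(f),\operatorname{Span}(f))$ is a bijection from the set of morphisms $f\colon\mathbb P^1\to X$ of degree $d$ satisfying $f(0)\in X_\lambda(F_\bullet)$, $f(1)\in X_\mu(G_\bullet)$, $f(\infty)\in X_\nu(H_\bullet)$ onto the set of points of $X^{(d)}_\lambda(F_\bullet)\cap X^{(d)}_\mu(G_\bullet)\cap X^{(d)}_\nu(H_\bullet)\subset Y_d=F(k-d,k+d;n)$. (In particular, every such $f$ has $\dim\operatorname{Ker}(f)=k-d$ and $\dim\operatorname{Span}(f)=k+d$.)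
   Context: For a complete flag $F_1\subset\cdots\subset F_n=E$ and a partition $\lambda=(\lambda_1\ge\cdots\ge\lambda_k\ge0)$ with $\lambda_1\le r$, the Schubert variety is $X_\lambda(F_\bullet)=\{V\in X:\dim(V\cap F_{r+i-\lambda_i})\ge i\ \forall\,1\le i\le k\}$, of codimension $|\lambda|=\sum\lambda_i$; $\sigma_\lambda$ denotes its class. The degree of $f\colon\mathbb P^1\to X$ is $\int f_*[\mathbb P^1]\cdot\sigma_1$. For $f$, $\operatorname{Ker}(f)=\bigcap_{V\in f(\mathbb P^1)}V$ and $\operatorname{Span}(f)=\sum_{V\in f(\mathbb P^1)}V$ (intersection and linear span of the subspaces of $E$ corresponding to points of the image). $F(a,b;n)$ is the two-step flag variety of pairs $A\subset B\subset E$ with $\dim A=a$, $\dim B=b$ (empty unless $0\le a\le b\le n$), and $Y_d=F(k-d,k+d;n)$. For a subvariety $\mathcal W\subset X$, $\mathcal W^{(d)}=\{(A,B)\in Y_d:\exists V\in\mathcal W,\ A\subset V\subset B\}$; $X^{(d)}_\lambda(F_\bullet)$ denotes $(X_\lambda(F_\bullet))^{(d)}$. *)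

theory Defs
  imports "HOL-Analysis.Analysis" "HOL-Computational_Algebra.Polynomial"
begin

text \<open>Complex subspaces of E = complex^'n (n = CARD('n)) are handled via the
 complex vector space interpretation vec (scalar multiplication *s).\<close>

definition cspace :: "(complex^'n) set \<Rightarrow> bool" where
  "cspace V \<longleftrightarrow> vec.subspace V"

definition cdim :: "(complex^'n) set \<Rightarrow> nat" where
  "cdim V = vec.dim V"

definition Grass :: "nat \<Rightarrow> (complex^'n) set set" where
  "Grass k = {V. cspace V \<and> cdim V = k}"

definition complete_flag :: "(nat \<Rightarrow> (complex^'n) set) \<Rightarrow> bool" where
  "complete_flag F \<longleftrightarrow> (\<forall>i\<le>CARD('n). cspace (F i) \<and> cdim (F i) = i)
     \<and> (\<forall>i<CARD('n). F i \<subseteq> F (Suc i))"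

definition partition_in_rect :: "nat \<Rightarrow> nat \<Rightarrow> (nat \<Rightarrow> nat) \<Rightarrow> bool" where
  "partition_in_rect k r lam \<longleftrightarrow>
     (\<forall>i j. 1 \<le> i \<longrightarrow> i \<le> j \<longrightarrow> j \<le> k \<longrightarrow> lam j \<le> lam i) \<and>
     (\<forall>i. 1 \<le> i \<longrightarrow> i \<le> k \<longrightarrow> lam i \<le> r)"

definition part_size :: "nat \<Rightarrow> (nat \<Rightarrow> nat) \<Rightarrow> nat" where
  "part_size k lam = (\<Sum>i=1..k. lam i)"

definition schubert :: "nat \<Rightarrow> (nat \<Rightarrow> nat) \<Rightarrow> (nat \<Rightarrow> (complex^'n) set) \<Rightarrow> (complex^'n) set set" where
  "schubert k lam F = {V \<in> Grass k. \<forall>i. 1 \<le> i \<longrightarrow> i \<le> k \<longrightarrow>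
       i \<le> cdim (V \<inter> F (CARD('n) - k + i - lam i))}"

definition Yd :: "nat \<Rightarrow> nat \<Rightarrow> ((complex^'n) set \<times> (complex^'n) set) set" where
  "Yd k d = {(A,B). d \<le> k \<and> k + d \<le> CARD('n) \<and> cspace A \<and> cspace B \<and> A \<subseteq> B
               \<and> cdim A = k - d \<and> cdim B = k + d}"

definition Wd :: "nat \<Rightarrow> nat \<Rightarrow> (complex^'n) set set \<Rightarrow> ((complex^'n) set \<times> (complex^'n) set) set" where
  "Wd k d W = {(A,B) \<in> Yd k d. \<exists>V\<in>W. A \<subseteq> V \<and> V \<subseteq> B}"

text \<open>Points of P^1: Some t is [1:t], None is infinity [0:1].
  A homogeneous polynomial of degree d in (s,t) is encoded by its dehomogenisation p
  with degree p <= d; its value at infinity is coeff p d.\<close>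
definition pval :: "nat \<Rightarrow> complex poly \<Rightarrow> complex option \<Rightarrow> complex" where
  "pval d p x = (case x of Some t \<Rightarrow> poly p t | None \<Rightarrow> coeff p d)"

text \<open>Plucker coordinates of the k-vector u_0 wedge ... wedge u_(k-1):
  the k x k minor on the columns sigma 0, ..., sigma (k-1).\<close>
definition plucker :: "nat \<Rightarrow> (nat \<Rightarrow> complex^'n) \<Rightarrow> (nat \<Rightarrow> 'n) \<Rightarrow> complex" where
  "plucker k u \<sigma> = (\<Sum>\<pi> | \<pi> permutes {..<k}. of_int (sign \<pi>) * (\<Prod>i<k. u i $ \<sigma> (\<pi> i)))"

definition is_basis_of :: "nat \<Rightarrow> (nat \<Rightarrow> complex^'n) \<Rightarrow> (complex^'n) set \<Rightarrow> bool" where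
  "is_basis_of k u V \<longleftrightarrow> inj_on u {..<k} \<and> vec.independent (u ` {..<k}) \<and> vec.span (u ` {..<k}) = V"

text \<open>f : P^1 -> G(k,n) is a morphism of degree d: composed with the Plucker embedding it is
  given by homogeneous polynomials of degree d (one per Plucker coordinate), which are,
  at every point x, the Plucker coordinates of a basis of f(x) (hence have no common zero).\<close>
definition morphism_deg :: "nat \<Rightarrow> nat \<Rightarrow> (complex option \<Rightarrow> (complex^'n) set) \<Rightarrow> bool" where
  "morphism_deg k d f \<longleftrightarrow> (\<exists>p :: (nat \<Rightarrow> 'n) \<Rightarrow> complex poly.
      (\<forall>\<sigma>. degree (p \<sigma>) \<le> d) \<and>
      (\<forall>x. \<exists>u. is_basis_of k u (f x) \<and> (\<forall>\<sigma>. pval d (p \<sigma>) x = plucker k u \<sigma>)))"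

definition Ker_map :: "(complex option \<Rightarrow> (complex^'n) set) \<Rightarrow> (complex^'n) set" where
  "Ker_map f = \<Inter> (range f)"

definition Span_map :: "(complex option \<Rightarrow> (complex^'n) set) \<Rightarrow> (complex^'n) set" where
  "Span_map f = vec.span (\<Union> (range f))"

inductive polyfun :: "(('v \<Rightarrow> complex) \<Rightarrow> complex) \<Rightarrow> bool" where
  pf_const: "polyfun (\<lambda>a. c)"
| pf_var: "polyfun (\<lambda>a. a x)"
| pf_add: "polyfun P \<Longrightarrow> polyfun Q \<Longrightarrow> polyfun (\<lambda>a. P a + Q a)"
| pf_mult: "polyfun P \<Longrightarrow> polyfun Q \<Longrightarrow> polyfun (\<lambda>a. P a * Q a)"

definition flag_of :: "(nat \<times> nat \<times> 'n \<Rightarrow> complex) \<Rightarrow> nat \<Rightarrow> nat \<Rightarrow> (complex^'n) set" where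
  "flag_of a m i = vec.span ((\<lambda>j. \<chi> c. a (m, j, c)) ` {..<i})"

end

(* If the kernel A and the span B of a curve f have dimensions k - e1 and k + e2, then e1, e2 <= d,
   because adding a vector v of f(t0) to all f(t), or intersecting all f(t) with a hyperplane through
   f(t0), divides the Pluecker coordinates by t - t0 and so lowers the degree.

   General position is obtained without dimension theory.  The triples of flags that admit a
   configuration A <= V1, V2, V3 <= B with V1, V2, V3 in the three Schubert varieties lie in the union
   of finitely many images of polynomial maps, whose number of parameters is smaller than the number
   3 n^2 of coordinates of the flags, unless e1 = e2 = d and V1, V2, V3 are pairwise transversal in
   B / A.  Counting monomials yields a nonzero polynomial that vanishes on such an image.

   In the remaining case V1, V2, V3 are determined by (A, B): two candidates for V1 would give a line
   of candidates, and some member of this line is not transversal to V2.  There are bases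
   a, x of V1, a, y of V3 and a, x + y of V2, where a is a basis of A, and the only curve of degree d
   through V1, V2, V3 with kernel A and span B is t |-> span(a, x + t y). *)
theory Submission
  imports "Jordan_Normal_Form.Determinant" Defs
begin

section \<open>Determinants of finite families\<close>

no_notation Matrix.vec_index (infixl \<open>$\<close> 100)
no_notation Matrix.scalar_prod (infix \<open>\<bullet>\<close> 70)
hide_const (open) Matrix.vec Matrix.row Matrix.mat Determinant.det
hide_type (open) Matrix.vec

text \<open>The degree of a curve is visible only through its minors, so subspaces are tested by
  determinants \<open>dt k (\<lambda>i j. \<phi> j (u i))\<close> of arbitrary functionals on a
  basis; free choice of the functionals replaces a choice of coordinates. Dividing by t - t0 makes
  sense only away from t0 and from the finitely many points where the new subspace has the wrong
  dimension. Curves are therefore replaced by families over infinite parameter sets, and closedness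
  of incidence conditions recovers the lost points. For e1 = e2 = d the parameter count is exactly 3
  n^2, and a further direction common to two of the three subspaces lowers it by exactly one; this
  is why transversality can be demanded. The count does not exclude several triples over one pair
  (A, B), and the line in the Schubert variety closes this gap. Uniqueness of the curve comes from
  infinity: a minor in which j of the functionals vanish on f(infinity) has degree at most d - j.
  Hence the coordinates of a suitable frame of f(t) have degree at most 1 in t, and two values
  determine them.\<close>

definition dt :: "nat \<Rightarrow> (nat \<Rightarrow> nat \<Rightarrow> 'a) \<Rightarrow> 'a :: comm_ring_1" where
  "dt k M = Determinant.det (Matrix.mat k k (\<lambda>(i,j). M i j))"

lemma dt_cong:
  "(\<And>i j. i < k \<Longrightarrow> j < k \<Longrightarrow> M i j = N i j) \<Longrightarrow> dt k M = dt k N"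
  unfolding dt_def by (intro arg_cong[where f = Determinant.det] eq_matI) auto

lemma dt_rows: "dt k M = (\<Sum>p | p permutes {..<k}. of_int (sign p) * (\<Prod>i<k. M i (p i)))"
proof -
  have "dt k M = (\<Sum>p | p permutes {0..<k}. of_int (sign p) * (\<Prod>i = 0..<k. M i (p i)))"
    unfolding dt_def by (subst Determinant.det_def'[where n = k]) (auto intro!: sum.cong prod.cong)
  then show ?thesis by (simp add: atLeast0LessThan)
qed

lemma dt_columns: "dt k M = (\<Sum>p | p permutes {..<k}. of_int (sign p) * (\<Prod>j<k. M (p j) j))"
proof -
  have "dt k M = Determinant.det (transpose_mat (Matrix.mat k k (\<lambda>(i,j). M i j)))"
    unfolding dt_def by (rule Determinant.det_transpose[symmetric, where n = k]) simp
  also have "transpose_mat (Matrix.mat k k (\<lambda>(i,j). M i j)) = Matrix.mat k k (\<lambda>(i,j). M j i)"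
    by (intro eq_matI) auto
  finally show ?thesis
    using dt_rows[of k "\<lambda>i j. M j i"] by (simp add: dt_def)
qed

lemma dt_eq_row:
  assumes "i < k" "i' < k" "i \<noteq> i'" "\<And>j. j < k \<Longrightarrow> M i j = M i' j"
  shows "dt k M = 0"
  unfolding dt_def using assms
  by (intro Determinant.det_identical_rows[of _ k i i']) (auto intro!: eq_vecI)

lemma dt_zero_column:
  assumes "j < k" "\<And>i. i < k \<Longrightarrow> M i j = 0"
  shows "dt k M = 0"
  unfolding dt_columns
proof (intro sum.neutral ballI)
  fix p assume "p \<in> {p. p permutes {..<k}}"
  then have "p j < k" using assms(1) permutes_in_image by fastforce
  then have "(\<Prod>j<k. M (p j) j) = 0" using assms by (intro prod_zero) auto
  then show "of_int (sign p) * (\<Prod>j<k. M (p j) j) = 0" by simp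
qed

lemma dt_mult: "dt k (\<lambda>i j. \<Sum>l<k. C i l * M l j) = dt k C * dt k M"
proof -
  have "Matrix.mat k k (\<lambda>(i,j). \<Sum>l<k. C i l * M l j)
      = Matrix.mat k k (\<lambda>(i,j). C i j) * Matrix.mat k k (\<lambda>(i,j). M i j)"
    by (intro eq_matI) (auto simp: scalar_prod_def atLeast0LessThan)
  then show ?thesis unfolding dt_def by (simp add: det_mult[where n = k])
qed

lemma dt_one: "dt k (\<lambda>i j. if i = j then 1 else 0) = 1"
proof -
  have "Matrix.mat k k (\<lambda>(i,j). if i = j then 1 else 0) = (1\<^sub>m k :: 'a mat)"
    by (intro eq_matI) auto
  then show ?thesis unfolding dt_def by simp
qed

text \<open>Cramer's rule for the system with identity matrix, whose solution is \<open>x\<close>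
  itself.\<close>

lemma dt_one_column:
  assumes "l < k"
  shows "dt k (\<lambda>i j. if j = l then x i else if i = j then 1 else 0) = x l"
proof -
  have "replace_col (1\<^sub>m k) (1\<^sub>m k *\<^sub>v Matrix.vec k x) l
      = Matrix.mat k k (\<lambda>(i,j). if j = l then x i else if i = j then 1 else 0)"
    by (intro eq_matI) (auto simp: replace_col_def)
  then show ?thesis
    using cramer_lemma_mat[of "1\<^sub>m k" k "Matrix.vec k x" l] assms by (simp add: dt_def)
qed

text \<open>The increasing enumeration of the indices other than \<open>i\<close>, as needed for
  minors with a deleted column.\<close>

definition skip :: "nat \<Rightarrow> nat \<Rightarrow> nat" where "skip i j = (if j < i then j else Suc j)"

lemma dt_last_row:
  "dt (Suc k) M = (\<Sum>j<Suc k. M k j * ((-1)^(k+j) * dt k (\<lambda>i l. M i (skip j l))))"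
proof -
  let ?A = "Matrix.mat (Suc k) (Suc k) (\<lambda>(i,j). M i j)"
  have "mat_delete ?A k j = Matrix.mat k k (\<lambda>(i,l). M i (skip j l))" if "j < Suc k" for j
    using that by (intro eq_matI) (auto simp: mat_delete_def skip_def)
  moreover have "Determinant.det ?A = (\<Sum>j<Suc k. ?A $$ (k,j) * cofactor ?A k j)"
    by (rule laplace_expansion_row) auto
  ultimately show ?thesis unfolding dt_def cofactor_def
    by (auto intro!: sum.cong)
qed

lemma dt_last_column:
  assumes "\<And>i. i < k \<Longrightarrow> M i k = 0"
  shows "dt (Suc k) M = M k k * dt k M"
proof -
  let ?A = "Matrix.mat (Suc k) (Suc k) (\<lambda>(i,j). M i j)"
  have *: "mat_delete ?A k k = Matrix.mat k k (\<lambda>(i,l). M i l)"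
    by (intro eq_matI) (auto simp: mat_delete_def)
  have "Determinant.det ?A = (\<Sum>i<Suc k. ?A $$ (i,k) * cofactor ?A i k)"
    by (rule laplace_expansion_column) auto
  also have "\<dots> = ?A $$ (k,k) * cofactor ?A k k"
    using assms by (subst sum.lessThan_Suc) (simp add: sum.neutral)
  finally show ?thesis unfolding dt_def cofactor_def * by (simp flip: mult_2)
qed

lemma dt_scale_row:
  assumes "l < k"
  shows "dt k (\<lambda>i j. (if i = l then c else 1) * M i j) = c * dt k M"
proof -
  have "dt k (\<lambda>i j. (if i = l then c else 1) * M i j)
      = (\<Sum>p | p permutes {..<k}. c * (of_int (sign p) * (\<Prod>i<k. M i (p i))))"
    unfolding dt_rows using assms by (intro sum.cong) (auto simp: prod.distrib prod.delta)
  then show ?thesis by (simp add: dt_rows sum_distrib_left)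
qed

lemma dt_scale: "dt k (\<lambda>i j. c * M i j) = c ^ k * dt k M"
  unfolding dt_rows by (simp add: prod.distrib sum_distrib_left mult.left_commute)

lemma poly_dt: "poly (dt k M) t = dt k (\<lambda>i j. poly (M i j) t)"
  unfolding dt_rows by (simp add: poly_sum poly_prod)

lemma degree_dt_le:
  fixes M :: "nat \<Rightarrow> nat \<Rightarrow> complex poly"
  assumes "\<And>i j. i < k \<Longrightarrow> j < k \<Longrightarrow> degree (M i j) \<le> D j"
  shows "degree (dt k M) \<le> (\<Sum>j<k. D j)"
  unfolding dt_columns
proof (intro degree_sum_le ballI)
  fix p assume "p \<in> {p. p permutes {..<k}}"
  then have p: "p permutes {..<k}" by simp
  have "degree (of_int (sign p) * (\<Prod>j<k. M (p j) j)) \<le> degree (\<Prod>j<k. M (p j) j)"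
    by (metis degree_mult_le degree_of_int add_0)
  also have "\<dots> \<le> (\<Sum>j<k. degree (M (p j) j))"
    using degree_prod_sum_le[of "{..<k}" "\<lambda>j. M (p j) j"] by (simp add: o_def)
  also have "\<dots> \<le> (\<Sum>j<k. D j)"
    using p assms permutes_in_image[OF p] by (intro sum_mono) fastforce
  finally show "degree (of_int (sign p) * (\<Prod>j<k. M (p j) j)) \<le> (\<Sum>j<k. D j)" .
qed (simp add: finite_permutations)

section \<open>Linear functionals and bases\<close>

lemma dt_left_inverse:
  fixes M :: "nat \<Rightarrow> nat \<Rightarrow> 'a :: field"
  assumes "dt k M \<noteq> 0"
  shows "\<exists>C. \<forall>i<k. \<forall>j<k. (\<Sum>l<k. C i l * M l j) = (if i = j then 1 else 0)"
proof -
  let ?A = "Matrix.mat k k (\<lambda>(i,j). M i j)"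
  have A: "?A \<in> carrier_mat k k" by simp
  note adj = adj_mat[OF A]
  have "(\<Sum>l<k. (adj_mat ?A $$ (i,l) / dt k M) * M l j) = (if i = j then 1 else 0)"
    if "i < k" "j < k" for i j
  proof -
    have "(\<Sum>l<k. adj_mat ?A $$ (i,l) * M l j) = (adj_mat ?A * ?A) $$ (i,j)"
      using that adj(1) by (auto simp: scalar_prod_def atLeast0LessThan intro!: sum.cong)
    also have "\<dots> = (if i = j then dt k M else 0)"
      using that unfolding adj(3) by (auto simp: dt_def)
    finally show ?thesis using assms by (simp flip: sum_divide_distrib)
  qed
  then show ?thesis by (intro exI[of _ "\<lambda>i l. adj_mat ?A $$ (i,l) / dt k M"]) auto
qed

definition lfun :: "(complex^'n \<Rightarrow> complex) \<Rightarrow> bool" where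
  "lfun \<phi> \<longleftrightarrow> (\<forall>x y. \<phi> (x + y) = \<phi> x + \<phi> y) \<and> (\<forall>c x. \<phi> (c *s x) = c * \<phi> x)"

lemma lfun_add: "lfun \<phi> \<Longrightarrow> \<phi> (x + y) = \<phi> x + \<phi> y"
  and lfun_scale: "lfun \<phi> \<Longrightarrow> \<phi> (c *s x) = c * \<phi> x"
  by (auto simp: lfun_def)

lemma lfun_zero: "lfun \<phi> \<Longrightarrow> \<phi> 0 = 0"
  using lfun_scale[of \<phi> 0 0] by simp

lemma lfun_diff: "lfun \<phi> \<Longrightarrow> \<phi> (x - y) = \<phi> x - \<phi> y"
  using lfun_add[of \<phi> "x - y" y] by (simp add: algebra_simps)

lemma lfun_sum: "lfun \<phi> \<Longrightarrow> \<phi> (\<Sum>i\<in>A. f i) = (\<Sum>i\<in>A. \<phi> (f i))"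
  by (induction A rule: infinite_finite_induct) (auto simp: lfun_zero lfun_add)

lemma lfun_expand: "lfun \<phi> \<Longrightarrow> \<phi> u = (\<Sum>c\<in>UNIV. \<phi> (axis c 1) * u $ c)"
  by (subst (1) basis_expansion[of u, symmetric]) (simp add: lfun_sum lfun_scale mult.commute)

lemma lfun_vanish_span:
  assumes "lfun \<phi>" "\<And>x. x \<in> S \<Longrightarrow> \<phi> x = 0" "x \<in> vec.span S"
  shows "\<phi> x = 0"
  using assms(3)
  by (induction rule: vec.span_induct_alt) (auto simp: lfun_zero lfun_add lfun_scale assms)

lemma lfun_extend:
  assumes "vec.independent (B :: (complex^'n) set)"
  shows "\<exists>\<phi>. lfun \<phi> \<and> (\<forall>x\<in>B. \<phi> x = f x)"
proof -
  interpret vector_space_pair "(*s) :: complex \<Rightarrow> complex^'n \<Rightarrow> complex^'n" "(*) :: complex \<Rightarrow> complex \<Rightarrow> complex"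
    by unfold_locales (auto simp: algebra_simps)
  show ?thesis
    using linear_independent_extend[OF assms, of f] unfolding Vector_Spaces.linear_iff lfun_def by blast
qed

section \<open>Bases and their dual functionals\<close>

lemma basis_dim: "is_basis_of k u V \<Longrightarrow> cdim V = k"
  unfolding is_basis_of_def cdim_def
  by (metis card_image card_lessThan vec.dim_eq_card_independent vec.dim_span)

lemma basis_cspace: "is_basis_of k u V \<Longrightarrow> cspace V"
  unfolding is_basis_of_def cspace_def by (metis vec.subspace_span)

lemma basis_mem: "is_basis_of k u V \<Longrightarrow> i < k \<Longrightarrow> u i \<in> V"
  unfolding is_basis_of_def by (metis imageI lessThan_iff vec.span_base)

lemma basis_exists:
  assumes "cspace V" shows "\<exists>u. is_basis_of (cdim V) u V"
proof -
  obtain B where B: "finite B" "B \<subseteq> V" "vec.independent B" "vec.span B = V" "card B = vec.dim V"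
    using vec.basis_subspace_exists assms cspace_def by metis
  obtain u where "bij_betw u {0..<card B} B" using ex_bij_betw_nat_finite[OF B(1)] by blast
  then show ?thesis using B
    by (intro exI[of _ u]) (auto simp: is_basis_of_def cdim_def bij_betw_def atLeast0LessThan)
qed

lemma basis_if_span:
  assumes "vec.span (u ` {..<k}) = V" "k \<le> cdim V"
  shows "is_basis_of k u V"
proof -
  have 1: "vec.dim (u ` {..<k}) = cdim V" using assms(1) cdim_def by (metis vec.dim_span)
  have 2: "vec.dim (u ` {..<k}) \<le> card (u ` {..<k})" by (intro vec.dim_le_card) (auto intro: vec.span_base)
  have "card (u ` {..<k}) = k" using 1 2 card_image_le[of "{..<k}" u] assms(2) by simp
  then have "inj_on u {..<k}" "vec.independent (u ` {..<k})"
    using 1 2 assms(2) vec.card_eq_dim[of "u ` {..<k}" "u ` {..<k}"] vec.span_superset[of "u ` {..<k}"]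
    by (metis card_lessThan eq_card_imp_inj_on finite_lessThan, metis finite_imageI finite_lessThan subset_refl le_antisym)
  with assms show ?thesis by (simp add: is_basis_of_def)
qed

lemma span_image_lessThan:
  "(v \<in> vec.span (u ` {..<k})) \<longleftrightarrow> (\<exists>c. v = (\<Sum>i<(k::nat). c i *s (u i :: complex^'n)))"
proof
  assume "v \<in> vec.span (u ` {..<k})"
  then show "\<exists>c. v = (\<Sum>i<k. c i *s u i)"
  proof (induction rule: vec.span_induct_alt)
    case base show ?case by (intro exI[of _ "\<lambda>_. 0"]) simp
  next
    case (step a x y)
    then obtain i c where i: "i < k" "x = u i" and y: "y = (\<Sum>i<k. c i *s u i)" by blast
    have "(\<Sum>l<k. (c l + (if l = i then a else 0)) *s u l) = a *s x + y"
      using i by (simp add: vec.scale_left_distrib sum.distrib y if_distrib[of "\<lambda>a. a *s _"] cong: if_cong)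
    then show ?case by (intro exI[of _ "\<lambda>l. c l + (if l = i then a else 0)"]) simp
  qed
next
  assume "\<exists>c. v = (\<Sum>i<k. c i *s u i)"
  then show "v \<in> vec.span (u ` {..<k})"
    by (auto intro!: vec.span_sum vec.span_scale intro: vec.span_base)
qed

lemma basis_expand: "is_basis_of k u V \<Longrightarrow> v \<in> V \<Longrightarrow> \<exists>c. v = (\<Sum>i<k. c i *s u i)"
  unfolding is_basis_of_def using span_image_lessThan by metis

text \<open>The dual basis is extended to functionals on all of E, since it will be evaluated on
  other members of a family as well.\<close>

lemma dual_exists:
  assumes "is_basis_of k u V"
  shows "\<exists>\<psi>. (\<forall>j. lfun (\<psi> j)) \<and> (\<forall>i<k. \<forall>j<k. \<psi> j (u i) = (if i = j then 1 else 0))"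
proof -
  have u: "inj_on u {..<k}" "vec.independent (u ` {..<k})" using assms by (auto simp: is_basis_of_def)
  have "\<exists>\<phi>. lfun \<phi> \<and> (\<forall>i<k. \<phi> (u i) = (if i = j then 1 else 0))" for j
    using lfun_extend[OF u(2), of "\<lambda>x. if the_inv_into {..<k} u x = j then 1 else 0"]
    by (auto simp: the_inv_into_f_f[OF u(1)])
  then show ?thesis by metis
qed

lemma basis_of_span_if_independent:
  assumes indep: "\<And>c i. (\<Sum>i<k. c i *s u i) = 0 \<Longrightarrow> i < k \<Longrightarrow> c i = 0"
  shows "is_basis_of k u (vec.span (u ` {..<k}))"
proof -
  have inj: "inj_on u {..<k}"
  proof (rule inj_onI, rule ccontr)
    fix a b assume ab: "a \<in> {..<k}" "b \<in> {..<k}" "u a = u b" "a \<noteq> b"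
    let ?c = "\<lambda>i. (if i = a then 1 else 0) - (if i = b then 1 else (0::complex))"
    have "(\<Sum>i<k. ?c i *s u i) = u a - u b" using ab
      by (simp add: vec.scale_left_diff_distrib sum_subtractf if_distrib[of "\<lambda>a. a *s _"] cong: if_cong)
    then show False using indep[of ?c a] ab by simp
  qed
  have "c (u i) = 0" if "(\<Sum>v\<in>u ` {..<k}. c v *s v) = 0" "i < k" for c i
    using indep[of "\<lambda>i. c (u i)" i] that by (simp add: sum.reindex[OF inj])
  then have "vec.independent (u ` {..<k})" by (auto simp: vec.independent_explicit)
  then show ?thesis using inj by (simp add: is_basis_of_def)
qed

lemma basis_of_span_if_dual:
  assumes \<psi>: "\<And>j. j < k \<Longrightarrow> lfun (\<psi> j)" "\<And>i j. i < k \<Longrightarrow> j < k \<Longrightarrow> \<psi> j (w i) = (if i = j then 1 else 0)"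
  shows "is_basis_of k w (vec.span (w ` {..<k}))"
proof (rule basis_of_span_if_independent)
  fix c i assume c: "(\<Sum>i<k. c i *s w i) = 0" and i: "i < k"
  have "0 = \<psi> i (\<Sum>j<k. c j *s w j)" using c \<psi>(1)[OF i] by (simp add: lfun_zero)
  also have "\<dots> = (\<Sum>j<k. if j = i then c j else 0)"
    unfolding lfun_sum[OF \<psi>(1)[OF i]] lfun_scale[OF \<psi>(1)[OF i]]
    using i \<psi>(2) by (intro sum.cong) auto
  also have "\<dots> = c i" using i by simp
  finally show "c i = 0" by simp
qed

lemma basis_if_basis_of_span:
  assumes w: "is_basis_of k w (vec.span (w ` {..<k}))"
    and V: "cspace V" "cdim V = k" "\<And>i. i < k \<Longrightarrow> w i \<in> V"
  shows "is_basis_of k w V"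
proof -
  have "vec.span (w ` {..<k}) \<subseteq> V" using V by (intro vec.span_minimal) (auto simp: cspace_def)
  then have "vec.span (w ` {..<k}) = V"
    using V basis_dim[OF w] vec.subspace_dim_equal[of "vec.span (w ` {..<k})" V]
    by (simp add: cspace_def cdim_def)
  with w show ?thesis by simp
qed

lemmas basis_if_dual = basis_if_basis_of_span[OF basis_of_span_if_dual]
  and basis_if_independent = basis_if_basis_of_span[OF basis_of_span_if_independent]

lemma separating_functional:
  assumes "cspace U" "(v :: complex^'n) \<notin> U"
  shows "\<exists>\<phi>. lfun \<phi> \<and> (\<forall>x\<in>U. \<phi> x = 0) \<and> \<phi> v = 1"
proof -
  obtain B where B: "B \<subseteq> U" "vec.independent B" "vec.span B = U"
    using vec.basis_subspace_exists assms cspace_def by metis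
  then have "vec.independent (insert v B)" using assms by (simp add: vec.independent_insert)
  from lfun_extend[OF this, of "\<lambda>x. if x = v then 1 else 0"]
  obtain \<phi> where \<phi>: "lfun \<phi>" "\<forall>x\<in>insert v B. \<phi> x = (if x = v then 1 else 0)" by blast
  have "\<phi> x = 0" if "x \<in> U" for x
    by (rule lfun_vanish_span[of \<phi> B]) (use \<phi> B assms that in auto)
  then show ?thesis using \<phi> by auto
qed

text \<open>The matrix \<open>C\<close> that expresses \<open>w\<close> in \<open>u\<close> factors
  out, so \<open>\<kappa>\<close> is its determinant and is independent of the functionals. It is
  nonzero because on functionals dual to \<open>w\<close> the left side is 1.\<close>

lemma basis_change:
  assumes "is_basis_of k u V" "is_basis_of k w V"
  shows "\<exists>\<kappa>. \<kappa> \<noteq> 0 \<and> (\<forall>\<phi>. (\<forall>j<k. lfun (\<phi> j)) \<longrightarrow>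
      dt k (\<lambda>i j. \<phi> j (w i)) = \<kappa> * dt k (\<lambda>i j. \<phi> j (u i)))"
proof -
  have "\<exists>C. \<forall>i<k. w i = (\<Sum>l<k. C i l *s u l)"
    using basis_expand[OF assms(1) basis_mem[OF assms(2)]] by metis
  then obtain C where C: "\<And>i. i < k \<Longrightarrow> w i = (\<Sum>l<k. C i l *s u l)" by blast
  have *: "dt k (\<lambda>i j. \<phi> j (w i)) = dt k C * dt k (\<lambda>i j. \<phi> j (u i))" if "\<forall>j<k. lfun (\<phi> j)" for \<phi>
    unfolding dt_mult[symmetric] using that C by (intro dt_cong) (simp add: lfun_sum lfun_scale)
  obtain \<psi> where \<psi>: "\<forall>j. lfun (\<psi> j)" "\<forall>i<k. \<forall>j<k. \<psi> j (w i) = (if i = j then 1 else 0)"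
    using dual_exists[OF assms(2)] by blast
  have "dt k (\<lambda>i j. \<psi> j (w i)) = dt k (\<lambda>i j. if i = j then 1 else 0)" using \<psi> by (intro dt_cong) auto
  then have "dt k C \<noteq> 0" using *[of \<psi>] \<psi> by (auto simp: dt_one)
  with * show ?thesis by blast
qed

text \<open>Where the minor for \<open>\<psi>\<close> is nonzero, the inverse of its matrix turns
  \<open>u\<close> into a basis dual to \<open>\<psi>\<close>; this is the affine chart of the
  Grassmannian attached to \<open>\<psi>\<close>. Evaluating \<open>basis_change\<close> at
  \<open>\<psi>\<close> itself identifies the factor in the last clause.\<close>

lemma dual_frame:
  assumes u: "is_basis_of k u V" and \<psi>: "\<forall>j<k. lfun (\<psi> j)" and nz: "dt k (\<lambda>i j. \<psi> j (u i)) \<noteq> 0"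
  shows "\<exists>w. is_basis_of k w V \<and> (\<forall>i<k. \<forall>j<k. \<psi> j (w i) = (if i = j then 1 else 0)) \<and>
    (\<forall>\<phi>. (\<forall>j<k. lfun (\<phi> j)) \<longrightarrow>
       dt k (\<lambda>i j. \<phi> j (u i)) = dt k (\<lambda>i j. \<psi> j (u i)) * dt k (\<lambda>i j. \<phi> j (w i)))"
proof -
  obtain C where C: "\<And>i j. i < k \<Longrightarrow> j < k \<Longrightarrow> (\<Sum>l<k. C i l * \<psi> j (u l)) = (if i = j then 1 else 0)"
    using dt_left_inverse[OF nz] by blast
  define w where "w i = (\<Sum>l<k. C i l *s u l)" for i
  have w1: "\<psi> j (w i) = (if i = j then 1 else 0)" if "i < k" "j < k" for i j
    using C[OF that] \<psi> that by (simp add: w_def lfun_sum lfun_scale)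
  have "w i \<in> V" for i
    unfolding w_def using basis_mem[OF u] basis_cspace[OF u]
    by (auto simp: cspace_def intro!: vec.subspace_sum vec.subspace_scale)
  then have w2: "is_basis_of k w V"
    using w1 \<psi> by (intro basis_if_dual[of k \<psi> w V] basis_cspace[OF u] basis_dim[OF u]) auto
  obtain \<kappa> where \<kappa>: "\<forall>\<phi>. (\<forall>j<k. lfun (\<phi> j)) \<longrightarrow>
      dt k (\<lambda>i j. \<phi> j (w i)) = \<kappa> * dt k (\<lambda>i j. \<phi> j (u i))"
    using basis_change[OF u w2] by blast
  have "dt k (\<lambda>i j. \<psi> j (w i)) = dt k (\<lambda>i j. if i = j then 1 else 0)" using w1 by (intro dt_cong) auto
  then have "\<kappa> * dt k (\<lambda>i j. \<psi> j (u i)) = 1" using \<kappa> \<psi> by (simp add: dt_one)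
  then have "dt k (\<lambda>i j. \<phi> j (u i)) = dt k (\<lambda>i j. \<psi> j (u i)) * dt k (\<lambda>i j. \<phi> j (w i))"
    if "\<forall>j<k. lfun (\<phi> j)" for \<phi>
    using \<kappa> that by (simp add: mult.assoc[symmetric] mult.commute[of _ \<kappa>])
  with w1 w2 show ?thesis by blast
qed

text \<open>In a dual frame coordinates are minors: exchanging one functional reads off its value on
  one frame vector. Thus polynomial minors yield rational formulas for the frame.\<close>

lemma dt_dual_replace:
  assumes "\<forall>i<k. \<forall>j<k. \<psi> j (w i) = (if i = j then 1 else (0::complex))" "l < k"
  shows "dt k (\<lambda>i j. (\<psi>(l := \<phi>)) j (w i)) = \<phi> (w l)"
  using dt_one_column[OF assms(2), of "\<lambda>i. \<phi> (w i)"] assms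
  by (subst dt_cong[of k _ "\<lambda>i j. if j = l then \<phi> (w i) else if i = j then 1 else 0"]) auto

text \<open>Some basis vector has a nonzero value under \<open>\<phi>\<close>. After moving it to
  place \<open>l\<close> and putting \<open>\<phi>\<close> at this place of the dual basis, the
  determinant is that value.\<close>

lemma functional_in_nonzero_dt:
  assumes u: "is_basis_of k u V" and \<phi>: "lfun \<phi>" "x \<in> V" "\<phi> x \<noteq> 0" and l: "l < k"
  shows "\<exists>\<psi>. (\<forall>j. lfun (\<psi> j)) \<and> \<psi> l = \<phi> \<and> dt k (\<lambda>i j. \<psi> j (u i)) \<noteq> 0"
proof -
  have "\<exists>i<k. \<phi> (u i) \<noteq> 0"
    using lfun_vanish_span[OF \<phi>(1), of "u ` {..<k}" x] \<phi> u by (auto simp: is_basis_of_def)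
  then obtain i where i: "i < k" "\<phi> (u i) \<noteq> 0" by blast
  define w where "w = u \<circ> Transposition.transpose i l"
  have "bij_betw (Transposition.transpose i l) {..<k} {..<k}"
    using i l by (simp add: bij_betw_transpose_iff)
  then have w: "is_basis_of k w V" using u
    unfolding is_basis_of_def w_def image_comp[symmetric] bij_betw_def
    by (auto intro: comp_inj_on)
  obtain \<psi> where \<psi>: "\<forall>j. lfun (\<psi> j)" "\<forall>i<k. \<forall>j<k. \<psi> j (w i) = (if i = j then 1 else 0)"
    using dual_exists[OF w] by blast
  obtain \<kappa> where \<kappa>: "\<forall>\<phi>. (\<forall>j<k. lfun (\<phi> j)) \<longrightarrow>
      dt k (\<lambda>i j. \<phi> j (w i)) = \<kappa> * dt k (\<lambda>i j. \<phi> j (u i))"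
    using basis_change[OF u w] by blast
  have "dt k (\<lambda>i j. (\<psi>(l := \<phi>)) j (w i)) = \<phi> (u i)"
    using dt_dual_replace[of k \<psi> w l \<phi>] \<psi>(2) l by (simp add: w_def)
  then show ?thesis using i \<psi>(1) \<phi>(1) \<kappa>[rule_format, of "\<psi>(l := \<phi>)"]
    by (intro exI[of _ "\<psi>(l := \<phi>)"]) auto
qed

text \<open>Expansion along the row of \<open>v\<close>: for fixed \<open>v\<close> the minors of
  the enlarged subspace are linear combinations of the k-minors with constant coefficients, so
  adding a fixed vector to a family does not raise the degree.\<close>

lemma dt_append:
  "dt (Suc k) (\<lambda>i j. \<phi> j (if i < k then u i else v)) =
   (\<Sum>j<Suc k. \<phi> j v * ((-1)^(k+j) * dt k (\<lambda>i l. \<phi> (skip j l) (u i))))"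
proof -
  have "dt k (\<lambda>i l. \<phi> (skip j l) (if i < k then u i else v)) = dt k (\<lambda>i l. \<phi> (skip j l) (u i))" for j
    by (rule dt_cong) simp
  then show ?thesis unfolding dt_last_row by simp
qed

lemma dt_append_span:
  assumes \<phi>: "\<forall>j. lfun (\<phi> j)" and v: "v \<in> vec.span (u ` {..<k})"
  shows "dt (Suc k) (\<lambda>i j. \<phi> j (if i < k then u i else v)) = 0"
proof -
  let ?L = "\<lambda>v. dt (Suc k) (\<lambda>i j. \<phi> j (if i < k then u i else v))"
  have "lfun ?L" unfolding lfun_def dt_append using \<phi>
    by (simp add: lfun_add lfun_scale sum.distrib sum_distrib_left algebra_simps)
  moreover have "?L x = 0" if "x \<in> u ` {..<k}" for x
  proof -
    obtain i where "i < k" "x = u i" using \<open>x \<in> u ` {..<k}\<close> by auto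
    then show ?thesis by (intro dt_eq_row[of i _ k]) auto
  qed
  ultimately show ?thesis using v by (rule lfun_vanish_span)
qed

section \<open>Adding a vector and cutting with a hyperplane\<close>

lemma basis_append:
  assumes "is_basis_of k u V" "v \<notin> V"
  shows "is_basis_of (Suc k) (\<lambda>i. if i < k then u i else v) (vec.span (insert v V))"
proof -
  let ?w = "\<lambda>i. if i < k then u i else v"
  have V: "V = vec.span (u ` {..<k})" using assms(1) by (simp add: is_basis_of_def)
  have im: "?w ` {..<Suc k} = insert v (u ` {..<k})" by (auto simp: lessThan_Suc)
  have sp: "vec.span (insert v V) = vec.span (?w ` {..<Suc k})"
    unfolding im vec.span_eq using vec.span_mono[of "u ` {..<k}" "insert v (u ` {..<k})"]
    vec.span_superset[of "u ` {..<k}"] vec.span_superset[of "insert v V"] by (auto simp: V intro: vec.span_base)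
  have "vec.dim (?w ` {..<Suc k}) = Suc k"
    using assms(2) basis_dim[OF assms(1)] unfolding im
    by (simp add: vec.dim_insert V cdim_def)
  then show ?thesis unfolding sp by (intro basis_if_span) (auto simp: cdim_def)
qed

lemma nonzero_dt_exists:
  assumes "is_basis_of k u V"
  shows "\<exists>\<phi>. (\<forall>j. lfun (\<phi> j)) \<and> dt k (\<lambda>i j. \<phi> j (u i)) \<noteq> 0"
proof -
  obtain \<psi> where \<psi>: "\<forall>j. lfun (\<psi> j)" "\<forall>i<k. \<forall>j<k. \<psi> j (u i) = (if i = j then 1 else 0)"
    using dual_exists[OF assms] by blast
  then have "dt k (\<lambda>i j. \<psi> j (u i)) = dt k (\<lambda>i j. if i = j then 1 else 0)" by (intro dt_cong) auto
  with \<psi> show ?thesis by (metis dt_one zero_neq_one)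
qed

lemma nonzero_dt_append:
  assumes "is_basis_of k u V" "v \<notin> V"
  shows "\<exists>\<phi>. (\<forall>j. lfun (\<phi> j)) \<and> dt (Suc k) (\<lambda>i j. \<phi> j (if i < k then u i else v)) \<noteq> 0"
  using nonzero_dt_exists[OF basis_append[OF assms]] .

lemma dim_kernel:
  assumes "cspace V" "lfun \<phi>" "x \<in> V" "\<phi> x \<noteq> 0"
  shows "cspace (V \<inter> {v. \<phi> v = 0})" "V = vec.span (insert x (V \<inter> {v. \<phi> v = 0}))"
    "cdim V = Suc (cdim (V \<inter> {v. \<phi> v = 0}))"
proof -
  let ?K = "V \<inter> {v. \<phi> v = 0}"
  show K: "cspace ?K" using assms
    by (auto simp: cspace_def vec.subspace_def lfun_add lfun_scale lfun_zero)
  show V: "V = vec.span (insert x ?K)"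
  proof
    show "V \<subseteq> vec.span (insert x ?K)"
    proof
      fix v assume "v \<in> V"
      then have "v - (\<phi> v / \<phi> x) *s x \<in> ?K" using assms
        by (auto simp: cspace_def lfun_diff lfun_scale intro!: vec.subspace_diff vec.subspace_scale)
      then show "v \<in> vec.span (insert x ?K)" by (subst vec.span_insert) (blast intro: vec.span_base)
    qed
    show "vec.span (insert x ?K) \<subseteq> V"
      using assms by (intro vec.span_minimal) (auto simp: cspace_def)
  qed
  have "x \<notin> vec.span ?K" using K assms by (metis (mono_tags) IntE cspace_def mem_Collect_eq vec.span_eq_iff)
  then show "cdim V = Suc (cdim ?K)"
    by (metis V cdim_def vec.dim_insert vec.dim_span Suc_eq_plus1)
qed

text \<open>Up to a factor, the minors of the hyperplane section are the minors of \<open>V\<close>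
  with \<open>\<phi>\<close> in the last place. The factor is adjusted to a prescribed
  \<open>\<beta>\<close> so that a family can be divided by t - t0. The adjustment rescales basis
  vector number 0, hence \<open>0 < k\<close>.\<close>

lemma kernel_basis:
  assumes u: "is_basis_of (Suc k) u V" and k: "0 < k"
    and \<phi>: "lfun \<phi>" "x \<in> V" "\<phi> x \<noteq> 0" and \<beta>: "\<beta> \<noteq> 0"
  shows "\<exists>w. is_basis_of k w (V \<inter> {v. \<phi> v = 0}) \<and>
    (\<forall>\<psi>. (\<forall>j. lfun (\<psi> j)) \<longrightarrow>
       dt k (\<lambda>i j. \<psi> j (w i)) = \<beta> * dt (Suc k) (\<lambda>i j. (\<psi>(k := \<phi>)) j (u i)))"
proof -
  let ?K = "V \<inter> {v. \<phi> v = 0}"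
  note K = dim_kernel[OF basis_cspace[OF u] \<phi>]
  have "cdim ?K = k" using K(3) basis_dim[OF u] by simp
  then obtain w where w: "is_basis_of k w ?K" using basis_exists[OF K(1)] by blast
  have "is_basis_of (Suc k) (\<lambda>i. if i < k then w i else x) V"
    using basis_append[OF w, of x] K(2) \<phi> by simp
  then obtain \<kappa> where \<kappa>: "\<kappa> \<noteq> 0" "\<forall>\<psi>. (\<forall>j<Suc k. lfun (\<psi> j)) \<longrightarrow>
      dt (Suc k) (\<lambda>i j. \<psi> j (if i < k then w i else x)) = \<kappa> * dt (Suc k) (\<lambda>i j. \<psi> j (u i))"
    using basis_change[OF u] by blast
  have 1: "\<phi> x * dt k (\<lambda>i j. \<psi> j (w i)) = \<kappa> * dt (Suc k) (\<lambda>i j. (\<psi>(k := \<phi>)) j (u i))"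
    if "\<forall>j. lfun (\<psi> j)" for \<psi>
  proof -
    have "dt (Suc k) (\<lambda>i j. (\<psi>(k := \<phi>)) j (if i < k then w i else x))
       = \<phi> x * dt k (\<lambda>i j. (\<psi>(k := \<phi>)) j (if i < k then w i else x))"
      using basis_mem[OF w] by (subst dt_last_column) auto
    also have "dt k (\<lambda>i j. (\<psi>(k := \<phi>)) j (if i < k then w i else x)) = dt k (\<lambda>i j. \<psi> j (w i))"
      by (rule dt_cong) auto
    finally show ?thesis using \<kappa>(2)[rule_format, of "\<psi>(k := \<phi>)"] that \<phi>(1) by simp
  qed
  define c where "c = \<beta> * \<phi> x / \<kappa>"
  have c: "c \<noteq> 0" using \<beta> \<phi> \<kappa> by (simp add: c_def)
  define w' where "w' i = (if i = 0 then c else 1) *s w i" for i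
  have "vec.span (w' ` {..<k}) = ?K"
  proof
    show "vec.span (w' ` {..<k}) \<subseteq> ?K"
      using K(1) basis_mem[OF w] unfolding w'_def
      by (intro vec.span_minimal) (auto simp only: cspace_def intro!: vec.subspace_scale)
    have "w i \<in> vec.span (w' ` {..<k})" if "i < k" for i
    proof -
      have "w i = (1 / (if i = 0 then c else 1)) *s w' i" using c by (simp add: w'_def)
      then show ?thesis using that by (metis imageI lessThan_iff vec.span_base vec.span_scale)
    qed
    then have "vec.span (w ` {..<k}) \<subseteq> vec.span (w' ` {..<k})"
      by (intro vec.span_minimal) auto
    then show "?K \<subseteq> vec.span (w' ` {..<k})" using w by (simp add: is_basis_of_def)
  qed
  then have w': "is_basis_of k w' ?K" using \<open>cdim ?K = k\<close> by (intro basis_if_span) auto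
  have "dt k (\<lambda>i j. \<psi> j (w' i)) = \<beta> * dt (Suc k) (\<lambda>i j. (\<psi>(k := \<phi>)) j (u i))"
    if "\<forall>j. lfun (\<psi> j)" for \<psi>
  proof -
    have "dt k (\<lambda>i j. \<psi> j (w' i)) = dt k (\<lambda>i j. (if i = 0 then c else 1) * \<psi> j (w i))"
      using that by (intro dt_cong) (simp add: w'_def lfun_scale)
    also have "\<dots> = c * dt k (\<lambda>i j. \<psi> j (w i))" using k by (rule dt_scale_row)
    also have "\<dots> = \<beta> * dt (Suc k) (\<lambda>i j. (\<psi>(k := \<phi>)) j (u i))"
      using 1[OF that] \<kappa>(1) \<phi>(3) by (simp add: c_def field_simps)
    finally show ?thesis .
  qed
  with w' show ?thesis by blast
qed

section \<open>Families of subspaces with polynomial minors\<close>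

lemma pval_simps [simp]:
  "pval d q (Some t) = poly q t" "pval d q None = coeff q d"
  "pval d 0 x = 0" "pval d (smult c q) x = c * pval d q x"
  by (auto simp: pval_def split: option.split)

lemma pval_sum: "pval d (\<Sum>i\<in>A. q i) x = (\<Sum>i\<in>A. pval d (q i) x)"
  by (cases x) (auto simp: poly_sum coeff_sum)

lemma poly_eq_0_if_infinite:
  "infinite Y \<Longrightarrow> (\<And>t. t \<in> Y \<Longrightarrow> poly q t = (0::complex)) \<Longrightarrow> q = 0"
  using poly_roots_finite[of q] finite_subset[of Y "{t. poly q t = 0}"] by blast

lemma poly_divide_root:
  fixes Q :: "complex poly"
  assumes "degree Q \<le> Suc d" "poly Q t0 = 0"
  obtains R where "degree R \<le> d" "\<And>t. poly Q t = (t - t0) * poly R t"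
proof -
  obtain R where R: "Q = [:- t0, 1:] * R" using assms(2) by (auto simp: poly_eq_0_iff_dvd)
  have "degree R \<le> d"
  proof (cases "R = 0")
    case False
    then have "degree Q = Suc (degree R)" unfolding R by (subst degree_mult_eq) auto
    then show ?thesis using assms(1) by simp
  qed simp
  then show ?thesis using that[of R] by (simp add: R algebra_simps)
qed

text \<open>The bases \<open>u x\<close> are part of the data because the minors must equal
  polynomial values exactly, not up to a factor depending on \<open>x\<close>. The set
  \<open>X\<close> allows points to be discarded when a linear factor is divided out.\<close>

definition fam :: "nat \<Rightarrow> nat \<Rightarrow> complex option set \<Rightarrow> (complex option \<Rightarrow> (complex^'n) set) \<Rightarrow>
    (complex option \<Rightarrow> nat \<Rightarrow> complex^'n) \<Rightarrow> bool" where
  "fam k d X f u \<longleftrightarrow> (\<forall>x\<in>X. is_basis_of k (u x) (f x)) \<and>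
     (\<forall>\<phi>. (\<forall>j. lfun (\<phi> j)) \<longrightarrow>
        (\<exists>q. degree q \<le> d \<and> (\<forall>x\<in>X. pval d q x = dt k (\<lambda>i j. \<phi> j (u x i)))))"

lemma fam_basis: "fam k d X f u \<Longrightarrow> x \<in> X \<Longrightarrow> is_basis_of k (u x) (f x)"
  by (simp add: fam_def)

lemma fam_poly:
  assumes "fam k d X f u" "\<And>j. lfun (\<phi> j)"
  obtains q where "degree q \<le> d" "\<And>x. x \<in> X \<Longrightarrow> pval d q x = dt k (\<lambda>i j. \<phi> j (u x i))"
  using assms unfolding fam_def by blast

lemma plucker_eq_dt: "plucker k u \<sigma> = dt k (\<lambda>i j. u i $ \<sigma> j)"
  unfolding plucker_def dt_rows ..

text \<open>Expanding every functional in coordinates makes each minor a fixed linear combination of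
  Pluecker coordinates, so the degree bound passes from the latter to arbitrary functionals.\<close>

lemma dt_eq_sum_plucker:
  fixes u :: "nat \<Rightarrow> complex^'n"
  assumes "\<And>j. lfun (\<phi> j)"
  shows "dt k (\<lambda>i j. \<phi> j (u i)) =
    (\<Sum>\<tau>\<in>PiE {..<k} (\<lambda>_. UNIV). (\<Prod>j<k. \<phi> j (axis (\<tau> j) 1)) * plucker k u \<tau>)"
proof -
  have "dt k (\<lambda>i j. \<phi> j (u i)) = (\<Sum>p | p permutes {..<k}. of_int (sign p) *
      (\<Prod>j<k. \<Sum>c\<in>UNIV. \<phi> j (axis c 1) * u (p j) $ c))"
    unfolding dt_columns by (subst (1) lfun_expand[OF assms]) simp
  also have "\<dots> = (\<Sum>p | p permutes {..<k}. of_int (sign p) *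
      (\<Sum>\<tau>\<in>PiE {..<k} (\<lambda>_. UNIV). \<Prod>j<k. \<phi> j (axis (\<tau> j) 1) * u (p j) $ \<tau> j))"
    by (subst prod_sum_PiE) auto
  also have "\<dots> = (\<Sum>\<tau>\<in>PiE {..<k} (\<lambda>_. UNIV). \<Sum>p | p permutes {..<k}. of_int (sign p) *
       (\<Prod>j<k. \<phi> j (axis (\<tau> j) 1) * u (p j) $ \<tau> j))"
    unfolding sum_distrib_left by (rule sum.swap)
  also have "\<dots> = (\<Sum>\<tau>\<in>PiE {..<k} (\<lambda>_. UNIV). (\<Prod>j<k. \<phi> j (axis (\<tau> j) 1)) * plucker k u \<tau>)"
    unfolding plucker_eq_dt dt_columns by (simp add: prod.distrib sum_distrib_left mult_ac)
  finally show ?thesis .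
qed

lemma morphism_fam:
  fixes f :: "complex option \<Rightarrow> (complex^'n) set"
  assumes "morphism_deg k d f"
  obtains u where "fam k d UNIV f u"
proof -
  obtain p :: "(nat \<Rightarrow> 'n) \<Rightarrow> complex poly" where p: "\<And>\<sigma>. degree (p \<sigma>) \<le> d"
    "\<And>x. \<exists>u. is_basis_of k u (f x) \<and> (\<forall>\<sigma>. pval d (p \<sigma>) x = plucker k u \<sigma>)"
    using assms unfolding morphism_deg_def by blast
  then obtain u where u: "\<And>x. is_basis_of k (u x) (f x)" "\<And>x \<sigma>. pval d (p \<sigma>) x = plucker k (u x) \<sigma>"
    by metis
  have "\<exists>q. degree q \<le> d \<and> (\<forall>x. pval d q x = dt k (\<lambda>i j. \<phi> j (u x i)))" if "\<And>j. lfun (\<phi> j)" for \<phi>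
  proof (intro exI conjI allI)
    let ?q = "\<Sum>\<tau>\<in>PiE {..<k} (\<lambda>_. UNIV). smult (\<Prod>j<k. \<phi> j (axis (\<tau> j) 1)) (p \<tau>)"
    show "degree ?q \<le> d" using p(1)
      by (intro degree_sum_le) (auto intro: finite_PiE order.trans[OF degree_smult_le])
    show "pval d ?q x = dt k (\<lambda>i j. \<phi> j (u x i))" for x
      unfolding dt_eq_sum_plucker[OF that] pval_sum by (simp add: u)
  qed
  with u have "fam k d UNIV f u" by (simp add: fam_def)
  then show ?thesis by (rule that)
qed

text \<open>A vector of \<open>f x\<close> outside \<open>U\<close> is detected by a functional that
  vanishes on \<open>U\<close>. A minor containing this functional is zero for infinitely many
  parameters, hence the zero polynomial, but it can be chosen nonzero at \<open>x\<close>.\<close>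

lemma fam_subset_closed:
  assumes fam: "fam k d X f u" and U: "cspace U" and Y: "infinite Y" "Some ` Y \<subseteq> X"
    and sub: "\<And>t. t \<in> Y \<Longrightarrow> f (Some t) \<subseteq> U" and x: "x \<in> X"
  shows "f x \<subseteq> U"
proof (rule ccontr)
  assume "\<not> f x \<subseteq> U"
  then obtain w where w: "w \<in> f x" "w \<notin> U" by blast
  then obtain \<phi> where \<phi>: "lfun \<phi>" "\<forall>x\<in>U. \<phi> x = 0" "\<phi> w = 1"
    using separating_functional[OF U] by blast
  \<comment> \<open>The minor needs a place for \<open>\<phi>\<close>; for k = 0 the subspace is
    zero and lies in \<open>U\<close>.\<close>
  have "0 < k"
  proof (rule ccontr)
    assume "\<not> 0 < k"
    then have "f x = {0}" using fam_basis[OF fam x] by (simp add: is_basis_of_def)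
    then show False using w U by (simp add: cspace_def vec.subspace_0)
  qed
  then obtain \<psi> where \<psi>: "\<forall>j. lfun (\<psi> j)" "\<psi> 0 = \<phi>" "dt k (\<lambda>i j. \<psi> j (u x i)) \<noteq> 0"
    using functional_in_nonzero_dt[OF fam_basis[OF fam x] \<phi>(1) w(1), of 0] \<phi> by auto
  obtain q where q: "\<And>x. x \<in> X \<Longrightarrow> pval d q x = dt k (\<lambda>i j. \<psi> j (u x i))"
    using fam_poly[OF fam, of \<psi>] \<psi> by metis
  have "q = 0"
  proof (rule poly_eq_0_if_infinite[OF Y(1)])
    fix t assume t: "t \<in> Y"
    then have "Some t \<in> X" using Y by auto
    then have "dt k (\<lambda>i j. \<psi> j (u (Some t) i)) = 0"
      using sub[OF t] basis_mem[OF fam_basis[OF fam]] \<phi> \<psi> \<open>0 < k\<close>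
      by (intro dt_zero_column[of 0]) auto
    then show "poly q t = 0" using q[OF \<open>Some t \<in> X\<close>] by simp
  qed
  then show False using q[OF x] \<psi> by simp
qed

lemma fam_append_poly:
  assumes fam: "fam k d X f u" and \<phi>: "\<And>j. lfun (\<phi> j)"
  obtains Q where "degree Q \<le> d"
    "\<And>x. x \<in> X \<Longrightarrow> pval d Q x = dt (Suc k) (\<lambda>i j. \<phi> j (if i < k then u x i else v))"
proof -
  have "\<exists>q. degree q \<le> d \<and> (\<forall>x\<in>X. pval d q x = dt k (\<lambda>i l. \<phi> (skip j l) (u x i)))" for j
    using fam_poly[OF fam, of "\<lambda>l. \<phi> (skip j l)"] \<phi> by metis
  then obtain q where q: "\<And>j. degree (q j) \<le> d"
      "\<And>x j. x \<in> X \<Longrightarrow> pval d (q j) x = dt k (\<lambda>i l. \<phi> (skip j l) (u x i))"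
    by metis
  show ?thesis
  proof (rule that)
    let ?Q = "\<Sum>j<Suc k. smult (\<phi> j v * (-1)^(k+j)) (q j)"
    show "degree ?Q \<le> d" using q(1)
      by (intro degree_sum_le) (auto intro: order.trans[OF degree_smult_le])
    show "pval d ?Q x = dt (Suc k) (\<lambda>i j. \<phi> j (if i < k then u x i else v))" if "x \<in> X" for x
      unfolding dt_append pval_sum using q(2)[OF that] by (simp only: pval_simps mult.assoc)
  qed
qed

text \<open>If \<open>v\<close> lies in a member, all minors of the family with \<open>v\<close>
  appended vanish there, and one of these minors is nonzero at \<open>x\<close>, so it has finitely
  many roots.\<close>

lemma finite_fam_mem:
  assumes fam: "fam k d X f u" and x: "x \<in> X" "v \<notin> f x"
  shows "finite {t. Some t \<in> X \<and> v \<in> f (Some t)}"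
proof (rule ccontr)
  let ?Y = "{t. Some t \<in> X \<and> v \<in> f (Some t)}"
  assume inf: "infinite ?Y"
  obtain \<phi> where \<phi>: "\<forall>j. lfun (\<phi> j)" "dt (Suc k) (\<lambda>i j. \<phi> j (if i < k then u x i else v)) \<noteq> 0"
    using nonzero_dt_append[OF fam_basis[OF fam x(1)] x(2)] by blast
  obtain Q where Q: "\<And>x. x \<in> X \<Longrightarrow> pval d Q x = dt (Suc k) (\<lambda>i j. \<phi> j (if i < k then u x i else v))"
    using \<phi>(1) by (auto intro: fam_append_poly[OF fam, of \<phi>])
  have "Q = 0"
  proof (rule poly_eq_0_if_infinite[OF inf])
    fix t assume "t \<in> ?Y"
    then have t: "Some t \<in> X" "v \<in> f (Some t)" by auto
    then have "v \<in> vec.span (u (Some t) ` {..<k})"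
      using fam_basis[OF fam t(1)] by (simp add: is_basis_of_def)
    then show "poly Q t = 0" using Q[OF t(1)] dt_append_span[OF \<phi>(1)] by simp
  qed
  then show False using Q[OF x(1)] \<phi>(2) by simp
qed

lemma basis_not_subset:
  assumes "is_basis_of k u V" "is_basis_of k u' V'" "V \<noteq> V'"
  obtains v where "v \<in> V" "v \<notin> V'"
  using vec.subspace_dim_equal[of V V'] basis_cspace[OF assms(1)] basis_cspace[OF assms(2)]
    basis_dim[OF assms(1)] basis_dim[OF assms(2)] assms(3) by (auto simp: cspace_def cdim_def)

text \<open>Induction on the degree: each division by a linear factor trades one unit of degree for
  one dimension, so that k + d is preserved.\<close>

lemma fam_span_bound:
  assumes "fam k d (Some ` Y) f u" "infinite Y"
  shows "\<exists>U. cspace U \<and> cdim U \<le> k + d \<and> (\<forall>t\<in>Y. f (Some t) \<subseteq> U)"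
  using assms
proof (induction d arbitrary: k Y f u)
  case (0 k Y f u)
  note fam = "0.prems"(1)
  obtain t0 where t0: "t0 \<in> Y" using "0.prems"(2) infinite_imp_nonempty by blast
  have "f (Some t0) = f (Some t1)" if t1: "t1 \<in> Y" for t1
  proof (rule ccontr)
    assume "f (Some t0) \<noteq> f (Some t1)"
    then obtain v where v: "v \<in> f (Some t0)" "v \<notin> f (Some t1)"
      using basis_not_subset[OF fam_basis[OF fam imageI[OF t0]] fam_basis[OF fam imageI[OF t1]]] by metis
    obtain \<phi> where \<phi>: "\<forall>j. lfun (\<phi> j)" "dt (Suc k) (\<lambda>i j. \<phi> j (if i < k then u (Some t1) i else v)) \<noteq> 0"
      using nonzero_dt_append[OF fam_basis[OF fam] v(2)] t1 by blast
    obtain Q where Q: "degree Q \<le> 0"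
       "\<And>x. x \<in> Some ` Y \<Longrightarrow> pval 0 Q x = dt (Suc k) (\<lambda>i j. \<phi> j (if i < k then u x i else v))"
      using \<phi>(1) by (auto intro: fam_append_poly[OF fam, of \<phi>])
    have "v \<in> vec.span (u (Some t0) ` {..<k})"
      using fam_basis[OF fam, of "Some t0"] v t0 by (simp add: is_basis_of_def)
    then have "poly Q t0 = 0" using Q(2)[of "Some t0"] t0 dt_append_span[OF \<phi>(1)] by simp
    moreover have "poly Q t1 \<noteq> 0" using Q(2)[of "Some t1"] t1 \<phi>(2) by simp
    moreover have "poly Q t0 = poly Q t1" using Q(1) by (auto elim!: degree_eq_zeroE)
    ultimately show False by simp
  qed
  then have eq: "\<forall>t\<in>Y. f (Some t) = f (Some t0)" by metis
  have "is_basis_of k (u (Some t0)) (f (Some t0))" using fam_basis[OF fam] t0 by blast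
  from basis_dim[OF this] basis_cspace[OF this] eq show ?case
    by (intro exI[of _ "f (Some t0)"] conjI ballI) (simp, simp, metis order_refl)
next
  case (Suc d k Y f u)
  note fam = Suc.prems(1)
  show ?case
  proof (cases "\<exists>t0\<in>Y. \<forall>t\<in>Y. f (Some t) = f (Some t0)")
    case True
    then obtain t0 where t0: "t0 \<in> Y" "\<forall>t\<in>Y. f (Some t) = f (Some t0)" by blast
    then have "is_basis_of k (u (Some t0)) (f (Some t0))" using fam_basis[OF fam] by blast
    from basis_dim[OF this] basis_cspace[OF this] t0(2) show ?thesis
      by (intro exI[of _ "f (Some t0)"] conjI ballI) (simp, simp, metis order_refl)
  next
    case False
    obtain t0 where t0: "t0 \<in> Y" using Suc.prems(2) infinite_imp_nonempty by blast
    with False obtain t1 where t1: "t1 \<in> Y" "f (Some t1) \<noteq> f (Some t0)" by blast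
    \<comment> \<open>As \<open>v\<close> lies in f(t0), the enlarged minors vanish at
      \<open>t0\<close>; as it is missing from f(t1), the rank grows by one for all but finitely
      many parameters.\<close>
    then obtain v where v: "v \<in> f (Some t0)" "v \<notin> f (Some t1)"
      using basis_not_subset fam_basis[OF fam] t0 by (metis imageI)
    define Z where "Z = insert t0 {t \<in> Y. v \<in> f (Some t)}"
    have "finite {t \<in> Y. v \<in> f (Some t)}"
      by (rule finite_subset[OF _ finite_fam_mem[OF fam, of "Some t1" v]]) (use t1(1) v(2) in auto)
    then have "finite Z" by (simp add: Z_def)
    then have Y': "infinite (Y - Z)" using Suc.prems by simp
    \<comment> \<open>Scaling the appended vector carries out the division: every enlarged minor is
      multiplied by 1 / (t - t0), while the spanned subspace stays the same.\<close>
    define c where "c x = 1 / (the x - t0)" for x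
    define u' where "u' x i = (if i < k then u x i else c x *s v)" for x i
    define f' where "f' x = vec.span (insert (c x *s v) (f x))" for x
    have fam': "fam (Suc k) d (Some ` (Y - Z)) f' u'"
      unfolding fam_def
    proof (intro conjI ballI allI impI)
      fix x assume "x \<in> Some ` (Y - Z)"
      then obtain t where t: "x = Some t" "t \<in> Y" "v \<notin> f x" "t \<noteq> t0" by (auto simp: Z_def)
      have "c x *s v \<notin> f x"
      proof
        assume "c x *s v \<in> f x"
        moreover have "vec.subspace (f x)"
          using basis_cspace[OF fam_basis[OF fam, of x]] t by (simp add: cspace_def)
        ultimately have "(t - t0) *s (c x *s v) \<in> f x" by (rule vec.subspace_scale[rotated])
        moreover have "(t - t0) *s (c x *s v) = v" using t by (simp add: c_def vector_smult_assoc)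
        ultimately show False using t by simp
      qed
      then show "is_basis_of (Suc k) (u' x) (f' x)"
        unfolding u'_def f'_def using t by (intro basis_append fam_basis[OF fam]) auto
    next
      fix \<phi> :: "nat \<Rightarrow> complex^'a \<Rightarrow> complex" assume \<phi>: "\<forall>j. lfun (\<phi> j)"
      obtain Q where Q: "degree Q \<le> Suc d"
         "\<And>x. x \<in> Some ` Y \<Longrightarrow> pval (Suc d) Q x = dt (Suc k) (\<lambda>i j. \<phi> j (if i < k then u x i else v))"
        using \<phi> by (auto intro: fam_append_poly[OF fam, of \<phi>])
      have "v \<in> vec.span (u (Some t0) ` {..<k})"
        using fam_basis[OF fam, of "Some t0"] v t0 by (simp add: is_basis_of_def)
      then have "poly Q t0 = 0" using Q(2)[of "Some t0"] t0 dt_append_span[OF \<phi>] by simp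
      then obtain R where R: "degree R \<le> d" "\<And>t. poly Q t = (t - t0) * poly R t"
        using poly_divide_root[OF Q(1)] by blast
      have "pval d R x = dt (Suc k) (\<lambda>i j. \<phi> j (u' x i))" if x: "x \<in> Some ` (Y - Z)" for x
      proof -
        obtain t where t: "x = Some t" "t \<in> Y" "t \<noteq> t0" using x by (auto simp: Z_def)
        have "dt (Suc k) (\<lambda>i j. \<phi> j (u' x i)) = c x * dt (Suc k) (\<lambda>i j. \<phi> j (if i < k then u x i else v))"
          unfolding u'_def dt_append using \<phi> by (simp add: lfun_scale sum_distrib_left algebra_simps)
        also have "\<dots> = c x * ((t - t0) * poly R t)"
          using Q(2)[of x] t by (simp add: R(2))
        finally show ?thesis using t by (simp add: c_def)
      qed
      with R(1) show "\<exists>q. degree q \<le> d \<and> (\<forall>x\<in>Some ` (Y - Z). pval d q x = dt (Suc k) (\<lambda>i j. \<phi> j (u' x i)))"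
        by blast
    qed
    obtain U where U: "cspace U" "cdim U \<le> Suc k + d" "\<forall>t\<in>Y - Z. f' (Some t) \<subseteq> U"
      using Suc.IH[OF fam' Y'] by blast
    \<comment> \<open>The discarded parameters in \<open>Z\<close> are recovered by
      closedness.\<close>
    have "f (Some t) \<subseteq> U" if "t \<in> Y" for t
    proof (rule fam_subset_closed[OF fam U(1) Y'])
      show "f (Some t) \<subseteq> U" if "t \<in> Y - Z" for t
        using U(3) that unfolding f'_def by (meson bspec order.trans subset_insertI vec.span_superset)
    qed (use that in auto)
    with U show ?thesis by (intro exI[of _ U]) auto
  qed
qed

text \<open>Dual to \<open>fam_span_bound\<close>: a hyperplane section lowers k and d together and
  preserves k - d. For d = 0 the span bound already makes the family constant.\<close>

lemma fam_kernel_bound: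
  assumes "fam k d (Some ` Y) f u" "infinite Y"
  shows "\<exists>U. cspace U \<and> k \<le> cdim U + d \<and> (\<forall>t\<in>Y. U \<subseteq> f (Some t))"
  using assms
proof (induction d arbitrary: k Y f u)
  case (0 k Y f u)
  obtain U where U: "cspace U" "cdim U \<le> k" "\<forall>t\<in>Y. f (Some t) \<subseteq> U"
    using fam_span_bound[OF 0] by auto
  have "f (Some t) = U" if "t \<in> Y" for t
    using U vec.subspace_dim_equal[of "f (Some t)" U] fam_basis[OF "0.prems"(1), of "Some t"] that
    by (metis basis_cspace basis_dim cdim_def cspace_def imageI)
  moreover have "k \<le> cdim U" using calculation fam_basis[OF "0.prems"(1)] "0.prems"(2)
    by (metis basis_dim equals0I finite.emptyI image_eqI order_refl)
  ultimately show ?case using U by auto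
next
  case (Suc d k Y f u)
  note fam = Suc.prems(1)
  \<comment> \<open>For k \<le> Suc d the zero space satisfies the bound. Splitting off this case
    leaves sections of positive dimension, as \<open>kernel_basis\<close> requires.\<close>
  consider "k \<le> Suc d" | "\<exists>t0\<in>Y. \<forall>t\<in>Y. f (Some t) = f (Some t0)"
    | "Suc d < k" "\<not> (\<exists>t0\<in>Y. \<forall>t\<in>Y. f (Some t) = f (Some t0))" by linarith
  then show ?case
  proof cases
    case 1
    then show ?thesis using basis_cspace[OF fam_basis[OF fam]]
      by (intro exI[of _ "{0}"]) (auto simp: cspace_def vec.subspace_0)
  next
    case 2
    then obtain t0 where t0: "t0 \<in> Y" "\<forall>t\<in>Y. f (Some t) = f (Some t0)" by blast
    then have "is_basis_of k (u (Some t0)) (f (Some t0))" using fam_basis[OF fam] by blast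
    from basis_dim[OF this] basis_cspace[OF this] t0(2) show ?thesis
      by (intro exI[of _ "f (Some t0)"] conjI ballI) (simp, simp, metis order_refl)
  next
    case 3
    then obtain l where l: "k = Suc l" "0 < l" by (cases k) auto
    obtain t0 where t0: "t0 \<in> Y" using Suc.prems(2) infinite_imp_nonempty by blast
    with 3 obtain t1 where t1: "t1 \<in> Y" "f (Some t1) \<noteq> f (Some t0)" by blast
    then obtain v where v: "v \<in> f (Some t1)" "v \<notin> f (Some t0)"
      using basis_not_subset fam_basis[OF fam] t0 by (metis imageI)
    \<comment> \<open>The hyperplane contains f(t0), so minors with \<open>\<phi>\<close> vanish at
      \<open>t0\<close>. It does not contain f(t1), so it contains f(t) for finitely many parameters
      only.\<close>
    obtain \<phi> where \<phi>: "lfun \<phi>" "\<forall>x\<in>f (Some t0). \<phi> x = 0" "\<phi> v = 1"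
      using separating_functional[OF basis_cspace[OF fam_basis[OF fam]] v(2)] t0 by auto
    obtain \<psi> where \<psi>: "\<forall>j. lfun (\<psi> j)" "\<psi> l = \<phi>" "dt k (\<lambda>i j. \<psi> j (u (Some t1) i)) \<noteq> 0"
      using functional_in_nonzero_dt[OF fam_basis[OF fam] \<phi>(1) v(1), of l] \<phi> t1 l by auto
    obtain q where q: "\<And>x. x \<in> Some ` Y \<Longrightarrow> pval (Suc d) q x = dt k (\<lambda>i j. \<psi> j (u x i))"
      using fam_poly[OF fam, of \<psi>] \<psi> by metis
    have "q \<noteq> 0" using q[of "Some t1"] t1 \<psi>(3) by auto
    define Z where "Z = insert t0 {t \<in> Y. \<forall>x\<in>f (Some t). \<phi> x = 0}"
    have "{t \<in> Y. \<forall>x\<in>f (Some t). \<phi> x = 0} \<subseteq> {t. poly q t = 0}"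
    proof clarify
      fix t assume t: "t \<in> Y" "\<forall>x\<in>f (Some t). \<phi> x = 0"
      have "dt k (\<lambda>i j. \<psi> j (u (Some t) i)) = 0"
        using t basis_mem[OF fam_basis[OF fam]] \<psi> l by (intro dt_zero_column[of l]) auto
      then show "poly q t = 0" using q[of "Some t"] t by simp
    qed
    then have "finite Z" using poly_roots_finite[OF \<open>q \<noteq> 0\<close>] finite_subset by (auto simp: Z_def)
    then have Y': "infinite (Y - Z)" using Suc.prems by simp
    define f' where "f' x = f x \<inter> {v. \<phi> v = 0}" for x
    have "\<exists>w. is_basis_of l w (f' x) \<and> (\<forall>\<psi>. (\<forall>j. lfun (\<psi> j)) \<longrightarrow>
       dt l (\<lambda>i j. \<psi> j (w i)) = 1 / (the x - t0) * dt (Suc l) (\<lambda>i j. (\<psi>(l := \<phi>)) j (u x i)))"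
      if x: "x \<in> Some ` (Y - Z)" for x
    proof -
      obtain t where t: "x = Some t" "t \<in> Y" "t \<noteq> t0" using x by (auto simp: Z_def)
      obtain y where y: "y \<in> f x" "\<phi> y \<noteq> 0" using x by (auto simp: Z_def)
      have "is_basis_of (Suc l) (u x) (f x)" using fam_basis[OF fam, of x] l t by simp
      from kernel_basis[OF this l(2) \<phi>(1) y, of "1 / (the x - t0)"] show ?thesis
        unfolding f'_def using t by simp
    qed
    then obtain u' where u': "\<And>x. x \<in> Some ` (Y - Z) \<Longrightarrow> is_basis_of l (u' x) (f' x)"
      "\<And>x \<psi>. x \<in> Some ` (Y - Z) \<Longrightarrow> (\<forall>j. lfun (\<psi> j)) \<Longrightarrow>
       dt l (\<lambda>i j. \<psi> j (u' x i)) = 1 / (the x - t0) * dt (Suc l) (\<lambda>i j. (\<psi>(l := \<phi>)) j (u x i))"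
      by metis
    have fam': "fam l d (Some ` (Y - Z)) f' u'"
      unfolding fam_def
    proof (intro conjI ballI allI impI)
      fix \<psi> :: "nat \<Rightarrow> complex^'a \<Rightarrow> complex" assume \<psi>: "\<forall>j. lfun (\<psi> j)"
      then have \<psi>': "lfun ((\<psi>(l := \<phi>)) j)" for j using \<phi> by auto
      obtain Q where Q: "degree Q \<le> Suc d"
         "\<And>x. x \<in> Some ` Y \<Longrightarrow> pval (Suc d) Q x = dt k (\<lambda>i j. (\<psi>(l := \<phi>)) j (u x i))"
        using fam_poly[OF fam, of "\<psi>(l := \<phi>)", OF \<psi>'] by blast
      have "dt k (\<lambda>i j. (\<psi>(l := \<phi>)) j (u (Some t0) i)) = 0"
        using t0 basis_mem[OF fam_basis[OF fam]] \<phi> l by (intro dt_zero_column[of l]) auto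
      then have "poly Q t0 = 0" using Q(2)[of "Some t0"] t0 by simp
      then obtain R where R: "degree R \<le> d" "\<And>t. poly Q t = (t - t0) * poly R t"
        using poly_divide_root[OF Q(1)] by blast
      have "pval d R x = dt l (\<lambda>i j. \<psi> j (u' x i))" if x: "x \<in> Some ` (Y - Z)" for x
      proof -
        obtain t where t: "x = Some t" "t \<in> Y" "t \<noteq> t0" using x by (auto simp: Z_def)
        have "dt l (\<lambda>i j. \<psi> j (u' x i)) = 1 / (t - t0) * ((t - t0) * poly R t)"
          using u'(2)[OF x \<psi>] Q(2)[of x] t l by (simp add: R(2))
        then show ?thesis using t by simp
      qed
      with R(1) show "\<exists>q. degree q \<le> d \<and> (\<forall>x\<in>Some ` (Y - Z). pval d q x = dt l (\<lambda>i j. \<psi> j (u' x i)))"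
        by blast
    qed (rule u')
    obtain U where U: "cspace U" "l \<le> cdim U + d" "\<forall>t\<in>Y - Z. U \<subseteq> f' (Some t)"
      using Suc.IH[OF fam' Y'] by blast
    have "U \<subseteq> f (Some t)" if "t \<in> Y" for t
    proof
      fix v assume v: "v \<in> U"
      show "v \<in> f (Some t)"
      proof (rule ccontr)
        assume "v \<notin> f (Some t)"
        then have "finite {t. Some t \<in> Some ` Y \<and> v \<in> f (Some t)}"
          using finite_fam_mem[OF fam, of "Some t"] that by blast
        moreover have "Y - Z \<subseteq> {t. Some t \<in> Some ` Y \<and> v \<in> f (Some t)}"
          using U(3) v by (auto simp: f'_def)
        ultimately show False using Y' finite_subset by blast
      qed
    qed
    with U l show ?thesis by (intro exI[of _ U]) auto
  qed
qed

section \<open>Kernel and span of a curve; vanishing at infinity\<close>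

lemma fam_subset: "fam k d X f u \<Longrightarrow> X' \<subseteq> X \<Longrightarrow> fam k d X' f u"
  unfolding fam_def by (meson subsetD)

lemma fam_cspace: "fam k d UNIV f u \<Longrightarrow> cspace (f x)"
  using basis_cspace[OF fam_basis] by blast

lemma Ker_Span_dim:
  assumes "morphism_deg k d f"
  shows "cspace (Ker_map f)" "cspace (Span_map f)" "k \<le> cdim (Ker_map f) + d" "cdim (Span_map f) \<le> k + d"
    "Ker_map f \<subseteq> f x" "f x \<subseteq> Span_map f"
proof -
  obtain u where fam: "fam k d UNIV f u" using morphism_fam[OF assms] .
  note fam' = fam_subset[OF fam subset_UNIV, of "Some ` UNIV"]
  have inf: "infinite (UNIV :: complex set)" by (rule infinite_UNIV_char_0)
  show K: "cspace (Ker_map f)" unfolding Ker_map_def cspace_def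
    using fam_cspace[OF fam] by (auto intro!: vec.subspace_Inter simp: cspace_def)
  show "cspace (Span_map f)" by (simp add: Span_map_def cspace_def)
  show "Ker_map f \<subseteq> f x" by (auto simp: Ker_map_def)
  show "f x \<subseteq> Span_map f" unfolding Span_map_def by (auto intro: vec.span_base)
  obtain U where U: "cspace U" "k \<le> cdim U + d" "\<forall>t. U \<subseteq> f (Some t)"
    using fam_kernel_bound[OF fam' inf] by auto
  \<comment> \<open>The point at stake is \<open>None\<close>: incidence that holds for all finite
    parameters persists at infinity.\<close>
  have "U \<subseteq> f x" for x
  proof (rule ccontr)
    assume "\<not> U \<subseteq> f x"
    then obtain v where "v \<in> U" "v \<notin> f x" by blast
    then have "finite {t. v \<in> f (Some t)}" using finite_fam_mem[OF fam, of x v] by simp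
    moreover have "{t. v \<in> f (Some t)} = UNIV" using U(3) \<open>v \<in> U\<close> by blast
    ultimately show False using inf by simp
  qed
  then have "U \<subseteq> Ker_map f" by (auto simp: Ker_map_def)
  then show "k \<le> cdim (Ker_map f) + d" using U(2) vec.dim_subset unfolding cdim_def
    by (metis add_le_mono1 order.trans)
  obtain W where W: "cspace W" "cdim W \<le> k + d" "\<forall>t. f (Some t) \<subseteq> W"
    using fam_span_bound[OF fam' inf] by auto
  have "f x \<subseteq> W" for x
    by (rule fam_subset_closed[OF fam W(1) inf]) (use W in auto)
  then have "Span_map f \<subseteq> W" unfolding Span_map_def
    using W(1) by (intro vec.span_minimal) (auto simp: cspace_def)
  then show "cdim (Span_map f) \<le> k + d" using W(2) vec.dim_subset unfolding cdim_def
    by (metis order.trans)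
qed

lemma degree_le_pred_if_coeff_0:
  assumes "degree q \<le> d" "coeff q d = 0" shows "degree q \<le> d - 1"
  using assms by (cases "degree q = d") (auto simp: leading_coeff_0_iff)

text \<open>One zero column at infinity only shows that \<open>q\<close> drops by one degree; the
  order \<open>card J\<close> needs a frame. Since \<open>\<eta>\<close> is a chart at infinity, its
  minor \<open>L\<close> has degree exactly \<open>d\<close>. The values of \<open>\<phi>\<close> on
  the dual frame, multiplied by \<open>L\<close>, form a matrix with determinant L^(k-1) q, and
  comparing degrees gives the bound.\<close>

lemma fam_degree_at_infinity:
  assumes fam: "fam k d UNIV f u" and k: "0 < k" and \<phi>: "\<And>j. lfun (\<phi> j)"
    and J: "J \<subseteq> {..<k}" "\<And>j v. j \<in> J \<Longrightarrow> v \<in> f None \<Longrightarrow> \<phi> j v = 0"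
    and q: "degree q \<le> d" "\<And>x. pval d q x = dt k (\<lambda>i j. \<phi> j (u x i))" "q \<noteq> 0"
  shows "degree q + card J \<le> d"
proof -
  note basis = fam_basis[OF fam UNIV_I]
  have finJ: "finite J" using J(1) finite_subset by blast
  obtain \<eta> where \<eta>: "\<forall>j. lfun (\<eta> j)" "dt k (\<lambda>i j. \<eta> j (u None i)) \<noteq> 0"
    using nonzero_dt_exists[OF basis] by blast
  obtain L where L: "degree L \<le> d" "\<And>x. pval d L x = dt k (\<lambda>i j. \<eta> j (u x i))"
    using fam_poly[OF fam, of \<eta>] \<eta> by (metis UNIV_I)
  have degL: "degree L = d" "L \<noteq> 0"
    using L(1) L(2)[of None] \<eta>(2) le_degree[of L d] by auto
  have "\<exists>m. degree m \<le> d \<and> (\<forall>x. pval d m x = dt k (\<lambda>a b. (\<eta>(i := \<phi> j)) b (u x a)))" for i j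
    using fam_poly[OF fam, of "\<eta>(i := \<phi> j)"] \<eta> \<phi> by (metis UNIV_I fun_upd_def)
  then obtain m where m: "\<And>i j. degree (m i j) \<le> d"
    "\<And>i j x. pval d (m i j) x = dt k (\<lambda>a b. (\<eta>(i := \<phi> j)) b (u x a))" by metis
  have mJ: "coeff (m i j) d = 0" if "i < k" "j \<in> J" for i j
    using m(2)[of i j None] that J(2)[OF that(2)] basis_mem[OF basis]
    by (auto intro: dt_zero_column[of i])
  have deg: "degree (m i j) \<le> (if j \<in> J then d - 1 else d)" if "i < k" for i j
    using degree_le_pred_if_coeff_0[OF m(1) mJ[OF that]] m(1) by auto
  \<comment> \<open>Cramer's rule for the dual frame of \<open>\<eta>\<close>; the columns of \<open>m\<close> in \<open>J\<close> have degree below \<open>d\<close>.\<close>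
  have "dt k m - L ^ (k - 1) * q = 0"
  proof (rule poly_eq_0_if_infinite)
    show "infinite (UNIV - {t. poly L t = 0})"
      using poly_roots_finite[OF degL(2)] infinite_UNIV_char_0 by (simp add: Diff_infinite_finite)
    fix t assume "t \<in> UNIV - {t. poly L t = 0}"
    then have nz: "dt k (\<lambda>i j. \<eta> j (u (Some t) i)) \<noteq> 0" using L(2)[of "Some t"] by auto
    obtain w where w: "\<forall>i<k. \<forall>j<k. \<eta> j (w i) = (if i = j then 1 else 0)"
      "\<forall>\<phi>. (\<forall>j<k. lfun (\<phi> j)) \<longrightarrow>
       dt k (\<lambda>i j. \<phi> j (u (Some t) i)) = dt k (\<lambda>i j. \<eta> j (u (Some t) i)) * dt k (\<lambda>i j. \<phi> j (w i))"
      using dual_frame[OF basis _ nz] \<eta>(1) by blast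
    have "poly (m i j) t = poly L t * \<phi> j (w i)" if "i < k" for i j
    proof -
      have "dt k (\<lambda>a b. (\<eta>(i := \<phi> j)) b (w a)) = \<phi> j (w i)"
        by (rule dt_dual_replace[of k \<eta>]) (use w that in auto)
      then show ?thesis using m(2)[of i j "Some t"] L(2)[of "Some t"] w(2)[rule_format, of "\<eta>(i := \<phi> j)"] \<eta>(1) \<phi>
        by auto
    qed
    then have "poly (dt k m) t = dt k (\<lambda>i j. poly L t * \<phi> j (w i))"
      unfolding poly_dt by (intro dt_cong) auto
    also have "\<dots> = poly L t ^ k * dt k (\<lambda>i j. \<phi> j (w i))" by (rule dt_scale)
    also have "\<dots> = poly L t ^ (k - 1) * poly q t"
      using q(2)[of "Some t"] L(2)[of "Some t"] w(2)[rule_format, of \<phi>] \<phi> k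
      by (cases k) (auto simp: algebra_simps)
    finally show "poly (dt k m - L ^ (k - 1) * q) t = 0" by simp
  qed
  then have eq: "dt k m = L ^ (k - 1) * q" by simp
  show ?thesis
  proof (cases "J = {}")
    case False
    \<comment> \<open>For d = 0 the natural number \<open>d - 1\<close> would not be smaller than
      \<open>d\<close>, and the sum of the column degrees below would be wrong.\<close>
    have "d \<noteq> 0"
    proof
      assume "d = 0"
      obtain j where "j \<in> J" using False by blast
      then have "dt k (\<lambda>i j. \<phi> j (u None i)) = 0"
        using J basis_mem[OF basis] by (intro dt_zero_column[of j]) auto
      then have "coeff q 0 = 0" using q(2)[of None] \<open>d = 0\<close> by simp
      then show False using q \<open>d = 0\<close> by (metis le_zero_eq leading_coeff_0_iff)
    qed
    have "degree (dt k m) \<le> (\<Sum>j<k. if j \<in> J then d - 1 else d)"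
      by (rule degree_dt_le) (rule deg)
    moreover have "(\<Sum>j<k. if j \<in> J then d - 1 else d) + card J = k * d"
    proof -
      have "(\<Sum>j<k. if j \<in> J then d - 1 else d) + (\<Sum>j<k. if j \<in> J then 1 else 0) = (\<Sum>j<k. d)"
        unfolding sum.distrib[symmetric] using \<open>d \<noteq> 0\<close> by (intro sum.cong) auto
      moreover have "(\<Sum>j<k. if j \<in> J then 1 else (0::nat)) = card J"
        using J(1) by (simp add: sum.If_cases Int_absorb1)
      ultimately show ?thesis by simp
    qed
    moreover have "degree (dt k m) = (k - 1) * d + degree q"
      unfolding eq using degL q(3) by (simp add: degree_mult_eq degree_power_eq)
    moreover have "k * d = (k - 1) * d + d" using k by (cases k) auto
    ultimately show ?thesis by linarith
  qed (use q in simp)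
qed

section \<open>Maps of degree d through three points\<close>

lemma fam_poly_UNIV:
  assumes "fam k d UNIV f u" "\<And>j. lfun (\<phi> j)"
  shows "\<exists>q. degree q \<le> d \<and> (\<forall>x. pval d q x = dt k (\<lambda>i j. \<phi> j (u x i)))"
  using assms unfolding fam_def by blast

lemma basis_independent:
  assumes "is_basis_of k u V" "(\<Sum>i<k. c i *s u i) = 0" "i < k"
  shows "c i = 0"
proof -
  obtain \<psi> where \<psi>: "\<forall>j. lfun (\<psi> j)" "\<forall>i<k. \<forall>j<k. \<psi> j (u i) = (if i = j then 1 else 0)"
    using dual_exists[OF assms(1)] by blast
  have "0 = \<psi> i (\<Sum>j<k. c j *s u j)" using assms \<psi> by (simp add: lfun_zero)
  also have "\<dots> = (\<Sum>j<k. if j = i then c j else 0)"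
    unfolding lfun_sum[OF \<psi>(1)[rule_format]] lfun_scale[OF \<psi>(1)[rule_format]]
    using \<psi>(2) assms(3) by (intro sum.cong) auto
  finally show ?thesis using assms(3) by simp
qed

lemma expand_dual:
  assumes b: "is_basis_of m b B" and v: "v \<in> B" and \<psi>: "\<And>j. lfun (\<psi> j)"
    "\<forall>i<m. \<forall>j<m. \<psi> j (b i) = (if i = j then 1 else 0)"
  shows "v = (\<Sum>i<m. \<psi> i v *s b i)"
proof -
  obtain c where c: "v = (\<Sum>i<m. c i *s b i)" using basis_expand[OF b v] by blast
  have "\<psi> i v = c i" if "i < m" for i
  proof -
    have "\<psi> i v = (\<Sum>j<m. if j = i then c j else 0)"
      unfolding c lfun_sum[OF \<psi>(1)] lfun_scale[OF \<psi>(1)]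
      using \<psi>(2) that by (intro sum.cong) auto
    with that show ?thesis by simp
  qed
  with c show ?thesis by simp
qed

lemma basis_extend:
  assumes "is_basis_of m a A" "A \<subseteq> V" "cspace V"
  shows "\<exists>b. is_basis_of (cdim V) b V \<and> (\<forall>i<m. b i = a i)"
  using assms
proof (induction "cdim V - m" arbitrary: m a A)
  case 0
  have "cdim A \<le> cdim V" using 0 by (simp add: cdim_def vec.dim_subset)
  then have "A = V" using 0 vec.subspace_dim_equal[of A V]
    by (metis basis_cspace basis_dim cdim_def cspace_def diff_is_0_eq)
  then show ?case using 0 basis_dim by blast
next
  case (Suc n)
  have "A \<noteq> V" using Suc basis_dim by force
  then obtain v where v: "v \<in> V" "v \<notin> A" using Suc by blast
  have "is_basis_of (Suc m) (\<lambda>i. if i < m then a i else v) (vec.span (insert v A))"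
    using basis_append[OF Suc.prems(1) v(2)] .
  moreover have "vec.span (insert v A) \<subseteq> V"
    using v Suc.prems by (intro vec.span_minimal) (auto simp: cspace_def)
  moreover have "n = cdim V - Suc m" using Suc by simp
  ultimately obtain b where "is_basis_of (cdim V) b V" "\<forall>i<Suc m. b i = (if i < m then a i else v)"
    using Suc.hyps(1) Suc.prems(3) by blast
  then show ?case by (intro exI[of _ b]) auto
qed

text \<open>The curve span(a, x + t y), where \<open>b\<close> lists the k - d vectors a, then the d
  vectors x, then the d vectors y, and \<open>b (i + d)\<close> is the partner of
  \<open>b i\<close>. At infinity only the leading coefficients in t remain.\<close>

definition pencil :: "nat \<Rightarrow> nat \<Rightarrow> (nat \<Rightarrow> complex^'n) \<Rightarrow> complex option \<Rightarrow> nat \<Rightarrow> complex^'n" where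
  "pencil k d b x i = (if i < k - d then b i else
     (case x of Some t \<Rightarrow> b i + t *s b (i + d) | None \<Rightarrow> b (i + d)))"

text \<open>Since V 2 and V 3 meet in A, their sum is B by dimension. Splitting each basis vector x
  of V 1 along this sum yields y in V 3 with x + y in V 2, and pairwise transversality makes a, x, y
  independent.\<close>

lemma three_point_frame:
  fixes A B :: "(complex^'n) set"
  assumes d: "d \<le> k" and A: "cspace A" "cdim A = k - d" and B: "cspace B" "cdim B = k + d"
    and V: "\<And>i. i \<in> {1,2,3::nat} \<Longrightarrow> cspace (V i) \<and> cdim (V i) = k \<and> A \<subseteq> V i \<and> V i \<subseteq> B"
    and int: "V 1 \<inter> V 2 = A" "V 1 \<inter> V 3 = A" "V 2 \<inter> V 3 = A"
  obtains b where "is_basis_of (k + d) b B" "is_basis_of (k - d) b A"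
    "is_basis_of k (pencil k d b (Some 0)) (V 1)"
    "is_basis_of k (pencil k d b (Some 1)) (V 2)"
    "is_basis_of k (pencil k d b None) (V 3)"
proof -
  have V1: "cspace (V 1)" "cdim (V 1) = k" "A \<subseteq> V 1" "V 1 \<subseteq> B"
   and V2: "cspace (V 2)" "cdim (V 2) = k" "A \<subseteq> V 2" "V 2 \<subseteq> B"
   and V3: "cspace (V 3)" "cdim (V 3) = k" "A \<subseteq> V 3" "V 3 \<subseteq> B"
    using V[of 1] V[of 2] V[of 3] by auto
  obtain a where a: "is_basis_of (k - d) a A" using basis_exists[OF A(1)] A(2) by auto
  obtain b0 where b0: "is_basis_of k b0 (V 1)" "\<forall>i<k - d. b0 i = a i"
    using basis_extend[OF a V1(3,1)] V1(2) by auto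
  have sumV: "{x + y |x y. x \<in> V 2 \<and> y \<in> V 3} = B"
  proof -
    let ?S = "{x + y |x y. x \<in> V 2 \<and> y \<in> V 3}"
    have s: "vec.subspace ?S" using V2(1) V3(1) unfolding cspace_def by (rule vec.subspace_sums)
    have "?S \<subseteq> B" using V2(4) V3(4) B(1) by (auto simp: cspace_def intro!: vec.subspace_add)
    moreover have "vec.dim ?S + (k - d) = k + k"
      using vec.dim_sums_Int[of "V 2" "V 3"] V2 V3 int A by (simp add: cspace_def cdim_def)
    ultimately show ?thesis
      using vec.subspace_dim_equal[OF s, of B] B d by (simp add: cspace_def cdim_def)
  qed
  have "\<exists>y. y \<in> V 3 \<and> b0 i + y \<in> V 2" if "i < k" for i
  proof -
    have "b0 i \<in> B" using basis_mem[OF b0(1) that] V1(4) by blast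
    then obtain p q where pq: "p \<in> V 2" "q \<in> V 3" "b0 i = p + q" unfolding sumV[symmetric] by blast
    then have "- q \<in> V 3" using V3(1) vec.subspace_neg by (auto simp: cspace_def)
    then show ?thesis using pq by (intro exI[of _ "- q"]) auto
  qed
  then obtain y where y: "\<And>i. i < k \<Longrightarrow> y i \<in> V 3" "\<And>i. i < k \<Longrightarrow> b0 i + y i \<in> V 2" by metis
  define b where "b i = (if i < k then b0 i else y (i - d))" for i
  have bk: "b i = b0 i" if "i < k" for i using that by (simp add: b_def)
  have bd: "b i \<in> V 3" if "k \<le> i" "i < k + d" for i using that y(1)[of "i - d"] d by (auto simp: b_def)
  have bs: "b i + b (i + d) \<in> V 2" if "k - d \<le> i" "i < k" for i using that y(2)[of i] d by (auto simp: b_def)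
  have bA: "b i \<in> A" if "i < k - d" for i using that basis_mem[OF a that] b0(2) by (auto simp: b_def)
  have basis1: "is_basis_of k b (V 1)"
    using b0(1) unfolding is_basis_of_def using bk
    by (metis (mono_tags, lifting) image_cong inj_on_cong lessThan_iff)
  \<comment> \<open>The vectors x are independent modulo A.\<close>
  have coeffA: "c i = 0" if cA: "(\<Sum>j=k-d..<k. c j *s b j) \<in> A" and ci: "k - d \<le> i" "i < k" for c i
  proof -
    obtain e where e: "(\<Sum>j=k-d..<k. c j *s b j) = (\<Sum>j<k-d. e j *s a j)"
      using basis_expand[OF a cA] by blast
    define c' where "c' j = (if j < k - d then - e j else c j)" for j
    have "(\<Sum>j<k. c' j *s b j) = (\<Sum>j<k-d. c' j *s b j) + (\<Sum>j=k-d..<k. c' j *s b j)"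
      using sum.atLeastLessThan_concat[of 0 "k - d" k "\<lambda>j. c' j *s b j"]
      by (simp add: lessThan_atLeast0)
    also have "\<dots> = - (\<Sum>j<k-d. e j *s a j) + (\<Sum>j=k-d..<k. c j *s b j)"
      using b0(2) bk by (simp add: c'_def sum_negf[symmetric])
    finally have "(\<Sum>j<k. c' j *s b j) = 0" using e by simp
    from basis_independent[OF basis1 this ci(2)] show ?thesis using ci by (simp add: c'_def)
  qed
  have B': "is_basis_of (k + d) b B"
  proof (rule basis_if_independent[OF _ B])
    show "b i \<in> B" if "i < k + d" for i
      using that basis_mem[OF basis1, of i] bd[of i] V1(4) V3(4) by (cases "i < k") auto
    fix c i assume c: "(\<Sum>i<k + d. c i *s b i) = 0" and i: "i < k + d"
    have "(\<Sum>i<k+d. c i *s b i) = (\<Sum>i<k. c i *s b i) + (\<Sum>i=k..<k+d. c i *s b i)"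
      using sum.atLeastLessThan_concat[of 0 k "k + d" "\<lambda>i. c i *s b i"] by (simp add: lessThan_atLeast0)
    then have eq: "(\<Sum>i=k..<k+d. c i *s b i) = - (\<Sum>i<k. c i *s b i)"
      using c by (simp add: eq_neg_iff_add_eq_0 add.commute)
    have "(\<Sum>i<k. c i *s b i) \<in> V 1" using V1(1) basis_mem[OF basis1]
      by (auto simp: cspace_def intro!: vec.subspace_sum vec.subspace_scale)
    then have "(\<Sum>i=k..<k+d. c i *s b i) \<in> V 1"
      unfolding eq using V1(1) vec.subspace_neg by (auto simp: cspace_def)
    moreover have "(\<Sum>i=k..<k+d. c i *s b i) \<in> V 3" using V3(1) bd
      by (auto simp: cspace_def intro!: vec.subspace_sum vec.subspace_scale)
    \<comment> \<open>The y-part of the relation lies in V 1 and V 3, hence in A. As all x + y are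
      in V 2, the same combination of the x lies in V 2 and in V 1, hence in A, and
      \<open>coeffA\<close> makes its coefficients zero.\<close>
    ultimately have yA: "(\<Sum>i=k..<k+d. c i *s b i) \<in> A" using int(2) by blast
    have "(\<Sum>i=k..<k+d. c i *s b i) = (\<Sum>i=(k-d)+d..<k+d. c i *s b i)" using d by simp
    also have "\<dots> = (\<Sum>i=k-d..<k. c (i + d) *s b (i + d))" by (rule sum.shift_bounds_nat_ivl)
    finally have yA': "(\<Sum>i=k-d..<k. c (i + d) *s b (i + d)) \<in> A" using yA by simp
    have "(\<Sum>i=k-d..<k. c (i + d) *s b i) =
       (\<Sum>i=k-d..<k. c (i + d) *s (b i + b (i + d))) - (\<Sum>i=k-d..<k. c (i + d) *s b (i + d))"
      by (simp add: vec.scale_right_distrib sum.distrib)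
    moreover have "(\<Sum>i=k-d..<k. c (i + d) *s (b i + b (i + d))) \<in> V 2" using V2(1) bs
      by (auto simp only: cspace_def atLeastLessThan_iff intro!: vec.subspace_sum vec.subspace_scale)
    ultimately have "(\<Sum>i=k-d..<k. c (i + d) *s b i) \<in> V 2"
      using yA' V2(1,3) vec.subspace_diff by (auto simp: cspace_def)
    moreover have "(\<Sum>i=k-d..<k. c (i + d) *s b i) \<in> V 1" using V1(1) basis_mem[OF basis1]
      by (auto simp: cspace_def intro!: vec.subspace_sum vec.subspace_scale)
    ultimately have "(\<Sum>i=k-d..<k. c (i + d) *s b i) \<in> A" using int(1) by blast
    from coeffA[OF this] have c1: "c (i + d) = 0" if "k - d \<le> i" "i < k" for i using that by simp
    have c2: "c i = 0" if "k \<le> i" "i < k + d" for i using c1[of "i - d"] that d by simp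
    then have "(\<Sum>i<k. c i *s b i) = 0" using eq by simp
    then show "c i = 0" using basis_independent[OF basis1, of c i] c2[of i] i by (cases "i < k") auto
  qed
  obtain \<psi> where \<psi>: "\<forall>j. lfun (\<psi> j)" "\<forall>i<k+d. \<forall>j<k+d. \<psi> j (b i) = (if i = j then 1 else 0)"
    using dual_exists[OF B'] by blast
  have "is_basis_of k (pencil k d b None) (V 3)"
  proof (rule basis_if_dual[OF _ _ V3(1,2)])
    show "pencil k d b None i \<in> V 3" if "i < k" for i
      using that bA[of i] bd[of "i + d"] V3(3) by (auto simp: pencil_def)
    show "lfun (if j < k - d then \<psi> j else \<psi> (j + d))" for j using \<psi> by simp
    show "(if j < k - d then \<psi> j else \<psi> (j + d)) (pencil k d b None i) = (if i = j then 1 else 0)"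
      if "i < k" "j < k" for i j using that \<psi>(2) by (auto simp: pencil_def)
  qed
  moreover have "is_basis_of k (pencil k d b (Some 1)) (V 2)"
  proof (rule basis_if_dual[OF _ _ V2(1,2)])
    show "pencil k d b (Some 1) i \<in> V 2" if "i < k" for i
      using that bA[of i] bs[of i] V2(3) by (auto simp: pencil_def)
    show "lfun (\<psi> j)" for j using \<psi> by simp
    show "\<psi> j (pencil k d b (Some 1) i) = (if i = j then 1 else 0)"
      if "i < k" "j < k" for i j using that \<psi> by (auto simp: pencil_def lfun_add)
  qed
  moreover have "is_basis_of k (pencil k d b (Some 0)) (V 1)"
  proof -
    have "pencil k d b (Some 0) = b" by (rule ext) (simp add: pencil_def)
    then show ?thesis using basis1 by simp
  qed
  moreover have "is_basis_of (k - d) b A"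
  proof -
    have eq: "b i = a i" if "i \<in> {..<k-d}" for i using that b0(2) by (auto simp: b_def)
    have "b ` {..<k-d} = a ` {..<k-d}" "inj_on b {..<k-d} = inj_on a {..<k-d}"
      by (auto intro!: image_cong inj_on_cong simp: eq)
    with a show ?thesis by (simp add: is_basis_of_def)
  qed
  ultimately show ?thesis using that[of b] B' by blast
qed

section \<open>Existence and uniqueness of the pencil\<close>

lemma pencil_basis:
  assumes b: "is_basis_of (k + d) b B" and d: "d \<le> k"
  shows "is_basis_of k (pencil k d b x) (vec.span (pencil k d b x ` {..<k}))"
proof -
  obtain \<psi> where \<psi>: "\<forall>j. lfun (\<psi> j)" "\<forall>i<k+d. \<forall>j<k+d. \<psi> j (b i) = (if i = j then 1 else 0)"
    using dual_exists[OF b] by blast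
  show ?thesis
  proof (rule basis_of_span_if_dual)
    let ?\<psi> = "\<lambda>j. if j < k - d \<or> x \<noteq> None then \<psi> j else \<psi> (j + d)"
    show "lfun (?\<psi> j)" for j using \<psi> by simp
    show "?\<psi> j (pencil k d b x i) = (if i = j then 1 else 0)" if "i < k" "j < k" for i j
      using that \<psi> by (cases x) (auto simp: pencil_def lfun_add lfun_scale)
  qed
qed

text \<open>Evaluation of forms at infinity: the coefficient at the formal degree is multiplicative
  even where the true degree is smaller.\<close>

lemma coeff_mult_bound:
  assumes "degree p \<le> m" "degree q \<le> n"
  shows "coeff (p * q) (m + n) = coeff p m * coeff q n"
proof -
  have "coeff (p * q) (m + n) = (\<Sum>i\<le>m + n. if i = m then coeff p m * coeff q n else 0)"
    unfolding coeff_mult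
  proof (intro sum.cong refl)
    fix i assume "i \<in> {..m + n}"
    then show "coeff p i * coeff q (m + n - i) = (if i = m then coeff p m * coeff q n else 0)"
      using assms coeff_eq_0[of p i] coeff_eq_0[of q "m + n - i"] by (cases i m rule: linorder_cases) auto
  qed
  then show ?thesis by simp
qed

lemma coeff_prod_bound:
  assumes "finite I" "\<And>i. i \<in> I \<Longrightarrow> degree (p i) \<le> e i"
  shows "degree (\<Prod>i\<in>I. p i) \<le> (\<Sum>i\<in>I. e i)"
    "coeff (\<Prod>i\<in>I. p i) (\<Sum>i\<in>I. e i) = (\<Prod>i\<in>I. coeff (p i) (e i))"
proof -
  have "degree (\<Prod>i\<in>I. p i) \<le> (\<Sum>i\<in>I. e i) \<and>
    coeff (\<Prod>i\<in>I. p i) (\<Sum>i\<in>I. e i) = (\<Prod>i\<in>I. coeff (p i) (e i))"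
    using assms
  proof (induction I rule: finite_induct)
    case (insert i I)
    then show ?case
      using degree_mult_le[of "p i" "prod p I"] coeff_mult_bound[of "p i" "e i" "prod p I" "sum e I"]
      by (auto intro!: order.trans[OF degree_mult_le] add_mono)
  qed simp
  then show "degree (\<Prod>i\<in>I. p i) \<le> (\<Sum>i\<in>I. e i)"
    "coeff (\<Prod>i\<in>I. p i) (\<Sum>i\<in>I. e i) = (\<Prod>i\<in>I. coeff (p i) (e i))" by auto
qed

text \<open>Only the last \<open>d\<close> rows depend on t, and linearly, so each term of the
  determinant has degree at most \<open>d\<close>. Its coefficient at \<open>d\<close> is the
  product of the coefficients at the formal row degrees \<open>e i\<close>, which is the same term
  for the pencil at infinity.\<close>

lemma pencil_morphism:
  fixes b :: "nat \<Rightarrow> complex^'n"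
  assumes b: "is_basis_of (k + d) b B" and d: "d \<le> k"
  shows "morphism_deg k d (\<lambda>x. vec.span (pencil k d b x ` {..<k}))"
proof -
  define M :: "(nat \<Rightarrow> 'n) \<Rightarrow> nat \<Rightarrow> nat \<Rightarrow> complex poly" where
    "M \<sigma> i j = (if i < k - d then [:b i $ \<sigma> j:] else [:b i $ \<sigma> j, b (i + d) $ \<sigma> j:])" for \<sigma> i j
  define e :: "nat \<Rightarrow> nat" where "e i = (if i < k - d then 0 else 1)" for i
  have deg: "degree (M \<sigma> i j) \<le> e i" for \<sigma> i j by (simp add: M_def e_def)
  have e: "(\<Sum>i<k. e i) = d"
  proof -
    have "(\<Sum>i<k. e i) = (\<Sum>i<k-d. e i) + (\<Sum>i=k-d..<k. e i)"
      using sum.atLeastLessThan_concat[of 0 "k - d" k e] by (simp add: lessThan_atLeast0)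
    also have "\<dots> = d" using d by (simp add: e_def)
    finally show ?thesis .
  qed
  have Mx: "degree (dt k (M \<sigma>)) \<le> d" "pval d (dt k (M \<sigma>)) x = plucker k (pencil k d b x) \<sigma>" for \<sigma> x
  proof -
    show "degree (dt k (M \<sigma>)) \<le> d" unfolding dt_rows
    proof (intro degree_sum_le)
      fix p
      have "degree (of_int (sign p) * (\<Prod>i<k. M \<sigma> i (p i))) \<le> degree (\<Prod>i<k. M \<sigma> i (p i))"
        by (metis degree_mult_le degree_of_int add_0)
      also have "\<dots> \<le> d" using coeff_prod_bound(1)[of "{..<k}" "\<lambda>i. M \<sigma> i (p i)" e] deg e by auto
      finally show "degree (of_int (sign p) * (\<Prod>i<k. M \<sigma> i (p i))) \<le> d" .
    qed (simp add: finite_permutations)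
    show "pval d (dt k (M \<sigma>)) x = plucker k (pencil k d b x) \<sigma>"
    proof (cases x)
      case (Some t)
      show ?thesis unfolding Some pval_simps poly_dt plucker_eq_dt
        by (intro dt_cong) (auto simp: M_def pencil_def)
    next
      case None
      have "coeff (of_int (sign p) * (\<Prod>i<k. M \<sigma> i (p i))) d
         = of_int (sign p) * (\<Prod>i<k. pencil k d b None i $ \<sigma> (p i))" for p
      proof -
        have "coeff (\<Prod>i<k. M \<sigma> i (p i)) d = (\<Prod>i<k. coeff (M \<sigma> i (p i)) (e i))"
          using coeff_prod_bound(2)[of "{..<k}" "\<lambda>i. M \<sigma> i (p i)" e] deg e by auto
        also have "\<dots> = (\<Prod>i<k. pencil k d b None i $ \<sigma> (p i))"
          by (intro prod.cong) (auto simp: M_def e_def pencil_def)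
        finally show ?thesis by (simp add: of_int_poly)
      qed
      then show ?thesis unfolding None pval_simps plucker_def dt_rows coeff_sum by simp
    qed
  qed
  have "(\<forall>\<sigma>. degree (dt k (M \<sigma>)) \<le> d) \<and> (\<forall>x. \<exists>u. is_basis_of k u (vec.span (pencil k d b x ` {..<k})) \<and>
      (\<forall>\<sigma>. pval d (dt k (M \<sigma>)) x = plucker k u \<sigma>))"
    using Mx pencil_basis[OF b d] by blast
  then show ?thesis unfolding morphism_deg_def by (rule exI[of _ "\<lambda>\<sigma>. dt k (M \<sigma>)"])
qed

text \<open>In the basis a, x, y the subspace f(infinity) is spanned by a and y. This forces the
  minor of the first k coordinates to be constant, so every f(t) has a frame dual to them. For the
  frame vectors beyond A the other coordinates have degree at most 1 in t, and the conditions at 0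
  and 1 determine them.\<close>

lemma morphism_eq_pencil:
  fixes b :: "nat \<Rightarrow> complex^'n"
  assumes k: "0 < k" and d: "d \<le> k" and b: "is_basis_of (k + d) b B" and a: "is_basis_of (k - d) b A"
    and f: "morphism_deg k d f" "\<And>x. A \<subseteq> f x" "\<And>x. f x \<subseteq> B"
    and f0: "is_basis_of k (pencil k d b (Some 0)) (f (Some 0))"
    and f1: "is_basis_of k (pencil k d b (Some 1)) (f (Some 1))"
    and finf: "is_basis_of k (pencil k d b None) (f None)"
  shows "f = (\<lambda>x. vec.span (pencil k d b x ` {..<k}))"
proof
  fix x
  obtain u where fam: "fam k d UNIV f u" using morphism_fam[OF f(1)] .
  note basis = fam_basis[OF fam UNIV_I]
  obtain \<psi> where \<psi>: "\<And>j. lfun (\<psi> j)" "\<forall>i<k+d. \<forall>j<k+d. \<psi> j (b i) = (if i = j then 1 else 0)"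
    using dual_exists[OF b] by blast
  show "f x = vec.span (pencil k d b x ` {..<k})"
  proof (cases x)
    case None
    then show ?thesis using finf by (simp add: is_basis_of_def)
  next
    case (Some t)
    have vanish: "\<phi> v = 0"
      if "is_basis_of k (pencil k d b x) (f x)" "lfun \<phi>" "\<And>i. i < k \<Longrightarrow> \<phi> (pencil k d b x i) = 0" "v \<in> f x"
      for x \<phi> v
    proof -
      have "v \<in> vec.span (pencil k d b x ` {..<k})" using that by (simp add: is_basis_of_def)
      from lfun_vanish_span[OF that(2) _ this] that(3) show ?thesis by auto
    qed
    have inf0: "\<psi> j v = 0" if "k - d \<le> j" "j < k" "v \<in> f None" for j v
      by (rule vanish[OF finf \<psi>(1) _ that(3)]) (use \<psi>(2) that in \<open>auto simp: pencil_def\<close>)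
    have at0: "\<psi> (k + j) v = 0" if "j < d" "v \<in> f (Some 0)" for j v
      by (rule vanish[OF f0 \<psi>(1) _ that(2)]) (use \<psi>(2) that in \<open>auto simp: pencil_def lfun_add lfun_scale \<psi>\<close>)
    have at1: "\<psi> (k + j) v = \<psi> (k - d + j) v" if "j < d" "v \<in> f (Some 1)" for j v
    proof -
      have "(\<lambda>v. \<psi> (k + j) v - \<psi> (k - d + j) v) v = 0"
      proof (rule vanish[OF f1 _ _ that(2)])
        show "lfun (\<lambda>v. \<psi> (k + j) v - \<psi> (k - d + j) v)"
          unfolding lfun_def by (simp add: lfun_add[OF \<psi>(1)] lfun_scale[OF \<psi>(1)] algebra_simps)
        show "\<psi> (k + j) (pencil k d b (Some 1) i) - \<psi> (k - d + j) (pencil k d b (Some 1) i) = 0"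
          if "i < k" for i
          using that \<open>j < d\<close> d \<psi>(2) by (auto simp: pencil_def lfun_add[OF \<psi>(1)])
      qed
      then show ?thesis by simp
    qed
    obtain q0 where q0: "degree q0 \<le> d" "\<And>x. pval d q0 x = dt k (\<lambda>i j. \<psi> j (u x i))"
      using fam_poly_UNIV[OF fam, of \<psi>] \<psi>(1) by auto
    have nz0: "poly q0 0 \<noteq> 0"
    proof -
      obtain \<kappa> where \<kappa>: "\<forall>\<phi>. (\<forall>j<k. lfun (\<phi> j)) \<longrightarrow> dt k (\<lambda>i j. \<phi> j (pencil k d b (Some 0) i))
          = \<kappa> * dt k (\<lambda>i j. \<phi> j (u (Some 0) i))"
        using basis_change[OF basis f0] by blast
      have "dt k (\<lambda>i j. \<psi> j (pencil k d b (Some 0) i)) = dt k (\<lambda>i j. if i = j then 1 else 0)"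
        using \<psi>(2) by (intro dt_cong) (auto simp: pencil_def)
      then show ?thesis using \<kappa>[rule_format, of \<psi>] q0(2)[of "Some 0"] \<psi>(1) by (auto simp: dt_one)
    qed
    \<comment> \<open>The d functionals dual to the x vanish at infinity, which uses up the whole
      degree.\<close>
    have "degree q0 + card {k-d..<k} \<le> d"
      by (rule fam_degree_at_infinity[OF fam k \<psi>(1) _ _ q0]) (use nz0 inf0 in auto)
    then have "degree q0 = 0" using d by simp
    then obtain c where c: "q0 = [:c:]" by (auto elim: degree_eq_zeroE)
    with nz0 have "c \<noteq> 0" by simp
    have "pencil k d b (Some t) i \<in> f (Some t)" if i: "i < k" for i
    proof (cases "i < k - d")
      case True
      then show ?thesis using basis_mem[OF a True] f(2) by (auto simp: pencil_def)
    next
      case False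
      have "\<exists>w. w \<in> f (Some t) \<and> (\<forall>j<k. \<psi> j w = (if i = j then 1 else 0)) \<and>
          (\<forall>\<phi>. lfun \<phi> \<longrightarrow> dt k (\<lambda>l j. (\<psi>(i := \<phi>)) j (u (Some t) l)) = c * \<phi> w)" for t
      proof -
        have nz: "dt k (\<lambda>i j. \<psi> j (u (Some t) i)) = c" using q0(2)[of "Some t"] by (simp add: c)
        obtain w where w: "is_basis_of k w (f (Some t))"
          "\<forall>i<k. \<forall>j<k. \<psi> j (w i) = (if i = j then 1 else 0)"
          "\<forall>\<phi>. (\<forall>j<k. lfun (\<phi> j)) \<longrightarrow>
            dt k (\<lambda>i j. \<phi> j (u (Some t) i)) = dt k (\<lambda>i j. \<psi> j (u (Some t) i)) * dt k (\<lambda>i j. \<phi> j (w i))"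
          using dual_frame[OF basis, of \<psi> "Some t"] \<psi>(1) nz \<open>c \<noteq> 0\<close> by auto
        have "dt k (\<lambda>l j. (\<psi>(i := \<phi>)) j (u (Some t) l)) = c * \<phi> (w i)" if "lfun \<phi>" for \<phi>
        proof -
          have "dt k (\<lambda>l j. (\<psi>(i := \<phi>)) j (w l)) = \<phi> (w i)"
            by (rule dt_dual_replace[of k \<psi>]) (use w i in auto)
          then show ?thesis using w(3)[rule_format, of "\<psi>(i := \<phi>)"] nz that \<psi>(1) by auto
        qed
        then show ?thesis using w i basis_mem[OF w(1) i] by blast
      qed
      then obtain w where w: "\<And>t. w t \<in> f (Some t)"
          "\<And>t j. j < k \<Longrightarrow> \<psi> j (w t) = (if i = j then 1 else 0)"
          "\<And>t \<phi>. lfun \<phi> \<Longrightarrow> dt k (\<lambda>l j. (\<psi>(i := \<phi>)) j (u (Some t) l)) = c * \<phi> (w t)"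
        by metis
      have comp: "\<psi> (k + j) (w t) = t * (if i = k - d + j then 1 else 0)" if j: "j < d" for j
      proof -
        define \<phi> where "\<phi> = \<psi>(i := \<psi> (k + j))"
        have \<phi>: "lfun (\<phi> j)" for j using \<psi>(1) by (simp add: \<phi>_def)
        obtain q where q: "degree q \<le> d" "\<And>x. pval d q x = dt k (\<lambda>i j. \<phi> j (u x i))"
          using fam_poly_UNIV[OF fam, of \<phi>] \<phi> by auto
        have qw: "poly q t = c * \<psi> (k + j) (w t)" for t
          using w(3)[OF \<psi>(1)] q(2)[of "Some t"] by (simp add: \<phi>_def)
        \<comment> \<open>Exchanging \<open>\<psi> i\<close> gives up one of the d functionals that
          vanish at infinity, so one degree remains.\<close>
        have "degree q \<le> 1"
        proof (cases "q = 0")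
          case False
          have "degree q + card ({k-d..<k} - {i}) \<le> d"
            by (rule fam_degree_at_infinity[OF fam k \<phi> _ _ q False]) (use inf0 in \<open>auto simp: \<phi>_def\<close>)
          moreover have "card ({k-d..<k} - {i}) = d - 1" using i \<open>\<not> i < k - d\<close> d by simp
          ultimately show ?thesis using j by linarith
        qed simp
        then have "q = [:coeff q 0, coeff q 1:]"
          by (intro poly_eqI) (auto simp: coeff_pCons coeff_eq_0 split: nat.split)
        then obtain \<alpha> \<beta> where "q = [:\<alpha>, \<beta>:]" by blast
        then have q': "poly q t = \<alpha> + t * \<beta>" for t by simp
        have "\<alpha> = 0" using q'[of 0] qw[of 0] at0[OF j w(1)] by simp
        moreover have "\<psi> (k + j) (w 1) = (if i = k - d + j then 1 else 0)"
          unfolding at1[OF j w(1)] using w(2)[of "k - d + j" 1] j d by simp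
        then have "\<alpha> + \<beta> = c * (if i = k - d + j then 1 else 0)" using q'[of 1] qw[of 1] by simp
        ultimately show ?thesis using q'[of t] qw[of t] \<open>c \<noteq> 0\<close> by auto
      qed
      have "w t = (\<Sum>l<k+d. \<psi> l (w t) *s b l)"
        using expand_dual[OF b _ \<psi>, of "w t"] w(1) f(3) by blast
      also have "\<dots> = (\<Sum>l<k+d. ((if l = i then 1 else 0) + (if l = i + d then t else 0)) *s b l)"
      proof (intro sum.cong refl arg_cong2[of _ _ _ _ "(*s)"])
        fix l assume l: "l \<in> {..<k+d}"
        show "\<psi> l (w t) = (if l = i then 1 else 0) + (if l = i + d then t else 0)"
        proof (cases "l < k")
          case True
          then show ?thesis using w(2)[OF True, of t] \<open>\<not> i < k - d\<close> by auto
        next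
          case False
          then show ?thesis using comp[of "l - k"] l i d by auto
        qed
      qed
      also have "\<dots> = b i + t *s b (i + d)"
        using i by (simp add: vec.scale_left_distrib sum.distrib if_distrib[of "\<lambda>a. a *s _"] cong: if_cong)
      finally show ?thesis using w(1)[of t] False by (simp add: pencil_def)
    qed
    then have "vec.span (pencil k d b (Some t) ` {..<k}) \<subseteq> f (Some t)"
      using fam_cspace[OF fam, of "Some t"] by (intro vec.span_minimal) (auto simp: cspace_def)
    then show ?thesis
      using vec.subspace_dim_equal[of "vec.span (pencil k d b (Some t) ` {..<k})" "f (Some t)"]
        fam_cspace[OF fam, of "Some t"] basis_dim[OF basis] basis_dim[OF pencil_basis[OF b d]] Some
      by (simp add: cspace_def cdim_def)
  qed
qed

section \<open>Polynomial parametrizations\<close>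

text \<open>In contrast to \<open>polyfun\<close> the admissible variables are recorded, so that
  parameters can be counted.\<close>

inductive polyin :: "'v set \<Rightarrow> (('v \<Rightarrow> complex) \<Rightarrow> complex) \<Rightarrow> bool" for V where
  polyin_const: "polyin V (\<lambda>a. c)"
| polyin_var: "x \<in> V \<Longrightarrow> polyin V (\<lambda>a. a x)"
| polyin_add: "polyin V P \<Longrightarrow> polyin V Q \<Longrightarrow> polyin V (\<lambda>a. P a + Q a)"
| polyin_mult: "polyin V P \<Longrightarrow> polyin V Q \<Longrightarrow> polyin V (\<lambda>a. P a * Q a)"

lemma polyin_sum: "(\<And>i. i \<in> I \<Longrightarrow> polyin V (P i)) \<Longrightarrow> polyin V (\<lambda>a. \<Sum>i\<in>I. P i a)"
  by (induction I rule: infinite_finite_induct) (auto intro: polyin.intros)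

lemma polyin_power: "polyin V P \<Longrightarrow> polyin V (\<lambda>a. P a ^ m)"
  by (induction m) (auto intro: polyin.intros)

lemma polyin_prod: "(\<And>i. i \<in> I \<Longrightarrow> polyin V (P i)) \<Longrightarrow> polyin V (\<lambda>a. \<Prod>i\<in>I. P i a)"
  by (induction I rule: infinite_finite_induct) (auto intro: polyin.intros)

lemma polyin_imp_polyfun: "polyin V P \<Longrightarrow> polyfun P"
  by (induction rule: polyin.induct) (auto intro: polyfun.intros)

lemma polyin_depends: "polyin V P \<Longrightarrow> (\<And>x. x \<in> V \<Longrightarrow> a x = b x) \<Longrightarrow> P a = P b"
  by (induction rule: polyin.induct) auto

lemma polyin_subst:
  "polyin V P \<Longrightarrow> (\<And>x. x \<in> V \<Longrightarrow> polyin W (g x)) \<Longrightarrow> polyin W (\<lambda>b. P (\<lambda>x. g x b))"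
  by (induction rule: polyin.induct) (auto intro: polyin.intros)

lemma polyin_mono: "polyin V P \<Longrightarrow> V \<subseteq> W \<Longrightarrow> polyin W P"
  using polyin_subst[of V P W "\<lambda>x a. a x"] by (auto intro: polyin.intros)

section \<open>Products of nonzero polynomial functions\<close>

lemma polyfun_line:
  assumes "polyfun P"
  shows "\<exists>q. \<forall>t. P (\<lambda>x. a x + t * (b x - a x)) = poly q t"
  using assms
proof (induction rule: polyfun.induct)
  case (pf_const c) show ?case by (intro exI[of _ "[:c:]"]) simp
next
  case (pf_var x) show ?case by (intro exI[of _ "[:a x, b x - a x:]"]) simp
next
  case (pf_add P Q)
  then obtain p q where "\<forall>t. P (\<lambda>x. a x + t * (b x - a x)) = poly p t"
    "\<forall>t. Q (\<lambda>x. a x + t * (b x - a x)) = poly q t" by blast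
  then show ?case by (intro exI[of _ "p + q"]) simp
next
  case (pf_mult P Q)
  then obtain p q where "\<forall>t. P (\<lambda>x. a x + t * (b x - a x)) = poly p t"
    "\<forall>t. Q (\<lambda>x. a x + t * (b x - a x)) = poly q t" by blast
  then show ?case by (intro exI[of _ "p * q"]) simp
qed

text \<open>On the line through \<open>a\<close> and \<open>b\<close> both functions become nonzero
  univariate polynomials, and their product has a nonroot.\<close>

lemma polyfun_mult_nonzero:
  assumes "polyfun P" "polyfun Q" "P a \<noteq> 0" "Q b \<noteq> 0"
  shows "\<exists>c. P c * Q c \<noteq> 0"
proof -
  obtain p q where p: "\<forall>t. P (\<lambda>x. a x + t * (b x - a x)) = poly p t"
    and q: "\<forall>t. Q (\<lambda>x. a x + t * (b x - a x)) = poly q t"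
    using polyfun_line[OF assms(1), of a b] polyfun_line[OF assms(2), of a b] by blast
  have "p \<noteq> 0" using p[rule_format, of 0] assms(3) by auto
  moreover have "q \<noteq> 0" using q[rule_format, of 1] assms(4) by auto
  ultimately have "p * q \<noteq> 0" by simp
  then obtain t where "poly (p * q) t \<noteq> 0" using poly_all_0_iff_0 by blast
  then show ?thesis using p q by (intro exI[of _ "\<lambda>x. a x + t * (b x - a x)"]) simp
qed

lemma common_nonzero_polyfun:
  assumes "finite X" "\<And>x. x \<in> X \<Longrightarrow> \<exists>P. polyfun P \<and> (\<exists>a. P a \<noteq> 0) \<and> (\<forall>a. R x a \<longrightarrow> P a = 0)"
  shows "\<exists>P. polyfun P \<and> (\<exists>a. P a \<noteq> 0) \<and> (\<forall>a. (\<exists>x\<in>X. R x a) \<longrightarrow> P a = 0)"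
  using assms
proof (induction X rule: finite_induct)
  case empty
  show ?case by (intro exI[of _ "\<lambda>_. 1"]) (auto intro: polyfun.intros)
next
  case (insert x X)
  obtain P where P: "polyfun P" "\<exists>a. P a \<noteq> 0" "\<forall>a. R x a \<longrightarrow> P a = 0" using insert.prems by blast
  obtain Q where Q: "polyfun Q" "\<exists>a. Q a \<noteq> 0" "\<forall>a. (\<exists>x\<in>X. R x a) \<longrightarrow> Q a = 0"
    using insert.IH insert.prems by blast
  show ?case
    using polyfun_mult_nonzero[OF P(1) Q(1)] P Q
    by (intro exI[of _ "\<lambda>a. P a * Q a"]) (auto intro: polyfun.intros)
qed

text \<open>Gaussian elimination: the equation \<open>b\<close> is removed together with an unknown
  \<open>a0\<close> that occurs in it.\<close>

lemma more_unknowns_than_equations: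
  fixes m :: "'a \<Rightarrow> 'b \<Rightarrow> 'c :: field"
  assumes "finite B" "finite A" "card B < card A"
  shows "\<exists>x. (\<exists>a\<in>A. x a \<noteq> 0) \<and> (\<forall>b\<in>B. (\<Sum>a\<in>A. x a * m a b) = 0)"
  using assms
proof (induction B arbitrary: A m rule: finite_induct)
  case empty
  then have "A \<noteq> {}" by auto
  then show ?case by (intro exI[of _ "\<lambda>_. 1"]) auto
next
  case (insert b B)
  show ?case
  proof (cases "\<forall>a\<in>A. m a b = 0")
    case True
    obtain x where "\<exists>a\<in>A. x a \<noteq> 0" "\<forall>b\<in>B. (\<Sum>a\<in>A. x a * m a b) = 0"
      using insert.IH[of A m] insert.prems insert.hyps by auto
    then show ?thesis using True by (intro exI[of _ x]) auto
  next
    case False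
    then obtain a0 where a0: "a0 \<in> A" "m a0 b \<noteq> 0" by blast
    define A' where "A' = A - {a0}"
    have A: "A = insert a0 A'" "a0 \<notin> A'" "finite A'" using a0 insert.prems by (auto simp: A'_def)
    define m' where "m' a b' = m a b' - m a b / m a0 b * m a0 b'" for a b'
    have "card B < card A'" using insert.prems insert.hyps A by simp
    then obtain x where x: "\<exists>a\<in>A'. x a \<noteq> 0" "\<forall>b\<in>B. (\<Sum>a\<in>A'. x a * m' a b) = 0"
      using insert.IH[of A' m'] A(3) by blast
    define x0 where "x0 = - (\<Sum>a\<in>A'. x a * m a b) / m a0 b"
    define z where "z = x(a0 := x0)"
    have sum: "(\<Sum>a\<in>A. z a * m a b') = x0 * m a0 b' + (\<Sum>a\<in>A'. x a * m a b')" for b'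
      unfolding A(1) using A(2,3) by (auto simp: z_def intro!: sum.cong)
    have "(\<Sum>a\<in>A. z a * m a b') = 0" if "b' \<in> insert b B" for b'
    proof (cases "b' = b")
      case True
      then show ?thesis unfolding sum using a0 by (simp add: x0_def)
    next
      case False
      then have "0 = (\<Sum>a\<in>A'. x a * m' a b')" using that x(2) by simp
      also have "\<dots> = x0 * m a0 b' + (\<Sum>a\<in>A'. x a * m a b')"
        by (simp add: m'_def x0_def right_diff_distrib sum_subtractf sum_distrib_right sum_divide_distrib
            sum_distrib_left mult_ac)
      finally show ?thesis unfolding sum by simp
    qed
    moreover have "\<exists>a\<in>A. z a \<noteq> 0" using x(1) A by (auto simp: z_def)
    ultimately show ?thesis by blast
  qed
qed

section \<open>Counting monomials\<close>

definition exps :: "'v set \<Rightarrow> nat \<Rightarrow> ('v \<Rightarrow> nat) set" where "exps V \<delta> = PiE V (\<lambda>_. {..\<delta>})"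

definition monomial_at :: "'v set \<Rightarrow> ('v \<Rightarrow> nat) \<Rightarrow> ('v \<Rightarrow> complex) \<Rightarrow> complex" where
  "monomial_at V e a = (\<Prod>v\<in>V. a v ^ e v)"

lemma finite_exps: "finite V \<Longrightarrow> finite (exps V \<delta>)"
  by (simp add: exps_def finite_PiE)

text \<open>Bounding the degree in each variable separately, instead of the total degree, makes this
  number an exact power.\<close>

lemma card_exps: "finite V \<Longrightarrow> card (exps V \<delta>) = Suc \<delta> ^ card V"
  by (simp add: exps_def card_PiE)

definition poly_bounded :: "'v set \<Rightarrow> nat \<Rightarrow> (('v \<Rightarrow> complex) \<Rightarrow> complex) \<Rightarrow> bool" where
  "poly_bounded V \<delta> P \<longleftrightarrow> (\<exists>c. \<forall>a. P a = (\<Sum>e\<in>exps V \<delta>. c e * monomial_at V e a))"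

lemma poly_bounded_monomial:
  assumes "finite V" "\<And>v. v \<in> V \<Longrightarrow> e v \<le> \<delta>"
  shows "poly_bounded V \<delta> (monomial_at V e)"
proof -
  have e: "restrict e V \<in> exps V \<delta>" using assms by (auto simp: exps_def)
  have "monomial_at V e a = (\<Sum>e'\<in>exps V \<delta>. (if e' = restrict e V then 1 else 0) * monomial_at V e' a)" for a
  proof -
    have "(\<Sum>e'\<in>exps V \<delta>. (if e' = restrict e V then 1 else 0) * monomial_at V e' a)
      = (\<Sum>e'\<in>exps V \<delta>. if e' = restrict e V then monomial_at V e' a else 0)" by (intro sum.cong) auto
    also have "\<dots> = monomial_at V (restrict e V) a" using e finite_exps[OF assms(1)] by simp
    also have "\<dots> = monomial_at V e a" unfolding monomial_at_def by (intro prod.cong) auto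
    finally show ?thesis by simp
  qed
  then show ?thesis unfolding poly_bounded_def
    by (intro exI[of _ "\<lambda>e'. if e' = restrict e V then 1 else 0"]) blast
qed

lemma poly_bounded_lincomb:
  assumes "\<And>i. i \<in> I \<Longrightarrow> poly_bounded V \<delta> (P i)"
  shows "poly_bounded V \<delta> (\<lambda>a. \<Sum>i\<in>I. c i * P i a)"
proof -
  have "\<exists>d. \<forall>i\<in>I. \<forall>a. P i a = (\<Sum>e\<in>exps V \<delta>. d i e * monomial_at V e a)"
    using assms unfolding poly_bounded_def by metis
  then obtain d where d: "\<And>i a. i \<in> I \<Longrightarrow> P i a = (\<Sum>e\<in>exps V \<delta>. d i e * monomial_at V e a)" by blast
  have "(\<Sum>i\<in>I. c i * P i a) = (\<Sum>e\<in>exps V \<delta>. (\<Sum>i\<in>I. c i * d i e) * monomial_at V e a)" for a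
    unfolding sum_distrib_right by (subst sum.swap) (simp add: d sum_distrib_left mult.assoc)
  then show ?thesis unfolding poly_bounded_def by (intro exI[of _ "\<lambda>e. \<Sum>i\<in>I. c i * d i e"]) blast
qed

lemma poly_bounded_mult:
  assumes V: "finite V" and P: "poly_bounded V \<delta> P" and Q: "poly_bounded V \<delta>' Q"
  shows "poly_bounded V (\<delta> + \<delta>') (\<lambda>a. P a * Q a)"
proof -
  obtain c where c: "\<And>a. P a = (\<Sum>e\<in>exps V \<delta>. c e * monomial_at V e a)" using P poly_bounded_def by metis
  obtain d where d: "\<And>a. Q a = (\<Sum>e\<in>exps V \<delta>'. d e * monomial_at V e a)" using Q poly_bounded_def by metis
  have "P a * Q a = (\<Sum>x\<in>exps V \<delta> \<times> exps V \<delta>'. (c (fst x) * d (snd x)) * monomial_at V (\<lambda>v. fst x v + snd x v) a)" for a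
    unfolding c d sum_product sum.cartesian_product
    by (intro sum.cong) (auto simp: monomial_at_def power_add prod.distrib)
  moreover have "poly_bounded V (\<delta> + \<delta>')
    (\<lambda>a. \<Sum>x\<in>exps V \<delta> \<times> exps V \<delta>'. (c (fst x) * d (snd x)) * monomial_at V (\<lambda>v. fst x v + snd x v) a)"
  proof (intro poly_bounded_lincomb poly_bounded_monomial V)
    fix x v assume "x \<in> exps V \<delta> \<times> exps V \<delta>'" "v \<in> V"
    then show "fst x v + snd x v \<le> \<delta> + \<delta>'" by (intro add_mono) (auto simp: exps_def)
  qed
  ultimately show ?thesis by simp
qed

lemma poly_bounded_mono:
  assumes "finite V" "poly_bounded V \<delta> P" "\<delta> \<le> \<delta>'"
  shows "poly_bounded V \<delta>' P"
proof -
  obtain c where c: "\<And>a. P a = (\<Sum>e\<in>exps V \<delta>. c e * monomial_at V e a)" using assms poly_bounded_def by metis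
  have "poly_bounded V \<delta>' (\<lambda>a. \<Sum>e\<in>exps V \<delta>. c e * monomial_at V e a)"
    using assms by (intro poly_bounded_lincomb poly_bounded_monomial) (force simp: exps_def)+
  then show ?thesis by (simp add: c[symmetric])
qed

lemma poly_bounded_const: "finite V \<Longrightarrow> poly_bounded V \<delta> (\<lambda>a. c)"
  using poly_bounded_lincomb[of "{()}" V \<delta> "\<lambda>_. monomial_at V (\<lambda>_. 0)" "\<lambda>_. c"] poly_bounded_monomial[of V "\<lambda>_. 0" \<delta>]
  by (simp add: monomial_at_def)

lemma polyin_bounded:
  assumes "polyin V P" "finite V"
  shows "\<exists>\<delta>. poly_bounded V \<delta> P"
  using assms
proof (induction rule: polyin.induct)
  case (polyin_var x)
  have "monomial_at V (\<lambda>v. if v = x then 1 else 0) = (\<lambda>a. a x)"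
    using polyin_var by (auto simp: monomial_at_def if_distrib[of "\<lambda>i. _ ^ i"] cong: if_cong)
  then show ?case using poly_bounded_monomial[of V "\<lambda>v. if v = x then 1 else 0" 1] polyin_var
    by (intro exI[of _ 1]) auto
next
  case (polyin_add P Q)
  then obtain \<delta> \<delta>' where b: "poly_bounded V \<delta> P" "poly_bounded V \<delta>' Q" by blast
  have "poly_bounded V (max \<delta> \<delta>') (\<lambda>a. \<Sum>i\<in>UNIV. 1 * (if i then P else Q) a)"
    by (intro poly_bounded_lincomb)
      (use poly_bounded_mono[OF \<open>finite V\<close> b(1), of "max \<delta> \<delta>'"] poly_bounded_mono[OF \<open>finite V\<close> b(2), of "max \<delta> \<delta>'"] in auto)
  then show ?case by (auto simp: UNIV_bool add.commute)
qed (use poly_bounded_const poly_bounded_mult in blast)+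

lemma poly_bounded_power:
  assumes "finite V" "poly_bounded V \<delta> P"
  shows "poly_bounded V (m * \<delta>) (\<lambda>a. P a ^ m)"
proof (induction m)
  case (Suc m)
  show ?case using poly_bounded_mult[OF assms Suc] by simp
qed (simp add: poly_bounded_const assms)

lemma poly_bounded_power_prod:
  assumes V: "finite V" and I: "finite I" "\<And>i. i \<in> I \<Longrightarrow> poly_bounded V \<delta> (g i)" "\<And>i. i \<in> I \<Longrightarrow> e i \<le> D"
  shows "poly_bounded V (card I * (D * \<delta>)) (\<lambda>a. \<Prod>i\<in>I. g i a ^ e i)"
  using I
proof (induction I rule: finite_induct)
  case (insert i I)
  have "poly_bounded V (D * \<delta>) (\<lambda>a. g i a ^ e i)"
    by (rule poly_bounded_mono[OF V poly_bounded_power[OF V, of \<delta>] mult_le_mono1]) (use insert.prems in auto)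
  moreover have "poly_bounded V (card I * (D * \<delta>)) (\<lambda>a. \<Prod>i\<in>I. g i a ^ e i)"
    using insert.IH insert.prems by simp
  ultimately have "poly_bounded V (D * \<delta> + card I * (D * \<delta>)) (\<lambda>a. g i a ^ e i * (\<Prod>i\<in>I. g i a ^ e i))"
    by (rule poly_bounded_mult[OF V])
  then show ?case using insert.hyps by simp
qed (simp add: poly_bounded_const V)

text \<open>Induction on the variables: for fixed values of the others the relation is a univariate
  polynomial in variable \<open>i\<close> that vanishes identically, so each of its coefficients is
  a relation in fewer variables.\<close>

lemma monomials_independent:
  assumes "finite I" "\<And>a. (\<Sum>e\<in>exps I D. x e * monomial_at I e a) = 0" "e \<in> exps I D"
  shows "x e = 0"
  using assms
proof (induction I arbitrary: x e rule: finite_induct)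
  case empty
  then show ?case by (simp add: exps_def monomial_at_def)
next
  case (insert i I)
  have inj: "inj_on (\<lambda>(n, e). e(i := n)) ({..D} \<times> exps I D)"
  proof (rule inj_onI, clarify)
    fix n e n' e' assume *: "e \<in> exps I D" "e' \<in> exps I D" "e(i := n) = e'(i := n')"
    have "e j = e' j" for j
      using fun_cong[OF *(3), of j] *(1,2) insert.hyps(2) PiE_arb[of e I _ i] PiE_arb[of e' I _ i]
      by (cases "j = i") (auto simp: exps_def)
    then show "n = n' \<and> e = e'" using fun_cong[OF *(3), of i] by auto
  qed
  have im: "exps (insert i I) D = (\<lambda>(n, e). e(i := n)) ` ({..D} \<times> exps I D)"
    unfolding exps_def PiE_insert_eq by auto
  have monomial_ins: "monomial_at (insert i I) (e(i := n)) (a(i := t)) = t ^ n * monomial_at I e a" for e n a t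
      proof -
    have "(\<Prod>v\<in>I. (a(i := t)) v ^ (e(i := n)) v) = (\<Prod>v\<in>I. a v ^ e v)"
      using insert.hyps by (intro prod.cong) auto
    then show ?thesis unfolding monomial_at_def using insert.hyps by simp
  qed
  have zero: "(\<Sum>e\<in>exps I D. x (e(i := n)) * monomial_at I e a) = 0" if "n \<le> D" for n a
  proof -
    let ?c = "\<lambda>n. \<Sum>e\<in>exps I D. x (e(i := n)) * monomial_at I e a"
    have "(\<Sum>n\<le>D. ?c n * t ^ n) = 0" for t
    proof -
      have "0 = (\<Sum>(n, e)\<in>{..D} \<times> exps I D. x (e(i := n)) * monomial_at (insert i I) (e(i := n)) (a(i := t)))"
        using insert.prems(1)[of "a(i := t)"] unfolding im sum.reindex[OF inj] by (simp add: o_def case_prod_beta)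
      also have "\<dots> = (\<Sum>n\<le>D. ?c n * t ^ n)"
        unfolding monomial_ins sum.cartesian_product[symmetric] by (simp add: sum_distrib_left sum_distrib_right mult_ac)
      finally show ?thesis by simp
    qed
    then show ?thesis using polyfun_eq_0[of ?c D] that by blast
  qed
  obtain n e' where e': "e = e'(i := n)" "n \<le> D" "e' \<in> exps I D" using insert.prems(2) unfolding im by auto
  show ?case unfolding e'(1) by (rule insert.IH[OF zero[OF e'(2)] e'(3)])
qed

text \<open>The monomials in the \<open>g i\<close> with exponents at most D number (D + 1)^card I,
  and all lie in a space of polynomials in the variables \<open>V\<close> whose dimension grows only
  like D^card V. For large D they are linearly dependent.\<close>

lemma algebraic_dependence:
  assumes V: "finite V" and I: "finite I" and card: "card V < card I" and g: "\<And>i. i \<in> I \<Longrightarrow> polyin V (g i)"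
  shows "\<exists>P. polyin I P \<and> (\<exists>a. P a \<noteq> 0) \<and> (\<forall>b. P (\<lambda>i. g i b) = 0)"
proof -
  have "\<exists>\<delta>. \<forall>i\<in>I. poly_bounded V (\<delta> i) (g i)" using polyin_bounded[OF g V] by metis
  then obtain \<delta>' where \<delta>': "\<And>i. i \<in> I \<Longrightarrow> poly_bounded V (\<delta>' i) (g i)" by blast
  define \<delta> where "\<delta> = Max (\<delta>' ` I)"
  have \<delta>: "poly_bounded V \<delta> (g i)" if "i \<in> I" for i
    using poly_bounded_mono[OF V \<delta>'[OF that]] I that by (simp add: \<delta>_def)
  let ?N = "card I" and ?M = "card V"
  \<comment> \<open>Chosen such that the constant factor in (\<Delta> + 1)^?M \<le> (D + 1)^?M * (?N
    * \<delta> + 1)^?M is \<open>D\<close> itself, hence smaller than the additional factor D + 1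
    available when \<open>?M < ?N\<close>.\<close>
  define D where "D = Suc (?N * \<delta>) ^ ?M"
  define \<Delta> where "\<Delta> = ?N * (D * \<delta>)"
  have "card (exps V \<Delta>) < card (exps I D)"
  proof -
    have "Suc \<Delta> \<le> Suc D * Suc (?N * \<delta>)" by (simp add: \<Delta>_def algebra_simps)
    then have "Suc \<Delta> ^ ?M \<le> Suc D ^ ?M * D" unfolding D_def
      by (metis power_mult_distrib power_mono zero_le)
    also have "\<dots> < Suc D ^ ?M * Suc D" by simp
    also have "\<dots> = Suc D ^ Suc ?M" by simp
    also have "\<dots> \<le> Suc D ^ ?N" using card by (intro power_increasing) auto
    finally show ?thesis using V I by (simp add: card_exps)
  qed
  have "\<exists>c. \<forall>a. (\<Prod>i\<in>I. g i a ^ e i) = (\<Sum>e'\<in>exps V \<Delta>. c e' * monomial_at V e' a)" if "e \<in> exps I D" for e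
  proof -
    have "poly_bounded V \<Delta> (\<lambda>a. \<Prod>i\<in>I. g i a ^ e i)"
      unfolding \<Delta>_def by (rule poly_bounded_power_prod[OF V I \<delta>]) (use that in \<open>auto simp: exps_def\<close>)
    then show ?thesis by (simp add: poly_bounded_def)
  qed
  then obtain c where c: "\<And>e a. e \<in> exps I D \<Longrightarrow> (\<Prod>i\<in>I. g i a ^ e i) = (\<Sum>e'\<in>exps V \<Delta>. c e e' * monomial_at V e' a)"
    by metis
  obtain x where x: "\<exists>e\<in>exps I D. x e \<noteq> 0" "\<forall>e'\<in>exps V \<Delta>. (\<Sum>e\<in>exps I D. x e * c e e') = 0"
    using more_unknowns_than_equations[OF finite_exps[OF V] finite_exps[OF I] \<open>card (exps V \<Delta>) < card (exps I D)\<close>]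
    by blast
  define P where "P a = (\<Sum>e\<in>exps I D. x e * monomial_at I e a)" for a
  have "polyin I P" unfolding P_def monomial_at_def
    by (intro polyin_sum polyin_mult polyin_const polyin_prod polyin_power polyin_var)
  moreover have "\<exists>a. P a \<noteq> 0" using monomials_independent[OF I, of x D] x(1) unfolding P_def by blast
  moreover have "P (\<lambda>i. g i b) = 0" for b
  proof -
    have "P (\<lambda>i. g i b) = (\<Sum>e\<in>exps I D. \<Sum>e'\<in>exps V \<Delta>. x e * c e e' * monomial_at V e' b)"
      unfolding P_def monomial_at_def[of I] by (intro sum.cong refl) (simp add: c sum_distrib_left mult.assoc)
    also have "\<dots> = (\<Sum>e'\<in>exps V \<Delta>. (\<Sum>e\<in>exps I D. x e * c e e') * monomial_at V e' b)"
      by (subst sum.swap) (simp add: sum_distrib_right)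
    finally show ?thesis using x(2) by simp
  qed
  ultimately show ?thesis by blast
qed

text \<open>Stands in for a bound \<open>M\<close> on the dimension of \<open>S\<close>. Finitely
  many maps are allowed because charts and pivot patterns occur in finitely many combinatorial
  types.\<close>

definition covered :: "nat \<Rightarrow> ('i \<Rightarrow> complex) set \<Rightarrow> bool" where
  "covered M S \<longleftrightarrow> (\<exists>\<Phi> :: ((nat \<Rightarrow> complex) \<Rightarrow> 'i \<Rightarrow> complex) set. finite \<Phi> \<and>
     (\<forall>\<phi>\<in>\<Phi>. \<forall>i. polyin {..<M} (\<lambda>x. \<phi> x i)) \<and> (\<forall>s\<in>S. \<exists>\<phi>\<in>\<Phi>. \<exists>x. s = \<phi> x))"

lemma covered_singleton: "covered 0 {s}"
  unfolding covered_def by (intro exI[of _ "{\<lambda>x. s}"]) (auto intro: polyin.intros)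

text \<open>A construction step from an old state, tagged \<open>Inl\<close>, and fresh parameters,
  tagged \<open>Inr\<close>; it is polynomial in both, so that steps compose.\<close>

definition poly_step :: "'p set \<Rightarrow> (('i \<Rightarrow> complex) \<Rightarrow> ('p \<Rightarrow> complex) \<Rightarrow> 'i \<Rightarrow> complex) \<Rightarrow> bool" where
  "poly_step J \<psi> \<longleftrightarrow> (\<forall>i. polyin (range Inl \<union> Inr ` J) (\<lambda>z. \<psi> (\<lambda>j. z (Inl j)) (\<lambda>p. z (Inr p)) i))"

text \<open>Composition of polynomial maps. The enumeration \<open>h\<close> places the fresh
  parameters behind the first \<open>M\<close> variables, so the parameter numbers add up.\<close>

lemma covered_step:
  fixes \<Psi> :: "(('i \<Rightarrow> complex) \<Rightarrow> ('p \<Rightarrow> complex) \<Rightarrow> 'i \<Rightarrow> complex) set"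
  assumes S: "covered M S" and \<Psi>: "finite \<Psi>" "\<And>\<psi>. \<psi> \<in> \<Psi> \<Longrightarrow> poly_step J \<psi>" and J: "finite J"
  shows "covered (M + card J) {\<psi> s y | \<psi> s y. \<psi> \<in> \<Psi> \<and> s \<in> S}"
proof -
  obtain \<Phi> where \<Phi>: "finite \<Phi>" "\<And>\<phi> i. \<phi> \<in> \<Phi> \<Longrightarrow> polyin {..<M} (\<lambda>x. \<phi> x i)" "\<And>s. s \<in> S \<Longrightarrow> \<exists>\<phi>\<in>\<Phi>. \<exists>x. s = \<phi> x"
    using S unfolding covered_def by (elim exE conjE) (rule that, auto)
  obtain h where h: "bij_betw h J {0..<card J}" using ex_bij_betw_finite_nat[OF J] by blast
  define F where "F \<psi> \<phi> x = \<psi> (\<phi> x) (\<lambda>p. x (M + h p))"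
    for \<psi> :: "('i \<Rightarrow> complex) \<Rightarrow> ('p \<Rightarrow> complex) \<Rightarrow> 'i \<Rightarrow> complex" and \<phi> and x :: "nat \<Rightarrow> complex"
  have "polyin {..<M + card J} (\<lambda>x. F \<psi> \<phi> x i)" if "\<psi> \<in> \<Psi>" "\<phi> \<in> \<Phi>" for \<psi> \<phi> i
  proof -
    define P where "P z = \<psi> (\<lambda>j. z (Inl j)) (\<lambda>p. z (Inr p)) i" for z
    define g where "g w x = (case w of Inl j \<Rightarrow> \<phi> x j | Inr p \<Rightarrow> x (M + h p))" for w x
    have P: "polyin (range Inl \<union> Inr ` J) P"
      using \<Psi>(2)[OF that(1)] unfolding poly_step_def P_def by blast
    have g: "polyin {..<M + card J} (g w)" if w: "w \<in> range Inl \<union> Inr ` J" for w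
    proof (cases w)
      case (Inl j)
      then show ?thesis using polyin_mono[OF \<Phi>(2)[OF \<open>\<phi> \<in> \<Phi>\<close>, of j], of "{..<M + card J}"]
        by (simp add: g_def[abs_def])
    next
      case (Inr p)
      then have "h p < card J" using w h by (auto simp: bij_betw_def)
      then show ?thesis using Inr polyin_var[of "M + h p" "{..<M + card J}"] by (simp add: g_def[abs_def])
    qed
    have "polyin {..<M + card J} (\<lambda>x. P (\<lambda>w. g w x))"
      by (rule polyin_subst[where g = g, OF P g])
    then show ?thesis by (simp add: F_def P_def g_def)
  qed
  moreover have "\<exists>f\<in>(\<lambda>(\<psi>, \<phi>). F \<psi> \<phi>) ` (\<Psi> \<times> \<Phi>). \<exists>x. \<psi> s y = f x" if s: "s \<in> S" and \<psi>: "\<psi> \<in> \<Psi>" for \<psi> s y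
  proof -
    obtain \<phi> x where \<phi>: "\<phi> \<in> \<Phi>" "s = \<phi> x" using \<Phi>(3)[OF s] by blast
    define z where "z m = (if m < M then x m else y (inv_into J h (m - M)))" for m
    have "\<phi> z = \<phi> x" by (rule ext, rule polyin_depends[OF \<Phi>(2)[OF \<phi>(1)]]) (simp add: z_def)
    moreover have "\<psi> (\<phi> z) (\<lambda>p. z (M + h p)) i = \<psi> (\<phi> z) y i" for i
    proof -
      define P where "P z = \<psi> (\<lambda>j. z (Inl j)) (\<lambda>p. z (Inr p)) i" for z
      have P: "polyin (range Inl \<union> Inr ` J) P"
        using \<Psi>(2)[OF \<psi>] unfolding poly_step_def P_def by blast
      have "P (\<lambda>w. case w of Inl j \<Rightarrow> \<phi> z j | Inr p \<Rightarrow> z (M + h p)) =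
         P (\<lambda>w. case w of Inl j \<Rightarrow> \<phi> z j | Inr p \<Rightarrow> y p)"
        by (rule polyin_depends[OF P]) (use h in \<open>auto simp: z_def bij_betw_def\<close>)
      then show ?thesis by (simp add: P_def)
    qed
    ultimately have "\<psi> s y = F \<psi> \<phi> z" using \<phi> by (auto simp: F_def)
    then show ?thesis using \<phi> \<psi> by blast
  qed
  ultimately show ?thesis unfolding covered_def using \<Psi>(1) \<Phi>(1)
    by (intro exI[of _ "(\<lambda>(\<psi>, \<phi>). F \<psi> \<phi>) ` (\<Psi> \<times> \<Phi>)"]) auto
qed

lemma covered_vanishing_poly:
  assumes S: "covered M S" and I: "finite I" "M < card I"
  shows "\<exists>P. polyfun P \<and> (\<exists>a. P a \<noteq> 0) \<and> (\<forall>a. (\<exists>s\<in>S. \<forall>i\<in>I. a i = s i) \<longrightarrow> P a = 0)"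
proof -
  obtain \<Phi> where \<Phi>: "finite \<Phi>" "\<And>\<phi> i. \<phi> \<in> \<Phi> \<Longrightarrow> polyin {..<M} (\<lambda>x. \<phi> x i)" "\<And>s. s \<in> S \<Longrightarrow> \<exists>\<phi>\<in>\<Phi>. \<exists>x. s = \<phi> x"
    using S unfolding covered_def by (elim exE conjE) (rule that, auto)
  have "\<exists>P. polyfun P \<and> (\<exists>a. P a \<noteq> 0) \<and> (\<forall>a. (\<exists>\<phi>\<in>\<Phi>. \<exists>x. \<forall>i\<in>I. a i = \<phi> x i) \<longrightarrow> P a = 0)"
  proof (rule common_nonzero_polyfun[OF \<Phi>(1)])
    fix \<phi> assume \<phi>: "\<phi> \<in> \<Phi>"
    obtain P where P: "polyin I P" "\<exists>a. P a \<noteq> 0" "\<forall>x. P (\<lambda>i. \<phi> x i) = 0"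
      using algebraic_dependence[of "{..<M}" I "\<lambda>i x. \<phi> x i"] I \<Phi>(2)[OF \<phi>] by auto
    have "P a = 0" if "\<forall>i\<in>I. a i = \<phi> x i" for a x
      using polyin_depends[OF P(1), of a "\<phi> x"] that P(3) by simp
    then show "\<exists>P. polyfun P \<and> (\<exists>a. P a \<noteq> 0) \<and> (\<forall>a. (\<exists>x. \<forall>i\<in>I. a i = \<phi> x i) \<longrightarrow> P a = 0)"
      using P polyin_imp_polyfun by blast
  qed
  then show ?thesis using \<Phi>(3) by metis
qed

section \<open>Normal forms of subspaces and flags\<close>

text \<open>Configurations of subspaces are encoded by the coordinates of vectors kept in numbered registers;
  registers 0, 1, 2 hold the three flags, with the indexing of \<^const>\<open>flag_of\<close>.\<close>

definition reg :: "(nat \<times> nat \<times> 'n \<Rightarrow> complex) \<Rightarrow> nat \<Rightarrow> nat \<Rightarrow> complex^'n" where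
  "reg s r i = (\<chi> c. s (r, i, c))"

lemma flag_of_reg: "flag_of a m i = vec.span (reg a m ` {..<i})"
  by (simp add: flag_of_def reg_def[abs_def])

lemma span_of_subspace: "vec.subspace U \<Longrightarrow> vec.span U = U"
  by (simp only: vec.span_eq_iff)

lemma dim_union_le:
  "finite T \<Longrightarrow> vec.dim (X \<union> T) \<le> vec.dim X + card (T :: (complex^'n) set)"
  by (induction T rule: finite_induct) (auto simp: vec.dim_insert)

text \<open>Standard chart of the Grassmannian of p-dimensional subspaces of M / L, with p (q - p)
  parameters \<open>y\<close>. A maximal set of vectors \<open>m i\<close> independent modulo
  \<open>U\<close> is the complement; the other \<open>m i\<close>, corrected by combinations of
  these, span \<open>U\<close> modulo \<open>L\<close>. The complement is returned because a later
  subspace may be sought between \<open>U\<close> and \<open>M\<close>.\<close>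

lemma relative_chart:
  fixes lb m :: "nat \<Rightarrow> complex^'n"
  assumes L: "vec.span (lb ` {..<l}) = L"
    and M: "vec.span (L \<union> m ` {..<q}) = M" "cdim M = l + q"
    and U: "cspace U" "L \<subseteq> U" "U \<subseteq> M" "cdim U = l + p" and p: "p \<le> q"
  obtains \<sigma> \<tau> y where "\<sigma> \<in> PiE {..<p} (\<lambda>_. {..<q})" "\<tau> \<in> PiE {..<q-p} (\<lambda>_. {..<q})"
    "vec.span (lb ` {..<l} \<union> (\<lambda>i. m (\<sigma> i) + (\<Sum>j<q-p. y (i,j) *s m (\<tau> j))) ` {..<p}) = U"
    "vec.span (U \<union> (\<lambda>j. m (\<tau> j)) ` {..<q-p}) = M"
proof -
  define ok where "ok T \<longleftrightarrow> T \<subseteq> {..<q} \<and> vec.dim (U \<union> m ` T) = vec.dim U + card T" for T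
  have "ok {}" by (simp add: ok_def)
  moreover have "finite {T. ok T}" by (rule finite_subset[of _ "Pow {..<q}"]) (auto simp: ok_def)
  ultimately obtain T where T: "ok T" "\<And>T'. ok T' \<Longrightarrow> T \<subseteq> T' \<Longrightarrow> T' = T"
    using finite_has_maximal[of "{T. ok T}"] by auto
  have Tq: "T \<subseteq> {..<q}" "finite T" using T(1) finite_subset by (auto simp: ok_def)
  have mM: "m i \<in> M" if "i < q" for i
    unfolding M(1)[symmetric] using that by (intro vec.span_base) auto
  have sM: "vec.subspace M" unfolding M(1)[symmetric] by (rule vec.subspace_span)
  have UT: "vec.span (U \<union> m ` T) = M"
  proof
    show "vec.span (U \<union> m ` T) \<subseteq> M"
      using U(3) Tq mM sM by (intro vec.span_minimal) auto
    have "m i \<in> vec.span (U \<union> m ` T)" if i: "i < q" for i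
    proof (rule ccontr)
      assume *: "m i \<notin> vec.span (U \<union> m ` T)"
      then have "i \<notin> T" by (auto intro: vec.span_base)
      then have "ok (insert i T)" using T(1) Tq i * by (simp add: ok_def vec.dim_insert)
      then show False using T(2) \<open>i \<notin> T\<close> by blast
    qed
    then show "M \<subseteq> vec.span (U \<union> m ` T)" unfolding M(1)[symmetric]
      using U by (intro vec.span_minimal) (auto intro: vec.span_base)
  qed
  have "cdim M = cdim U + card T"
    unfolding UT[symmetric] using T(1) by (simp add: ok_def cdim_def)
  then have cT: "card T = q - p" using M(2) U(4) p by simp
  define I where "I = {..<q} - T"
  have cI: "card I = p" using Tq cT p by (simp add: I_def card_Diff_subset)
  obtain \<sigma>0 where \<sigma>0: "bij_betw \<sigma>0 {0..<p} I"
    using ex_bij_betw_nat_finite[of I] cI by (auto simp: I_def)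
  obtain \<tau>0 where \<tau>0: "bij_betw \<tau>0 {0..<q-p} T"
    using ex_bij_betw_nat_finite[of T] cT Tq by auto
  define \<sigma> where "\<sigma> = restrict \<sigma>0 {..<p}"
  define \<tau> where "\<tau> = restrict \<tau>0 {..<q-p}"
  have \<sigma>: "\<sigma> ` {..<p} = I" using \<sigma>0 by (simp add: \<sigma>_def bij_betw_def lessThan_atLeast0)
  have \<tau>: "\<tau> ` {..<q-p} = T" using \<tau>0 by (simp add: \<tau>_def bij_betw_def lessThan_atLeast0)
  have mT: "(\<lambda>j. m (\<tau> j)) ` {..<q-p} = m ` T" unfolding \<tau>[symmetric] by (simp add: image_image)
  have "\<exists>c. m (\<sigma> i) + (\<Sum>j<q-p. c j *s m (\<tau> j)) \<in> U" if "i < p" for i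
  proof -
    have "\<sigma> i < q" using \<sigma> that by (auto simp: I_def)
    then have "m (\<sigma> i) \<in> vec.span (U \<union> m ` T)" using UT mM by blast
    then obtain u v where uv: "m (\<sigma> i) = u + v" "u \<in> vec.span U" "v \<in> vec.span (m ` T)"
      unfolding vec.span_Un by blast
    then obtain c where c: "v = (\<Sum>j<q-p. c j *s m (\<tau> j))"
      using span_image_lessThan[of v "\<lambda>j. m (\<tau> j)" "q - p"] mT by auto
    have "m (\<sigma> i) + (\<Sum>j<q-p. (- c j) *s m (\<tau> j)) = u" using uv(1) c by (simp add: sum_negf)
    then show ?thesis using uv(2) U(1) by (intro exI[of _ "\<lambda>j. - c j"]) (simp add: cspace_def span_of_subspace)
  qed
  then obtain c where c: "\<And>i. i < p \<Longrightarrow> m (\<sigma> i) + (\<Sum>j<q-p. c i j *s m (\<tau> j)) \<in> U" by metis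
  define y where "y = (\<lambda>(i,j). c i j)"
  let ?u = "\<lambda>i. m (\<sigma> i) + (\<Sum>j<q-p. y (i,j) *s m (\<tau> j))"
  let ?U' = "vec.span (lb ` {..<l} \<union> ?u ` {..<p})"
  have U'U: "?U' \<subseteq> U" using U c L
    by (intro vec.span_minimal) (auto simp: cspace_def y_def intro: vec.span_base)
  have sub: "M \<subseteq> vec.span (?U' \<union> m ` T)" unfolding M(1)[symmetric]
  proof (intro vec.span_minimal Un_least vec.subspace_span)
    show "L \<subseteq> vec.span (?U' \<union> m ` T)" unfolding L[symmetric]
      by (meson Un_upper1 order.trans vec.span_mono vec.span_superset)
    show "m ` {..<q} \<subseteq> vec.span (?U' \<union> m ` T)"
    proof clarify
      fix i assume "i < q"
      show "m i \<in> vec.span (?U' \<union> m ` T)"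
      proof (cases "i \<in> T")
        case False
        then have "i \<in> I" using \<open>i < q\<close> by (simp add: I_def)
        then obtain i' where i': "i' < p" "i = \<sigma> i'" using \<sigma> by blast
        have "?u i' \<in> ?U'" using i' by (intro vec.span_base) auto
        then have "?u i' \<in> vec.span (?U' \<union> m ` T)" by (intro vec.span_base) auto
        moreover have "(\<Sum>j<q-p. y (i',j) *s m (\<tau> j)) \<in> vec.span (?U' \<union> m ` T)"
        proof (intro vec.span_sum vec.span_scale)
          fix j assume "j \<in> {..<q-p}"
          then have "\<tau> j \<in> T" using \<tau> by blast
          then show "m (\<tau> j) \<in> vec.span (?U' \<union> m ` T)" by (intro vec.span_base) auto
        qed
        ultimately have "?u i' - (\<Sum>j<q-p. y (i',j) *s m (\<tau> j)) \<in> vec.span (?U' \<union> m ` T)"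
          by (rule vec.span_diff)
        then show ?thesis by (simp add: i')
      qed (auto intro: vec.span_base)
    qed
  qed
  \<comment> \<open>Equality of \<open>?U'\<close> and \<open>U\<close> is a dimension count: at
    most q - p further vectors complete \<open>?U'\<close> to M.\<close>
  have "cdim M \<le> vec.dim (?U' \<union> m ` T)" using vec.dim_mono[OF sub] by (simp add: cdim_def)
  also have "\<dots> \<le> vec.dim ?U' + card (m ` T)" using Tq by (intro dim_union_le) simp
  also have "\<dots> \<le> vec.dim ?U' + (q - p)" using card_image_le[OF Tq(2), of m] cT by simp
  finally have "vec.dim U \<le> vec.dim ?U'" using M(2) U(4) p by (simp add: cdim_def)
  then have "?U' = U" using vec.subspace_dim_equal[of ?U' U] U'U U(1) by (simp add: cspace_def)
  moreover have "\<sigma> \<in> PiE {..<p} (\<lambda>_. {..<q})" using \<sigma> by (auto simp: \<sigma>_def I_def)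
  moreover have "\<tau> \<in> PiE {..<q-p} (\<lambda>_. {..<q})" using \<tau> Tq by (auto simp: \<tau>_def)
  moreover have "vec.span (U \<union> (\<lambda>j. m (\<tau> j)) ` {..<q-p}) = M" unfolding mT by (rule UT)
  ultimately show ?thesis using that[of \<sigma> \<tau> y] by blast
qed

lemma flag_dim:
  fixes a :: "nat \<times> nat \<times> 'n::finite \<Rightarrow> complex"
  assumes "complete_flag (flag_of a m)" "i \<le> CARD('n)"
  shows "cdim (flag_of a m i) = i"
  using assms by (simp add: complete_flag_def)

text \<open>Echelon form: \<open>\<kappa> i\<close> is \<open>Inr l\<close> if \<open>i\<close> is the pivot number \<open>l\<close> of \<open>V\<close> with respect to the flag, and
  \<open>Inl j\<close> if \<open>i\<close> is the non-pivot number \<open>j\<close>.  The Schubert condition bounds the number of non-pivots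
  before the pivot number \<open>l\<close> by \<open>CARD('n) - k - lam (Suc l)\<close>.\<close>

lemma schubert_normal_form:
  fixes a :: "nat \<times> nat \<times> 'n::finite \<Rightarrow> complex" and V :: "(complex^'n) set" and m :: nat
  defines "w \<equiv> reg a m"
  assumes F: "complete_flag (flag_of a m)" and V: "V \<in> schubert k lam (flag_of a m)"
    and lam: "partition_in_rect k (CARD('n) - k) lam" and k: "k < CARD('n)"
  obtains \<kappa> np z where "\<kappa> \<in> PiE {..<CARD('n)} (\<lambda>_. {..<CARD('n) - k} <+> {..<k})"
    "inj_on \<kappa> {..<CARD('n)}"
    "\<And>i j. i < CARD('n) \<Longrightarrow> \<kappa> i = Inl j \<Longrightarrow> np j = i"
    "\<And>i l. i < CARD('n) \<Longrightarrow> \<kappa> i = Inr l \<Longrightarrow>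
       w i - (\<Sum>j<CARD('n) - k - lam (Suc l). z l j *s w (np j)) \<in> V"
proof -
  let ?n = "CARD('n)" and ?r = "CARD('n) - k"
  define F' where "F' i = flag_of a m i" for i
  have F': "F' i = vec.span (w ` {..<i})" for i by (simp add: F'_def flag_of_reg w_def)
  have dF: "vec.dim (F' i) = i" if "i \<le> ?n" for i using flag_dim[OF F that] by (simp add: F'_def cdim_def)
  have Vk: "vec.subspace V" "vec.dim V = k" using V by (auto simp: schubert_def Grass_def cspace_def cdim_def)
  have F'Suc: "F' (Suc i) = vec.span (insert (w i) (F' i))" for i
    unfolding F' vec.span_eq
    using vec.span_superset[of "insert (w i) (vec.span (w ` {..<i}))"]
      vec.span_mono[of "w ` {..<i}" "w ` {..<Suc i}"]
    by (auto simp: lessThan_Suc intro: vec.span_base)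
  \<comment> \<open>As \<open>g\<close> grows by one exactly at the pivots, \<open>g i\<close>
    counts the pivots before \<open>i\<close>, and \<open>i - g i\<close> the non-pivots before
    \<open>i\<close>.\<close>
  define g where "g i = vec.dim (V \<inter> F' i)" for i
  define piv where "piv i \<longleftrightarrow> g (Suc i) \<noteq> g i" for i
  have sF: "vec.subspace (F' i)" for i by (simp add: F')
  have sVF: "vec.subspace (V \<inter> F' i)" for i using Vk sF by (simp add: vec.subspace_inter)
  have mono_F: "F' i \<subseteq> F' j" if "i \<le> j" for i j unfolding F' using that by (intro vec.span_mono) auto
  have pivot_vec: "\<exists>v\<in>V. \<exists>x\<in>F' i. w i = v + x" if "piv i" for i
  proof -
    have "V \<inter> F' i \<noteq> V \<inter> F' (Suc i)" using that by (auto simp: piv_def g_def)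
    then obtain v where v: "v \<in> V" "v \<in> F' (Suc i)" "v \<notin> F' i" using mono_F[of i "Suc i"] by auto
    then obtain c where c: "v - c *s w i \<in> F' i"
      unfolding F'Suc vec.span_insert using sF by (auto simp: span_of_subspace)
    have "c \<noteq> 0" using c v by auto
    have "w i = (1/c) *s v + - ((1/c) *s (v - c *s w i))"
      using \<open>c \<noteq> 0\<close> by (simp add: vec.scale_right_diff_distrib vector_smult_assoc)
    moreover have "(1/c) *s v \<in> V" using Vk v by (intro vec.subspace_scale)
    moreover have "- ((1/c) *s (v - c *s w i)) \<in> F' i" using c sF by (intro vec.subspace_neg vec.subspace_scale)
    ultimately show ?thesis by blast
  qed
  have gSuc: "g (Suc i) = (if piv i then Suc (g i) else g i)" for i
  proof (cases "piv i")
    case True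
    have "V \<inter> F' i \<subseteq> V \<inter> F' (Suc i)" using mono_F[of i "Suc i"] by auto
    then have ge: "g i \<le> g (Suc i)" unfolding g_def by (rule vec.dim_subset)
    obtain v x where v: "v \<in> V" "x \<in> F' i" "w i = v + x" using pivot_vec[OF True] by blast
    have "V \<inter> F' (Suc i) \<subseteq> vec.span (insert v (V \<inter> F' i))"
    proof
      fix u assume u: "u \<in> V \<inter> F' (Suc i)"
      then obtain c where c: "u - c *s w i \<in> F' i"
        unfolding F'Suc vec.span_insert using sF by (auto simp: span_of_subspace)
      have "u - c *s v = (u - c *s w i) + c *s x" by (simp add: v(3) vec.scale_right_distrib)
      also have "\<dots> \<in> F' i" using c v(2) sF by (intro vec.subspace_add vec.subspace_scale)
      finally have "u - c *s v \<in> V \<inter> F' i"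
        using u v(1) Vk by (auto intro!: vec.subspace_diff vec.subspace_scale)
      then show "u \<in> vec.span (insert v (V \<inter> F' i))"
        by (subst vec.span_insert) (blast intro: vec.span_base)
    qed
    from vec.dim_mono[OF this] have "g (Suc i) \<le> Suc (g i)"
      unfolding g_def by (auto simp: vec.dim_insert split: if_splits)
    then show ?thesis using True ge by (auto simp: piv_def)
  qed (simp add: piv_def)
  have g0: "g 0 = 0" by (simp add: g_def F' vec.dim_insert)
  have gk: "g i \<le> k" for i unfolding g_def Vk(2)[symmetric] by (rule vec.dim_subset) auto
  have gn: "g ?n = k"
  proof -
    have "vec.dim (F' ?n) = CARD('n)" by (rule dF) simp
    then have "F' ?n = UNIV" using sF[of ?n] vec.dim_eq_full[of "F' ?n"] by (simp add: span_of_subspace vec.dimension_def card_cart_basis)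
    then show ?thesis by (simp add: g_def Vk)
  qed
  have gi: "g i \<le> i" for i by (induction i) (auto simp: g0 gSuc)
  have rank_mono: "i - g i \<le> j - g j" if "i \<le> j" for i j
    using that by (induction j rule: dec_induct) (use gi gSuc in \<open>auto simp: Suc_diff_le\<close>)
  have rank_less: "i - g i < j - g j" if "i < j" "\<not> piv i" for i j
  proof -
    have "i - g i < Suc i - g (Suc i)" using that(2) gSuc[of i] gi[of i] by simp
    also have "\<dots> \<le> j - g j" using that(1) by (intro rank_mono) simp
    finally show ?thesis .
  qed
  define \<kappa> where "\<kappa> = restrict (\<lambda>i. if piv i then Inr (g i) else Inl (i - g i)) {..<?n}"
  define np where "np j = (THE i. \<not> piv i \<and> i - g i = j)" for j
  have np: "np (i - g i) = i" if "\<not> piv i" for i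
    unfolding np_def using that rank_less by (intro the_equality) (auto, metis less_irrefl linorder_neqE_nat)
  have K1: "\<kappa> \<in> PiE {..<?n} (\<lambda>_. {..<?r} <+> {..<k})"
  proof -
    have "g i < k" if "piv i" for i using gSuc[of i] gk[of "Suc i"] that by simp
    moreover have "i - g i < ?r" if "\<not> piv i" "i < ?n" for i using rank_less[OF that(2,1)] by (simp add: gn)
    ultimately show ?thesis by (auto simp: \<kappa>_def)
  qed
  have K2: "np j = i" if "i < ?n" "\<kappa> i = Inl j" for i j
    using that np by (auto simp: \<kappa>_def split: if_splits)
  have K3: "\<exists>z. w i - (\<Sum>j<?r - lam (Suc l). z j *s w (np j)) \<in> V" if i: "i < ?n" and l: "\<kappa> i = Inr l" for i l
  proof -
    have pi: "piv i" "g i = l" using i l by (auto simp: \<kappa>_def split: if_splits)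
    define N where "N i = w ` {l. l < i \<and> \<not> piv l}" for i
    \<comment> \<open>The remainder supplied by \<open>pivot_vec\<close> may involve earlier pivot
      vectors. Induction eliminates these and leaves only earlier non-pivot vectors.\<close>
    have mem: "w i \<in> vec.span (V \<union> N i)" if "piv i" for i
      using that
    proof (induction i rule: less_induct)
      case (less i)
      obtain v x where v: "v \<in> V" "x \<in> F' i" "w i = v + x" using pivot_vec[OF less.prems] by blast
      have "F' i \<subseteq> vec.span (V \<union> N i)" unfolding F'
      proof (intro vec.span_minimal vec.subspace_span, clarify)
        fix l assume l: "l < i"
        show "w l \<in> vec.span (V \<union> N i)"
        proof (cases "piv l")
          case True
          have "N l \<subseteq> N i" using l by (auto simp: N_def)
          then have "vec.span (V \<union> N l) \<subseteq> vec.span (V \<union> N i)" by (intro vec.span_mono) auto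
          then show ?thesis using less.IH[OF l True] by blast
        next
          case False
          then show ?thesis using l by (intro vec.span_base) (auto simp: N_def)
        qed
      qed
      then show ?case unfolding v(3) using v by (intro vec.span_add) (auto intro: vec.span_base)
    qed
    have "l < k" using gSuc[of i] gk[of "Suc i"] pi by simp
    then have lam': "lam (Suc l) \<le> ?r" using lam by (simp add: partition_in_rect_def)
    have "Suc l \<le> g (?n - k + Suc l - lam (Suc l))"
    proof -
      have "\<forall>i. 1 \<le> i \<longrightarrow> i \<le> k \<longrightarrow> i \<le> cdim (V \<inter> flag_of a m (?n - k + i - lam i))"
        using V unfolding schubert_def by blast
      from this[rule_format, of "Suc l"] \<open>l < k\<close> show ?thesis by (simp add: g_def F'_def cdim_def)
    qed
    moreover have "g j \<le> g i" if "j \<le> i" for j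
      unfolding g_def using mono_F[OF that] by (intro vec.dim_subset) auto
    \<comment> \<open>At \<open>i\<close> the dimension of the intersection is still
      \<open>l\<close>, whereas the Schubert condition gives at least l + 1 at the index on the
      right. Pivots are counted from 0 and parts of \<open>lam\<close> from 1, hence
      \<open>Suc l\<close>.\<close>
    ultimately have "i < ?r + Suc l - lam (Suc l)" using pi(2) by (metis Suc_le_eq leD not_le)
    then have bound: "i - g i \<le> ?r - lam (Suc l)" using pi lam' by simp
    have "N i \<subseteq> (\<lambda>j. w (np j)) ` {..<?r - lam (Suc l)}"
    proof
      fix x assume "x \<in> N i"
      then obtain j where j: "j < i" "\<not> piv j" "x = w j" by (auto simp: N_def)
      have "j - g j < ?r - lam (Suc l)" using rank_less[OF j(1,2)] bound by simp
      then show "x \<in> (\<lambda>j. w (np j)) ` {..<?r - lam (Suc l)}"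
        using np[OF j(2)] j(3) by (intro image_eqI[of _ _ "j - g j"]) auto
    qed
    then have "vec.span (V \<union> N i) \<subseteq> vec.span (V \<union> (\<lambda>j. w (np j)) ` {..<?r - lam (Suc l)})"
      by (intro vec.span_mono) auto
    then have "w i \<in> vec.span (V \<union> (\<lambda>j. w (np j)) ` {..<?r - lam (Suc l)})" using mem[OF pi(1)] by blast
    then obtain v x where vx: "w i = v + x" "v \<in> vec.span V" "x \<in> vec.span ((\<lambda>j. w (np j)) ` {..<?r - lam (Suc l)})"
      unfolding vec.span_Un by blast
    then obtain z where "x = (\<Sum>j<?r - lam (Suc l). z j *s w (np j))"
      using span_image_lessThan[of x "\<lambda>j. w (np j)"] by blast
    then show ?thesis using vx(1,2) Vk(1) by (intro exI[of _ z]) (simp add: span_of_subspace)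
  qed
  have K4: "inj_on \<kappa> {..<?n}"
  proof (rule inj_onI)
    have Suc_le: "g (Suc i) \<le> g j" if "i < j" for i j
      unfolding g_def using mono_F[of "Suc i" j] that by (intro vec.dim_subset) auto
    have pp: False if "piv i" "i < j" "g i = g j" for i j
      using that gSuc[of i] Suc_le[OF that(2)] by simp
    fix i j assume "i \<in> {..<?n}" "j \<in> {..<?n}" "\<kappa> i = \<kappa> j"
    then show "i = j" using np[of i] np[of j] pp[of i j] pp[of j i]
      by (cases i j rule: linorder_cases) (auto simp: \<kappa>_def split: if_splits)
  qed
  \<comment> \<open>The coefficients are indexed by the pivot number, not by the position
    \<open>i\<close>, so that one set of parameters serves all patterns
    \<open>\<kappa>\<close>.\<close>
  have "\<exists>z. \<forall>i<?n. \<kappa> i = Inr l \<longrightarrow> w i - (\<Sum>j<?r - lam (Suc l). z j *s w (np j)) \<in> V" for l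
  proof (cases "\<exists>i<?n. \<kappa> i = Inr l")
    case True
    then obtain i where i: "i < ?n" "\<kappa> i = Inr l" by blast
    obtain z where z: "w i - (\<Sum>j<?r - lam (Suc l). z j *s w (np j)) \<in> V" using K3[OF i] by blast
    have "i' = i" if "i' < ?n" "\<kappa> i' = Inr l" for i'
      using K4 i that by (metis inj_onD lessThan_iff)
    then show ?thesis using z by blast
  qed simp
  then obtain z where z: "\<And>l. \<forall>i<?n. \<kappa> i = Inr l \<longrightarrow> w i - (\<Sum>j<?r - lam (Suc l). z l j *s w (np j)) \<in> V"
    by metis
  show ?thesis using that[of \<kappa> np z, OF K1 K4 K2] z by blast
qed

section \<open>Parametrizing subspaces and flags\<close>

text \<open>Spanning families of the right size are bases, so the two dimension clauses take the
  place of independence.\<close>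

definition chart :: "(nat \<times> nat \<times> 'n \<Rightarrow> complex) \<Rightarrow> nat \<Rightarrow> nat \<Rightarrow> nat \<Rightarrow> nat \<Rightarrow>
    (complex^'n) set \<Rightarrow> (complex^'n) set \<Rightarrow> bool" where
  "chart s rl l rm q L M \<longleftrightarrow> vec.span (reg s rl ` {..<l}) = L \<and>
     vec.span (L \<union> reg s rm ` {..<q}) = M \<and> cdim L = l \<and> cdim M = l + q"

text \<open>Writes the basis of \<open>U\<close> from \<open>relative_chart\<close> into
  \<open>ru\<close> and the complement into \<open>rc\<close>. The index choices
  \<open>\<sigma>\<close> and \<open>\<tau>\<close> are discrete; only \<open>y\<close> counts as
  parameters.\<close>

definition sub_op :: "nat \<Rightarrow> nat \<Rightarrow> nat \<Rightarrow> nat \<Rightarrow> nat \<Rightarrow> nat \<Rightarrow> nat \<Rightarrow> (nat \<Rightarrow> nat) \<Rightarrow> (nat \<Rightarrow> nat) \<Rightarrow>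
    (nat \<times> nat \<times> 'n \<Rightarrow> complex) \<Rightarrow> (nat \<times> nat \<Rightarrow> complex) \<Rightarrow> nat \<times> nat \<times> 'n \<Rightarrow> complex" where
  "sub_op rl l rm q ru rc p \<sigma> \<tau> s y = (\<lambda>(r, i, c).
     if r = ru then
       if i < l then s (rl, i, c)
       else if i < l + p then s (rm, \<sigma> (i - l), c) + (\<Sum>j<q-p. y (i - l, j) * s (rm, \<tau> j, c))
       else 0
     else if r = rc then s (rm, \<tau> i, c) else s (r, i, c))"

lemma poly_step_sub_op:
  fixes rl :: nat
  shows "poly_step ({..<p} \<times> {..<q-p}) (sub_op rl l rm q ru rc p \<sigma> \<tau> :: (nat \<times> nat \<times> 'n \<Rightarrow> complex) \<Rightarrow> _)"
  unfolding poly_step_def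
proof
  fix x :: "nat \<times> nat \<times> 'n"
  obtain r i c where x: "x = (r, i, c)" by (cases x) auto
  have l: "polyin (range Inl \<union> Inr ` ({..<p} \<times> {..<q-p})) (\<lambda>z. z (Inl v))" for v :: "nat \<times> nat \<times> 'n"
    by (rule polyin_var) simp
  show "polyin (range Inl \<union> Inr ` ({..<p} \<times> {..<q-p}))
    (\<lambda>z. sub_op rl l rm q ru rc p \<sigma> \<tau> (\<lambda>j. z (Inl j)) (\<lambda>p. z (Inr p)) x)"
    unfolding sub_op_def x prod.case
    by (cases "r = ru"; cases "i < l"; cases "i < l + p"; cases "r = rc")
      (auto intro!: polyin_add polyin_sum polyin_mult polyin_const l intro: polyin_var)
qed

text \<open>The set \<open>S'\<close> is fixed before the configuration is known, and the other
  registers are preserved; both are needed to chain steps.\<close>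

definition subspace_step :: "(nat \<times> nat \<times> 'n::finite \<Rightarrow> complex) set \<Rightarrow> nat \<Rightarrow> nat \<Rightarrow> nat \<Rightarrow> nat \<Rightarrow>
    nat \<Rightarrow> nat \<Rightarrow> nat \<Rightarrow> (nat \<times> nat \<times> 'n \<Rightarrow> complex) set \<Rightarrow> bool" where
  "subspace_step S rl l rm q ru rc p S' \<longleftrightarrow>
    (\<forall>s L N U. s \<in> S \<longrightarrow> chart s rl l rm q L N \<longrightarrow> cspace U \<longrightarrow> L \<subseteq> U \<longrightarrow> U \<subseteq> N \<longrightarrow> cdim U = l + p \<longrightarrow>
      (\<exists>s'\<in>S'. chart s' ru (l + p) rc (q - p) U N \<and> (\<forall>r. r \<noteq> ru \<longrightarrow> r \<noteq> rc \<longrightarrow> reg s' r = reg s r)))"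

lemma covered_subspace_step:
  fixes S :: "(nat \<times> nat \<times> 'n::finite \<Rightarrow> complex) set"
  assumes S: "covered M S" and p: "p \<le> q" and r: "ru \<noteq> rc"
  shows "\<exists>S'. covered (M + p * (q - p)) S' \<and> subspace_step S rl l rm q ru rc p S'"
proof -
  define \<Psi> :: "((nat \<times> nat \<times> 'n \<Rightarrow> complex) \<Rightarrow> _) set" where
    "\<Psi> = (\<lambda>(\<sigma>, \<tau>). sub_op rl l rm q ru rc p \<sigma> \<tau>) ` (PiE {..<p} (\<lambda>_. {..<q}) \<times> PiE {..<q-p} (\<lambda>_. {..<q}))"
  define S' where "S' = {\<psi> s y | \<psi> s y. \<psi> \<in> \<Psi> \<and> s \<in> S}"
  have "covered (M + card ({..<p} \<times> {..<q-p})) S'"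
    unfolding S'_def
  proof (rule covered_step[OF S])
    show "finite \<Psi>" unfolding \<Psi>_def by (intro finite_imageI finite_cartesian_product finite_PiE) auto
    show "poly_step ({..<p} \<times> {..<q-p}) \<psi>" if "\<psi> \<in> \<Psi>" for \<psi>
      using that poly_step_sub_op by (auto simp: \<Psi>_def)
  qed simp
  moreover have "\<exists>s'\<in>S'. chart s' ru (l + p) rc (q - p) U N \<and> (\<forall>r. r \<noteq> ru \<longrightarrow> r \<noteq> rc \<longrightarrow> reg s' r = reg s r)"
    if s: "s \<in> S" and c: "chart s rl l rm q L N" and U: "cspace U" "L \<subseteq> U" "U \<subseteq> N" "cdim U = l + p" for s L N U
  proof -
    have L: "vec.span (reg s rl ` {..<l}) = L" and N: "vec.span (L \<union> reg s rm ` {..<q}) = N" "cdim N = l + q"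
      using c by (auto simp: chart_def)
    obtain \<sigma> \<tau> y where *: "\<sigma> \<in> PiE {..<p} (\<lambda>_. {..<q})" "\<tau> \<in> PiE {..<q-p} (\<lambda>_. {..<q})"
      "vec.span (reg s rl ` {..<l} \<union> (\<lambda>i. reg s rm (\<sigma> i) + (\<Sum>j<q-p. y (i,j) *s reg s rm (\<tau> j))) ` {..<p}) = U"
      "vec.span (U \<union> (\<lambda>j. reg s rm (\<tau> j)) ` {..<q-p}) = N"
      using relative_chart[OF L N U p] .
    define s' where "s' = sub_op rl l rm q ru rc p \<sigma> \<tau> s y"
    have "sub_op rl l rm q ru rc p \<sigma> \<tau> \<in> \<Psi>" using *(1,2) by (auto simp: \<Psi>_def)
    then have "s' \<in> S'" using s by (auto simp: S'_def s'_def)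
    have "{..<l + p} = {..<l} \<union> (\<lambda>i. l + i) ` {..<p}"
      using ivl_disj_un_one(2)[of l "l + p"] image_add_atLeastLessThan[of l 0 p]
      by (simp add: lessThan_atLeast0 add.commute)
    moreover have "reg s' ru i = reg s rl i" if "i < l" for i
      using that by (simp add: reg_def s'_def sub_op_def vec_eq_iff)
    moreover have "reg s' ru (l + i) = reg s rm (\<sigma> i) + (\<Sum>j<q-p. y (i,j) *s reg s rm (\<tau> j))" if "i < p" for i
      using that by (simp add: reg_def s'_def sub_op_def vec_eq_iff)
    ultimately have "reg s' ru ` {..<l + p} = reg s rl ` {..<l} \<union>
       (\<lambda>i. reg s rm (\<sigma> i) + (\<Sum>j<q-p. y (i,j) *s reg s rm (\<tau> j))) ` {..<p}"
      by (simp add: image_Un image_image)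
    moreover have "reg s' rc i = reg s rm (\<tau> i)" for i
      using r by (simp add: reg_def s'_def sub_op_def vec_eq_iff)
    moreover have "reg s' r = reg s r" if "r \<noteq> ru" "r \<noteq> rc" for r
      using that by (simp add: reg_def s'_def sub_op_def vec_eq_iff fun_eq_iff)
    ultimately have "chart s' ru (l + p) rc (q - p) U N \<and> (\<forall>r. r \<noteq> ru \<longrightarrow> r \<noteq> rc \<longrightarrow> reg s' r = reg s r)"
      using * U N p by (simp add: chart_def)
    with \<open>s' \<in> S'\<close> show ?thesis by blast
  qed
  ultimately show ?thesis unfolding subspace_step_def
    by (intro exI[of _ S']) (simp add: card_cartesian_product)
qed

text \<open>Inverts the echelon form of \<open>schubert_normal_form\<close>: with V in register
  \<open>rv\<close>, the non-pivot flag vectors are free, and a pivot vector is an element of V plus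
  a combination of as many initial non-pivot vectors as \<open>lam\<close> permits.\<close>

definition flag_op :: "nat \<Rightarrow> nat \<Rightarrow> nat \<Rightarrow> (nat \<Rightarrow> nat) \<Rightarrow> (nat \<Rightarrow> nat + nat) \<Rightarrow> (nat \<times> nat \<times> 'n::finite \<Rightarrow> complex) \<Rightarrow>
    ((nat \<times> 'n) + (nat \<times> nat) + (nat \<times> nat) \<Rightarrow> complex) \<Rightarrow> nat \<times> nat \<times> 'n \<Rightarrow> complex" where
  "flag_op m rv k lam \<kappa> s y = (\<lambda>(r, i, c).
     if r = m then
       if i < CARD('n) then
         case \<kappa> i of Inl j \<Rightarrow> y (Inl (j, c))
         | Inr l \<Rightarrow> (\<Sum>h<k. y (Inr (Inl (l, h))) * s (rv, h, c)) +
              (\<Sum>j<CARD('n) - k - lam (Suc l). y (Inr (Inr (l, j))) * y (Inl (j, c)))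
       else 0
     else s (r, i, c))"

definition flag_params :: "nat \<Rightarrow> (nat \<Rightarrow> nat) \<Rightarrow> ((nat \<times> 'n::finite) + (nat \<times> nat) + (nat \<times> nat)) set" where
  "flag_params k lam = ({..<CARD('n) - k} \<times> UNIV) <+> ({..<k} \<times> {..<k}) <+>
     (SIGMA l:{..<k}. {..<CARD('n) - k - lam (Suc l)})"

text \<open>The sum (n - k) n + k^2 + (k (n - k) - |lam|) is n^2 - |lam|; the deficit is the
  codimension of the Schubert condition.\<close>

lemma card_flag_params:
  assumes lam: "partition_in_rect k (CARD('n) - k) lam" and k: "k < CARD('n)"
  shows "finite (flag_params k lam :: (nat \<times> 'n::finite + _) set)"
    "card (flag_params k lam :: (nat \<times> 'n + _) set) + part_size k lam = CARD('n) * CARD('n)"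
proof -
  let ?r = "CARD('n) - k"
  show "finite (flag_params k lam :: (nat \<times> 'n + _) set)" by (simp add: flag_params_def)
  have ps: "part_size k lam = (\<Sum>l<k. lam (Suc l))"
    unfolding part_size_def by (rule sum.reindex_bij_witness[of _ Suc "\<lambda>i. i - 1"]) auto
  have "(\<Sum>l<k. ?r - lam (Suc l)) + (\<Sum>l<k. lam (Suc l)) = (\<Sum>l<k. ?r)"
    unfolding sum.distrib[symmetric] using lam by (intro sum.cong) (auto simp: partition_in_rect_def simp del: diff_diff_left)
  moreover have "card (flag_params k lam :: (nat \<times> 'n + _) set) = ?r * CARD('n) + (k * k + (\<Sum>l<k. ?r - lam (Suc l)))"
    by (simp add: flag_params_def card_Plus card_cartesian_product)
  moreover have "?r * CARD('n) + (k * k + k * ?r) = CARD('n) * CARD('n)"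
  proof -
    obtain r where "CARD('n) = k + r" using k by (metis less_imp_add_positive)
    then show ?thesis by (simp add: algebra_simps)
  qed
  ultimately show "card (flag_params k lam :: (nat \<times> 'n + _) set) + part_size k lam = CARD('n) * CARD('n)"
    unfolding ps by simp
qed

lemma poly_step_flag_op:
  assumes \<kappa>: "\<kappa> \<in> PiE {..<CARD('n)} (\<lambda>_. {..<CARD('n) - k} <+> {..<k})"
  shows "poly_step (flag_params k lam) (flag_op m rv k lam \<kappa> :: (nat \<times> nat \<times> 'n::finite \<Rightarrow> complex) \<Rightarrow> _)"
  unfolding poly_step_def
proof
  fix x :: "nat \<times> nat \<times> 'n"
  obtain r i c where x: "x = (r, i, c)" by (cases x) auto
  let ?W = "range Inl \<union> Inr ` flag_params k lam :: ((nat \<times> nat \<times> 'n) + (nat \<times> 'n + _)) set"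
  have 1: "polyin ?W (\<lambda>z. z (Inl v))" for v by (rule polyin_var) simp
  have 2: "polyin ?W (\<lambda>z. z (Inr (Inl (j, c))))" if "j < CARD('n) - k" for j
    by (rule polyin_var) (use that in \<open>auto simp: flag_params_def\<close>)
  have 3: "polyin ?W (\<lambda>z. z (Inr (Inr (Inl (l, h)))))" if "l < k" "h < k" for l h
    by (rule polyin_var) (use that in \<open>auto simp: flag_params_def\<close>)
  have 4: "polyin ?W (\<lambda>z. z (Inr (Inr (Inr (l, j)))))" if "l < k" "j < CARD('n) - k - lam (Suc l)" for l j
    by (rule polyin_var) (use that in \<open>auto simp: flag_params_def\<close>)
  show "polyin ?W (\<lambda>z. flag_op m rv k lam \<kappa> (\<lambda>j. z (Inl j)) (\<lambda>p. z (Inr p)) x)"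
  proof (cases "r = m \<and> i < CARD('n)")
    case True
    then have "\<kappa> i \<in> {..<CARD('n) - k} <+> {..<k}" using \<kappa> by auto
    then consider j where "\<kappa> i = Inl j" "j < CARD('n) - k" | l where "\<kappa> i = Inr l" "l < k" by auto
    then show ?thesis
    proof cases
      case 1
      then show ?thesis using True 2 by (simp add: flag_op_def x)
    next
      case (2 l)
      have "polyin ?W (\<lambda>z. (\<Sum>h<k. z (Inr (Inr (Inl (l, h)))) * z (Inl (rv, h, c))) +
              (\<Sum>j<CARD('n) - k - lam (Suc l). z (Inr (Inr (Inr (l, j)))) * z (Inr (Inl (j, c)))))"
        using 2(2) by (intro polyin_add polyin_sum polyin_mult 1 \<open>\<And>j. j < CARD('n) - k \<Longrightarrow> _\<close> 3 4) auto
      then show ?thesis using True 2 by (simp add: flag_op_def x)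
    qed
  next
    case False
    then show ?thesis using 1[of "(r, i, c)"] by (cases "r = m") (auto simp: flag_op_def x intro: polyin_const)
  qed
qed

definition flag_step :: "(nat \<times> nat \<times> 'n::finite \<Rightarrow> complex) set \<Rightarrow> nat \<Rightarrow> (nat \<Rightarrow> nat) \<Rightarrow> nat \<Rightarrow> nat \<Rightarrow>
    (nat \<times> nat \<times> 'n \<Rightarrow> complex) set \<Rightarrow> bool" where
  "flag_step S k lam rv m S' \<longleftrightarrow>
    (\<forall>s a. s \<in> S \<longrightarrow> complete_flag (flag_of a m) \<longrightarrow>
      vec.span (reg s rv ` {..<k}) \<in> schubert k lam (flag_of a m) \<longrightarrow>
      (\<exists>s'\<in>S'. (\<forall>i<CARD('n). reg s' m i = reg a m i) \<and> (\<forall>r. r \<noteq> m \<longrightarrow> reg s' r = reg s r)))"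

lemma covered_flag_step:
  fixes S :: "(nat \<times> nat \<times> 'n::finite \<Rightarrow> complex) set"
  assumes S: "covered M S" and lam: "partition_in_rect k (CARD('n) - k) lam" and k: "k < CARD('n)"
  shows "\<exists>S'. covered (M + card (flag_params k lam :: (nat \<times> 'n + _) set)) S' \<and> flag_step S k lam rv m S'"
proof -
  define \<Psi> :: "((nat \<times> nat \<times> 'n \<Rightarrow> complex) \<Rightarrow> _) set" where
    "\<Psi> = flag_op m rv k lam ` (PiE {..<CARD('n)} (\<lambda>_. {..<CARD('n) - k} <+> {..<k}))"
  define S' where "S' = {\<psi> s y | \<psi> s y. \<psi> \<in> \<Psi> \<and> s \<in> S}"
  have "covered (M + card (flag_params k lam :: (nat \<times> 'n + _) set)) S'"
    unfolding S'_def
  proof (rule covered_step[OF S])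
    show "finite \<Psi>" unfolding \<Psi>_def by (intro finite_imageI finite_PiE) auto
    show "poly_step (flag_params k lam) \<psi>" if "\<psi> \<in> \<Psi>" for \<psi>
      using that poly_step_flag_op by (auto simp: \<Psi>_def)
  qed (rule card_flag_params[OF lam k])
  moreover have "\<exists>s'\<in>S'. (\<forall>i<CARD('n). reg s' m i = reg a m i) \<and> (\<forall>r. r \<noteq> m \<longrightarrow> reg s' r = reg s r)"
    if s: "s \<in> S" and V: "vec.span (reg s rv ` {..<k}) = V" and F: "complete_flag (flag_of a m)"
      and VX: "V \<in> schubert k lam (flag_of a m)" for s a V
  proof -
    obtain \<kappa> np z where \<kappa>: "\<kappa> \<in> PiE {..<CARD('n)} (\<lambda>_. {..<CARD('n) - k} <+> {..<k})"
      "inj_on \<kappa> {..<CARD('n)}" "\<And>i j. i < CARD('n) \<Longrightarrow> \<kappa> i = Inl j \<Longrightarrow> np j = i"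
      "\<And>i l. i < CARD('n) \<Longrightarrow> \<kappa> i = Inr l \<Longrightarrow>
       reg a m i - (\<Sum>j<CARD('n) - k - lam (Suc l). z l j *s reg a m (np j)) \<in> V"
      using schubert_normal_form[OF F VX lam k] by blast
    have "\<exists>c. \<forall>l. \<kappa> i = Inr l \<longrightarrow>
      reg a m i = (\<Sum>h<k. c h *s reg s rv h) + (\<Sum>j<CARD('n) - k - lam (Suc l). z l j *s reg a m (np j))"
      if i: "i < CARD('n)" for i
    proof (cases "\<kappa> i")
      case (Inr l)
      obtain c where "reg a m i - (\<Sum>j<CARD('n) - k - lam (Suc l). z l j *s reg a m (np j)) = (\<Sum>h<k. c h *s reg s rv h)"
        using \<kappa>(4)[OF i Inr] unfolding V[symmetric] span_image_lessThan by blast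
      then show ?thesis using Inr by (intro exI[of _ c]) (auto simp: algebra_simps)
    qed simp
    then have "\<forall>i\<in>{..<CARD('n)}. \<exists>c. \<forall>l. \<kappa> i = Inr l \<longrightarrow>
      reg a m i = (\<Sum>h<k. c h *s reg s rv h) + (\<Sum>j<CARD('n) - k - lam (Suc l). z l j *s reg a m (np j))"
      by blast
    from bchoice[OF this] obtain C where C: "\<And>i l. i < CARD('n) \<Longrightarrow> \<kappa> i = Inr l \<Longrightarrow>
      reg a m i = (\<Sum>h<k. C i h *s reg s rv h) + (\<Sum>j<CARD('n) - k - lam (Suc l). z l j *s reg a m (np j))"
      by auto
    \<comment> \<open>The parameters are indexed by the pivot number \<open>l\<close> and
      \<open>C\<close> by the position \<open>i\<close>, so \<open>\<kappa>\<close> has to be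
      inverted at the pivots.\<close>
    define y where "y v = (case v of Inl (j, c) \<Rightarrow> reg a m (np j) $ c
       | Inr (Inl (l, h)) \<Rightarrow> C (the_inv_into {..<CARD('n)} \<kappa> (Inr l)) h | Inr (Inr (l, j)) \<Rightarrow> z l j)" for v
    define s' where "s' = flag_op m rv k lam \<kappa> s y"
    have "s' \<in> S'" using \<kappa>(1) s by (auto simp: S'_def s'_def \<Psi>_def)
    moreover have "reg s' m i = reg a m i" if i: "i < CARD('n)" for i
    proof (cases "\<kappa> i")
      case (Inl j)
      then show ?thesis using i \<kappa>(3)[OF i Inl] by (simp add: reg_def s'_def flag_op_def y_def vec_eq_iff)
    next
      case (Inr l)
      have "the_inv_into {..<CARD('n)} \<kappa> (Inr l) = i"
        using the_inv_into_f_f[OF \<kappa>(2), of i] i Inr by simp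
      then have "reg s' m i $ c = ((\<Sum>h<k. C i h *s reg s rv h) + (\<Sum>j<CARD('n) - k - lam (Suc l). z l j *s reg a m (np j))) $ c" for c
        using i Inr by (simp add: reg_def s'_def flag_op_def y_def)
      then show ?thesis unfolding C[OF i Inr] by (simp add: vec_eq_iff)
    qed
    moreover have "reg s' r = reg s r" if "r \<noteq> m" for r
      using that by (simp add: reg_def s'_def flag_op_def vec_eq_iff fun_eq_iff)
    ultimately show ?thesis by blast
  qed
  ultimately show ?thesis unfolding flag_step_def by (intro exI[of _ S']) blast
qed

section \<open>Configurations avoided by generic flags\<close>

text \<open>One format for both kinds of excluded configurations: for s = a the space
  \<open>S\<close> is \<open>A\<close>, and for s = a + 1 it witnesses that V1 and V2 meet outside
  A.\<close>

definition bad_config :: "nat \<Rightarrow> nat \<Rightarrow> nat \<Rightarrow> nat \<Rightarrow> (nat \<Rightarrow> nat \<Rightarrow> nat) \<Rightarrow> nat \<Rightarrow> nat \<Rightarrow> nat \<Rightarrow>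
    (nat \<times> nat \<times> 'n::finite \<Rightarrow> complex) \<Rightarrow> bool" where
  "bad_config k a s b lams m1 m2 m3 x \<longleftrightarrow> (\<exists>A S B V1 V2 V3.
     cspace A \<and> cspace S \<and> cspace B \<and> cdim A = a \<and> cdim S = s \<and> cdim B = b \<and>
     A \<subseteq> S \<and> S \<subseteq> V1 \<and> S \<subseteq> V2 \<and> A \<subseteq> V3 \<and> V1 \<subseteq> B \<and> V2 \<subseteq> B \<and> V3 \<subseteq> B \<and>
     V1 \<in> schubert k (lams m1) (flag_of x m1) \<and> V2 \<in> schubert k (lams m2) (flag_of x m2) \<and>
     V3 \<in> schubert k (lams m3) (flag_of x m3))"

lemma schubert_cspace: "V \<in> schubert k lam F \<Longrightarrow> cspace V" "V \<in> schubert k lam F \<Longrightarrow> cdim V = k"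
  by (auto simp: schubert_def Grass_def)

text \<open>The left side of \<open>count\<close> adds the chart dimensions for B, A, S, V1 and V2
  together, and V3; the flags contribute 3 n^2 minus the sizes of the partitions. Hence
  \<open>count\<close> says that there are fewer parameters than the 3 n^2 flag coordinates.\<close>

lemma generic_avoids_config:
  fixes lams :: "nat \<Rightarrow> nat \<Rightarrow> nat" and a s b k :: nat
  assumes dims: "a \<le> s" "s \<le> k" "k \<le> b" "b \<le> CARD('n::finite)" and k: "k < CARD('n)"
    and m: "{m1, m2, m3} = {0, 1, 2}" "m1 \<noteq> m2" "m1 \<noteq> m3" "m2 \<noteq> m3"
    and lams: "\<And>m. m \<in> {m1, m2, m3} \<Longrightarrow> partition_in_rect k (CARD('n) - k) (lams m)"
    and count: "b * (CARD('n) - b) + a * (b - a) + (s - a) * (b - s) + 2 * ((k - s) * (b - k)) + (k - a) * (b - k)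
      < part_size k (lams m1) + part_size k (lams m2) + part_size k (lams m3)"
  shows "\<exists>P :: (nat \<times> nat \<times> 'n \<Rightarrow> complex) \<Rightarrow> complex. polyfun P \<and> (\<exists>x. P x \<noteq> 0) \<and>
    (\<forall>x. ((\<forall>m\<in>{0,1,2}. complete_flag (flag_of x m)) \<and> bad_config k a s b lams m1 m2 m3 x) \<longrightarrow> P x = 0)"
proof -
  let ?n = "CARD('n)"
  obtain e :: "nat \<Rightarrow> 'n" where e: "bij_betw e {0..<?n} UNIV"
    using ex_bij_betw_nat_finite[of "UNIV :: 'n set"] by auto
  define s0 :: "nat \<times> nat \<times> 'n \<Rightarrow> complex" where "s0 = (\<lambda>(r, i, c). if r = 4 \<and> c = e i then 1 else 0)"
  have "reg s0 4 i = axis (e i) 1" for i by (auto simp: reg_def s0_def axis_def vec_eq_iff)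
  then have "reg s0 4 ` {..<?n} = (\<lambda>c. axis c 1) ` e ` {..<?n}" by (simp add: image_image)
  moreover have "e ` {..<?n} = UNIV" using e by (simp add: bij_betw_def lessThan_atLeast0)
  ultimately have "reg s0 4 ` {..<?n} = cart_basis" by (auto simp: cart_basis_def)
  \<comment> \<open>Register 4 holds the standard basis of E. Register 3 is always read with length
    0 and stands for the zero space.\<close>
  then have c0: "chart s0 3 0 4 ?n {0} UNIV"
    using vec.span_mono[of cart_basis "insert 0 cart_basis"] span_cart_basis
    by (auto simp: chart_def cdim_def card_cart_basis vec.dimension_def)
  have S0: "covered 0 {s0}" by (rule covered_singleton)
  \<comment> \<open>Registers 5, 7, 9, 11, 13, 15 receive bases of B, A, S, V1, V2, V3, and the register after each of
     them a complementary basis up to the ambient space of that step.\<close>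
  obtain S1 where S1: "covered (b * (?n - b)) S1" "subspace_step {s0} 3 0 4 ?n 5 6 b S1"
    using covered_subspace_step[OF S0 dims(4), of 5 6 3 0 4] by auto
  have "a \<le> b" using dims by simp
  from covered_subspace_step[OF S1(1) this, of 7 8 3 0 5]
  obtain S2 where S2: "covered (b * (?n - b) + a * (b - a)) S2" "subspace_step S1 3 0 5 b 7 8 a S2" by auto
  have "s - a \<le> b - a" "b - a - (s - a) = b - s" using dims by simp_all
  from covered_subspace_step[OF S2(1) this(1), of 9 10 7 a 8, unfolded this(2)]
  obtain S3 where S3: "covered (b * (?n - b) + a * (b - a) + (s - a) * (b - s)) S3"
    "subspace_step S2 7 a 8 (b - a) 9 10 (s - a) S3" by (auto simp del: diff_diff_left)
  have ks: "k - s \<le> b - s" "b - s - (k - s) = b - k" using dims by simp_all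
  from covered_subspace_step[OF S3(1) ks(1), of 11 12 9 s 10, unfolded ks(2)]
  obtain S4 where S4: "covered (b * (?n - b) + a * (b - a) + (s - a) * (b - s) + (k - s) * (b - k)) S4"
    "subspace_step S3 9 s 10 (b - s) 11 12 (k - s) S4" by (auto simp del: diff_diff_left)
  from covered_subspace_step[OF S4(1) ks(1), of 13 14 9 s 10, unfolded ks(2)]
  obtain S5 where S5: "covered (b * (?n - b) + a * (b - a) + (s - a) * (b - s) + (k - s) * (b - k) + (k - s) * (b - k)) S5"
    "subspace_step S4 9 s 10 (b - s) 13 14 (k - s) S5" by (auto simp del: diff_diff_left)
  have ka: "k - a \<le> b - a" "b - a - (k - a) = b - k" using dims by simp_all
  define M where "M = b * (?n - b) + a * (b - a) + (s - a) * (b - s) + 2 * ((k - s) * (b - k)) + (k - a) * (b - k)"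
  from covered_subspace_step[OF S5(1) ka(1), of 15 16 7 a 8, unfolded ka(2)]
  obtain S6 where S6: "covered M S6" "subspace_step S5 7 a 8 (b - a) 15 16 (k - a) S6"
    by (auto simp: M_def mult_2 add.assoc)
  define C where "C m = card (flag_params k (lams m) :: (nat \<times> 'n + _) set)" for m
  have C: "C m + part_size k (lams m) = ?n * ?n" if "m \<in> {m1, m2, m3}" for m
    unfolding C_def by (rule card_flag_params(2)[OF lams[OF that] k])
  from covered_flag_step[OF S6(1) lams k, of m1 11 m1]
  obtain S7 where S7: "covered (M + C m1) S7" "flag_step S6 k (lams m1) 11 m1 S7" by (auto simp: C_def)
  from covered_flag_step[OF S7(1) lams k, of m2 13 m2]
  obtain S8 where S8: "covered (M + C m1 + C m2) S8" "flag_step S7 k (lams m2) 13 m2 S8" by (auto simp: C_def)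
  from covered_flag_step[OF S8(1) lams k, of m3 15 m3]
  obtain S9 where S9: "covered (M + C m1 + C m2 + C m3) S9" "flag_step S8 k (lams m3) 15 m3 S9" by (auto simp: C_def)
  define I :: "(nat \<times> nat \<times> 'n) set" where "I = {0,1,2} \<times> {..<?n} \<times> UNIV"
  have "card I = 3 * (?n * ?n)" by (simp add: I_def card_cartesian_product)
  then have "M + C m1 + C m2 + C m3 < card I" using count C[of m1] C[of m2] C[of m3] unfolding M_def by simp
  moreover have "finite I" by (simp add: I_def)
  ultimately obtain P where P: "polyfun P" "\<exists>a. P a \<noteq> 0" "\<forall>a. (\<exists>s\<in>S9. \<forall>i\<in>I. a i = s i) \<longrightarrow> P a = 0"
    using covered_vanishing_poly[OF S9(1)] by blast
  have "\<exists>s\<in>S9. \<forall>i\<in>I. x i = s i"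
    if F: "\<forall>m\<in>{0,1,2}. complete_flag (flag_of x m)" and bad: "bad_config k a s b lams m1 m2 m3 x" for x
  proof -
    have mem: "m1 \<in> {0,1,2}" "m2 \<in> {0,1,2}" "m3 \<in> {0,1,2}" using m(1) by blast+
    note F = F[rule_format, OF mem(1)] F[rule_format, OF mem(2)] F[rule_format, OF mem(3)]
    have mlt: "m1 < 3" "m2 < 3" "m3 < 3" using mem by auto
    obtain A S B V1 V2 V3 where c: "cspace A" "cspace S" "cspace B" "cdim A = a" "cdim S = s" "cdim B = b"
     and sub: "A \<subseteq> S" "S \<subseteq> V1" "S \<subseteq> V2" "A \<subseteq> V3" "V1 \<subseteq> B" "V2 \<subseteq> B" "V3 \<subseteq> B"
     and V: "V1 \<in> schubert k (lams m1) (flag_of x m1)" "V2 \<in> schubert k (lams m2) (flag_of x m2)"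
     "V3 \<in> schubert k (lams m3) (flag_of x m3)"
      using bad unfolding bad_config_def by blast
    have AB: "A \<subseteq> B" and SB: "S \<subseteq> B" using sub by auto
    note cV = schubert_cspace[OF V(1)] schubert_cspace[OF V(2)] schubert_cspace[OF V(3)]
    have zero: "{0} \<subseteq> U" if "cspace U" for U using that by (simp add: cspace_def vec.subspace_0)
    obtain s1 where s1: "s1 \<in> S1" "chart s1 5 b 6 (?n - b) B UNIV"
      using S1(2)[unfolded subspace_step_def, rule_format, OF singletonI c0 c(3) zero[OF c(3)] subset_UNIV] c(6) by auto
    have "chart s1 3 0 5 b {0} B" using s1(2) c zero[OF c(3)]
        vec.span_mono[of "reg s1 5 ` {..<b}" "insert 0 (reg s1 5 ` {..<b})"]
      by (auto simp: chart_def cdim_def vec.span_insert_0)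
    from S2(2)[unfolded subspace_step_def, rule_format, OF s1(1) this c(1) zero[OF c(1)] AB, unfolded add_0]
    obtain s2 where s2: "s2 \<in> S2" "chart s2 7 a 8 (b - a) A B" using c(4) by auto
    have "cdim S = a + (s - a)" using c(5) dims by simp
    from S3(2)[unfolded subspace_step_def, rule_format, OF s2(1) s2(2) c(2) sub(1) SB this]
    obtain s3 where s3: "s3 \<in> S3" "chart s3 9 (a + (s - a)) 10 (b - a - (s - a)) S B"
      "\<forall>r. r \<noteq> 9 \<longrightarrow> r \<noteq> 10 \<longrightarrow> reg s3 r = reg s2 r" using sub by auto
    have s3': "chart s3 9 s 10 (b - s) S B" using s3(2) dims by simp
    have "cdim V1 = s + (k - s)" using cV dims by simp
    from S4(2)[unfolded subspace_step_def, rule_format, OF s3(1) s3' cV(1) sub(2,5) this]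
    obtain s4 where s4: "s4 \<in> S4" "chart s4 11 (s + (k - s)) 12 (b - s - (k - s)) V1 B"
      "\<forall>r. r \<noteq> 11 \<longrightarrow> r \<noteq> 12 \<longrightarrow> reg s4 r = reg s3 r" by auto
    have s4': "chart s4 9 s 10 (b - s) S B" using s3' s4(3) by (simp add: chart_def)
    have "cdim V2 = s + (k - s)" using cV dims by simp
    from S5(2)[unfolded subspace_step_def, rule_format, OF s4(1) s4' cV(3) sub(3,6) this]
    obtain s5 where s5: "s5 \<in> S5" "chart s5 13 (s + (k - s)) 14 (b - s - (k - s)) V2 B"
      "\<forall>r. r \<noteq> 13 \<longrightarrow> r \<noteq> 14 \<longrightarrow> reg s5 r = reg s4 r" by auto
    have s5': "chart s5 7 a 8 (b - a) A B" using s2(2) s3(3) s4(3) s5(3) by (simp add: chart_def)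
    have "cdim V3 = a + (k - a)" using cV dims by simp
    from S6(2)[unfolded subspace_step_def, rule_format, OF s5(1) s5' cV(5) sub(4,7) this]
    obtain s6 where s6: "s6 \<in> S6" "chart s6 15 (a + (k - a)) 16 (b - a - (k - a)) V3 B"
      "\<forall>r. r \<noteq> 15 \<longrightarrow> r \<noteq> 16 \<longrightarrow> reg s6 r = reg s5 r" by auto
    have V1: "vec.span (reg s6 11 ` {..<k}) = V1" using s4(2) s5(3) s6(3) dims by (simp add: chart_def)
    have V2: "vec.span (reg s6 13 ` {..<k}) = V2" using s5(2) s6(3) dims by (simp add: chart_def)
    have V3: "vec.span (reg s6 15 ` {..<k}) = V3" using s6(2) dims by (simp add: chart_def)
    obtain s7 where s7: "s7 \<in> S7" "\<forall>i<?n. reg s7 m1 i = reg x m1 i" "\<forall>r. r \<noteq> m1 \<longrightarrow> reg s7 r = reg s6 r"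
      using S7(2)[unfolded flag_step_def, rule_format, OF s6(1) F(1)] V1 V(1) by auto
    have V2': "vec.span (reg s7 13 ` {..<k}) = V2" using s7(3) V2 mlt by simp
    have V3': "vec.span (reg s7 15 ` {..<k}) = V3" using s7(3) V3 mlt by simp
    obtain s8 where s8: "s8 \<in> S8" "\<forall>i<?n. reg s8 m2 i = reg x m2 i" "\<forall>r. r \<noteq> m2 \<longrightarrow> reg s8 r = reg s7 r"
      using S8(2)[unfolded flag_step_def, rule_format, OF s7(1) F(2)] V2' V(2) by auto
    have V3'': "vec.span (reg s8 15 ` {..<k}) = V3" using s8(3) V3' mlt by simp
    obtain s9 where s9: "s9 \<in> S9" "\<forall>i<?n. reg s9 m3 i = reg x m3 i" "\<forall>r. r \<noteq> m3 \<longrightarrow> reg s9 r = reg s8 r"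
      using S9(2)[unfolded flag_step_def, rule_format, OF s8(1) F(3)] V3'' V(3) by auto
    have "reg s9 r i = reg x r i" if "r \<in> {m1, m2, m3}" "i < ?n" for r i
      using that s7(2) s8(2,3) s9(2,3) m(2-4) by auto
    then have "x (r, i, c) = s9 (r, i, c)" if "r \<in> {0,1,2}" "i < ?n" for r i c
      using that unfolding m(1) reg_def by (simp add: vec_eq_iff)
    then have "\<forall>i\<in>I. x i = s9 i" by (auto simp: I_def)
    with s9(1) show ?thesis by blast
  qed
  with P show ?thesis by (intro exI[of _ P]) blast
qed

text \<open>Here k = a + e1, b = k + e2 and n = b + f. The products f d, a d, e1 d, e2 d dominate e2
  f, a e1, e1 e2, e1 e2 one by one, and since k and n - k are positive, one of these comparisons is
  strict.\<close>

lemma dim_count_strict: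
  fixes a e1 e2 d f :: nat
  assumes "e1 \<le> d" "e2 \<le> d" "\<not> (e1 = d \<and> e2 = d)" "1 \<le> a + e1" "1 \<le> e2 + f"
  shows "e2 * f + a * e1 + 2 * (e1 * e2) < (a + e1 + e2 + f) * d"
proof -
  have le: "e2 * f \<le> f * d" "a * e1 \<le> a * d" "e1 * e2 \<le> e1 * d" "e1 * e2 \<le> e2 * d"
    using assms(1,2) by (simp_all add: mult.commute mult_le_mono)
  have eq: "(a + e1 + e2 + f) * d = a * d + e1 * d + e2 * d + f * d" by (simp add: algebra_simps)
  have two: "2 * (e1 * e2) = e1 * e2 + e1 * e2" by simp
  have "e2 * f < f * d \<or> a * e1 < a * d \<or> e1 * e2 < e1 * d \<or> e1 * e2 < e2 * d"
  proof (cases "e1 < d")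
    case True
    then have "a * e1 < a * d \<or> a = 0" "e1 * e2 < e2 * d \<or> e2 = 0" by auto
    moreover have "a = 0 \<and> e2 = 0 \<Longrightarrow> e1 * e2 < e1 * d" using assms True by simp
    ultimately show ?thesis by blast
  next
    case False
    then have e: "e1 = d" "e2 < d" using assms by auto
    then have "e1 * e2 < e1 * d \<or> e1 = 0" by auto
    then show ?thesis using e by auto
  qed
  then show ?thesis unfolding eq two using le by linarith
qed

text \<open>The case s = a: the left side is k (n - k) plus the quantity bounded in
  \<open>dim_count_strict\<close>.\<close>

lemma count_degenerate:
  fixes a b k n d :: nat
  assumes "a \<le> k" "k \<le> b" "b \<le> n" "1 \<le> k" "k < n" "k \<le> a + d" "b \<le> k + d" "\<not> (a + d = k \<and> b = k + d)"
  shows "b * (n - b) + a * (b - a) + (a - a) * (b - a) + 2 * ((k - a) * (b - k)) + (k - a) * (b - k)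
      < k * (n - k) + n * d"
proof -
  obtain e1 where e1: "k = a + e1" using assms(1) le_Suc_ex by blast
  obtain e2 where e2: "b = k + e2" using assms(2) le_Suc_ex by blast
  obtain f where f: "n = b + f" using assms(3) le_Suc_ex by blast
  have sub: "n - b = f" "b - a = e1 + e2" "k - a = e1" "b - k = e2" "n - k = e2 + f"
    using e1 e2 f by auto
  have "e2 * f + a * e1 + 2 * (e1 * e2) < (a + e1 + e2 + f) * d"
    by (rule dim_count_strict) (use assms e1 e2 f in auto)
  moreover have "b * f + a * (e1 + e2) + 3 * (e1 * e2) = k * (e2 + f) + (e2 * f + a * e1 + 2 * (e1 * e2))"
    unfolding e2 e1 by (simp add: algebra_simps)
  moreover have "n * d = (a + e1 + e2 + f) * d" unfolding f e2 e1 by simp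
  ultimately show ?thesis unfolding sub diff_self_eq_0 mult_0 by linarith
qed

text \<open>The left side is exactly one less than the right. Without a common direction both would
  be equal; the choice of S adds 2 d - 1 parameters, while V1 and V2 lose d each.\<close>

lemma count_nontransversal:
  fixes k n d :: nat
  assumes "1 \<le> d" "d \<le> k" "k + d \<le> n"
  shows "(k + d) * (n - (k + d)) + (k - d) * (k + d - (k - d)) + (Suc (k - d) - (k - d)) * (k + d - Suc (k - d))
      + 2 * ((k - Suc (k - d)) * (k + d - k)) + (k - (k - d)) * (k + d - k) < k * (n - k) + n * d"
proof -
  obtain a where a: "k = a + d" using assms(2) by (metis add.commute le_Suc_ex)
  obtain f where f: "n = k + d + f" using assms(3) le_Suc_ex by blast
  obtain c where c: "d = Suc c" using assms(1) by (cases d) auto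
  show ?thesis unfolding a f c by (simp add: algebra_simps)
qed

section \<open>Lines in Schubert varieties\<close>

lemma flag_mono:
  fixes F :: "nat \<Rightarrow> (complex^'n) set"
  assumes "complete_flag F" "i \<le> j" "j \<le> CARD('n)"
  shows "F i \<subseteq> F j"
  using assms(2,3)
proof (induction j rule: dec_induct)
  case (step m)
  then show ?case using assms(1) unfolding complete_flag_def by (meson Suc_leD Suc_le_lessD order.trans)
qed simp

lemma flag_top:
  fixes F :: "nat \<Rightarrow> (complex^'n) set"
  assumes "complete_flag F"
  shows "F (CARD('n)) = UNIV"
proof -
  have "vec.subspace (F (CARD('n)))" "vec.dim (F (CARD('n))) = CARD('n)"
    using assms by (auto simp: complete_flag_def cspace_def cdim_def)
  then show ?thesis using vec.dim_eq_full[of "F (CARD('n))"]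
    by (simp add: span_of_subspace vec.dimension_def card_cart_basis)
qed

text \<open>The line consists of the k-dimensional spaces between a hyperplane \<open>L\<close> of
  V, which contains A and V \<inter> F j, and N = V + w. Before the first flag index
  \<open>l\<close> at which V leaves \<open>L\<close>, replacing V by another member loses nothing;
  from \<open>l\<close> on, both v and w belong to the flag space, so the exchange keeps all
  dimensions. As N has dimension k + 1, it meets W outside A, and some member of the line contains
  such a vector.\<close>

lemma schubert_line_meets_oriented:
  fixes F :: "nat \<Rightarrow> (complex^'n) set"
  assumes F: "complete_flag F" and V: "V \<in> schubert k lam F" and B: "cspace B" "cdim A + cdim B \<le> k + k"
    and AB: "A \<subseteq> V" "V \<subseteq> B" "cspace A" and W: "cspace W" "cdim W = k" "A \<subseteq> W" "W \<subseteq> B" and k: "k \<le> CARD('n)"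
    and w: "w \<in> F (Suc j)" "w \<in> B" "w \<notin> V" and j: "Suc j \<le> CARD('n)"
    and v0: "v0 \<in> V" "v0 \<notin> vec.span (A \<union> (V \<inter> F j))"
  shows "\<exists>V'\<in>schubert k lam F. A \<subseteq> V' \<and> V' \<subseteq> B \<and> V' \<inter> W \<noteq> A"
proof -
  let ?n = "CARD('n)"
  have sV: "vec.subspace V" "vec.dim V = k" using schubert_cspace[OF V] by (auto simp: cspace_def cdim_def)
  have sF: "vec.subspace (F i)" if "i \<le> ?n" for i using F that by (simp add: complete_flag_def cspace_def)
  obtain \<phi> where \<phi>: "lfun \<phi>" "\<forall>x\<in>vec.span (A \<union> (V \<inter> F j)). \<phi> x = 0" "\<phi> v0 = 1"
    using separating_functional[of "vec.span (A \<union> (V \<inter> F j))" v0] v0(2) by (auto simp: cspace_def)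
  have \<phi>0: "\<phi> x = 0" if "x \<in> A \<or> x \<in> V \<and> x \<in> F j" for x
    using \<phi>(2) that by (auto intro: vec.span_base)
  define L where "L = V \<inter> {v. \<phi> v = 0}"
  define l where "l = (LEAST i. i \<le> ?n \<and> (\<exists>v\<in>V \<inter> F i. \<phi> v \<noteq> 0))"
  have "?n \<le> ?n \<and> (\<exists>v\<in>V \<inter> F ?n. \<phi> v \<noteq> 0)" using v0(1) \<phi>(3) flag_top[OF F] by (auto intro!: bexI[of _ v0])
  then have l: "l \<le> ?n \<and> (\<exists>v\<in>V \<inter> F l. \<phi> v \<noteq> 0)" unfolding l_def by (rule LeastI)
  have lmin: "\<phi> v = 0" if "i < l" "v \<in> V \<inter> F i" for i v
  proof (rule ccontr)
    assume "\<phi> v \<noteq> 0"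
    then have "i \<le> ?n \<and> (\<exists>v\<in>V \<inter> F i. \<phi> v \<noteq> 0)" using that l by auto
    then have "l \<le> i" unfolding l_def by (rule Least_le)
    then show False using that by simp
  qed
  obtain v where v: "v \<in> V" "v \<in> F l" "\<phi> v \<noteq> 0" using l by blast
  have jl: "Suc j \<le> l"
  proof (rule ccontr)
    assume "\<not> Suc j \<le> l"
    then have "F l \<subseteq> F j" using flag_mono[OF F, of l j] j by simp
    then show False using v \<phi>0[of v] by blast
  qed
  have sL: "vec.subspace L" and VL: "V = vec.span (insert v L)" and dL: "vec.dim V = Suc (vec.dim L)"
    using dim_kernel[of V \<phi> v] schubert_cspace(1)[OF V] \<phi>(1) v unfolding L_def cspace_def cdim_def by auto
  have AL: "A \<subseteq> L" using AB \<phi>0 by (auto simp: L_def)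
  define N where "N = vec.span (insert w V)"
  have sN: "vec.subspace N" by (simp add: N_def)
  have dN: "vec.dim N = Suc k" using w(3) sV by (simp add: N_def vec.dim_insert span_of_subspace)
  have NB: "N \<subseteq> B" unfolding N_def using w(2) AB B by (intro vec.span_minimal) (auto simp: cspace_def)
  have "N \<inter> W \<noteq> A"
  proof
    assume eq: "N \<inter> W = A"
    let ?S = "{x + y |x y. x \<in> N \<and> y \<in> W}"
    have "vec.dim ?S + vec.dim A = Suc k + k"
      using vec.dim_sums_Int[OF sN, of W] W dN eq by (simp add: cspace_def cdim_def)
    moreover have "?S \<subseteq> B" using NB W(4) B(1) by (auto simp: cspace_def intro!: vec.subspace_add)
    then have "vec.dim ?S \<le> vec.dim B" by (rule vec.dim_subset)
    ultimately show False using B(2) by (simp add: cdim_def)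
  qed
  moreover have "A \<subseteq> N \<inter> W" using AB W unfolding N_def by (auto intro: vec.span_base)
  ultimately obtain u where u: "u \<in> N" "u \<in> W" "u \<notin> A" by blast
  obtain \<beta> where \<beta>: "u - \<beta> *s w \<in> V" using u(1) sV(1) unfolding N_def vec.span_insert by (auto simp: span_of_subspace)
  then obtain \<alpha> where \<alpha>: "u - \<beta> *s w - \<alpha> *s v \<in> L"
    unfolding VL vec.span_insert[of v L] using sL by (auto simp: span_of_subspace)
  \<comment> \<open>The member L + x must contain \<open>u\<close>, so \<open>x\<close> is the part
    of \<open>u\<close> outside \<open>L\<close>. If \<open>u\<close> already lies in
    \<open>L\<close>, every member contains it, and x = v selects V itself.\<close>
  define x where "x = (if \<alpha> = 0 \<and> \<beta> = 0 then v else \<alpha> *s v + \<beta> *s w)"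
  have xL: "x \<notin> L"
  proof (cases "\<beta> = 0")
    case True
    then have "x \<in> V" "\<phi> x \<noteq> 0" using v \<phi>(1) sV by (auto simp: x_def lfun_scale vec.subspace_scale)
    then show ?thesis by (simp add: L_def)
  next
    case False
    show ?thesis
    proof
      assume "x \<in> L"
      then have "x - \<alpha> *s v \<in> V" using v sV by (auto simp: L_def intro!: vec.subspace_diff vec.subspace_scale)
      then have "(1 / \<beta>) *s (x - \<alpha> *s v) \<in> V" using sV by (intro vec.subspace_scale)
      then show False using False w(3) by (simp add: x_def vector_smult_assoc)
    qed
  qed
  have xF: "x \<in> F i" if "l \<le> i" "i \<le> ?n" for i
  proof -
    have "v \<in> F i" "w \<in> F i" using v(2) w(1) flag_mono[OF F] that jl by (meson le_trans subsetD)+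
    then show ?thesis using sF[OF that(2)] by (auto simp: x_def intro!: vec.subspace_add vec.subspace_scale)
  qed
  define V' where "V' = vec.span (insert x L)"
  have sV': "vec.subspace V'" by (simp add: V'_def)
  have dV': "vec.dim V' = k" using xL dL sV sL by (simp add: V'_def vec.dim_insert span_of_subspace)
  have LV': "L \<subseteq> V'" "x \<in> V'" unfolding V'_def by (auto intro: vec.span_base)
  have "u \<in> V'"
  proof (cases "\<alpha> = 0 \<and> \<beta> = 0")
    case True
    then show ?thesis using \<alpha> LV' by auto
  next
    case False
    then have "x = \<alpha> *s v + \<beta> *s w" by (simp only: x_def if_False)
    then have "u - \<beta> *s w - \<alpha> *s v + x = u" by simp
    moreover have "u - \<beta> *s w - \<alpha> *s v + x \<in> V'"
      by (rule vec.subspace_add[OF sV']) (use \<alpha> LV' in auto)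
    ultimately show ?thesis by (simp only:)
  qed
  have V'B: "V' \<subseteq> B"
  proof -
    have "v \<in> B" "w \<in> B" using v(1) AB(2) w(2) by auto
    then have "x \<in> B" using B(1) by (auto simp: x_def cspace_def intro!: vec.subspace_add vec.subspace_scale)
    then show ?thesis unfolding V'_def using AB(2) B(1)
      by (intro vec.span_minimal) (auto simp: cspace_def L_def)
  qed
  have dims: "vec.dim (V \<inter> F i) \<le> vec.dim (V' \<inter> F i)" if i: "i \<le> ?n" for i
  proof (cases "i < l")
    case True
    then have "V \<inter> F i \<subseteq> V' \<inter> F i" using lmin[OF True] LV' by (auto simp: L_def)
    then show ?thesis by (rule vec.dim_subset)
  next
    case False
    have "v \<in> F i" using v(2) flag_mono[OF F, of l i] False i by auto
    then have "vec.dim (V \<inter> F i) = Suc (vec.dim (V \<inter> F i \<inter> {v. \<phi> v = 0}))"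
      using dim_kernel(3)[of "V \<inter> F i" \<phi> v] sV sF[OF i] \<phi>(1) v
      by (simp add: cspace_def cdim_def vec.subspace_inter)
    also have "V \<inter> F i \<inter> {v. \<phi> v = 0} = L \<inter> F i" by (auto simp: L_def)
    also have "Suc (vec.dim (L \<inter> F i)) = vec.dim (insert x (L \<inter> F i))"
      using xL sL sF[OF i] by (simp add: vec.dim_insert span_of_subspace vec.subspace_inter)
    also have "\<dots> \<le> vec.dim (V' \<inter> F i)"
      using LV' xF[of i] False i by (intro vec.dim_subset) auto
    finally show ?thesis .
  qed
  have "V' \<in> schubert k lam F"
    unfolding schubert_def
  proof (intro CollectI conjI allI impI)
    show "V' \<in> Grass k" using sV' dV' by (simp add: Grass_def cspace_def cdim_def)
    fix i assume i: "1 \<le> i" "i \<le> k"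
    then have "i \<le> cdim (V \<inter> F (?n - k + i - lam i))" using V by (simp add: schubert_def)
    also have "\<dots> \<le> cdim (V' \<inter> F (?n - k + i - lam i))"
      unfolding cdim_def using i k by (intro dims) simp
    finally show "i \<le> cdim (V' \<inter> F (?n - k + i - lam i))" .
  qed
  moreover have "A \<subseteq> V'" using AL LV' by blast
  moreover have "V' \<inter> W \<noteq> A" using u \<open>u \<in> V'\<close> by blast
  ultimately show ?thesis using V'B by blast
qed

text \<open>Two points of a Schubert variety in the interval [A, B] yield a line of the Schubert variety
  in this interval, and that line meets the hypersurface of subspaces not transversal to W.\<close>

lemma schubert_line_meets:
  fixes F :: "nat \<Rightarrow> (complex^'n) set"
  assumes F: "complete_flag F" and V: "V1 \<in> schubert k lam F" "V2 \<in> schubert k lam F" "V1 \<noteq> V2"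
    and B: "cspace B" "cdim A + cdim B \<le> k + k"
    and AB: "A \<subseteq> V1" "V1 \<subseteq> B" "A \<subseteq> V2" "V2 \<subseteq> B" "cspace A"
    and W: "cspace W" "cdim W = k" "A \<subseteq> W" "W \<subseteq> B" and k: "k \<le> CARD('n)"
  shows "\<exists>V'\<in>schubert k lam F. A \<subseteq> V' \<and> V' \<subseteq> B \<and> V' \<inter> W \<noteq> A"
proof -
  let ?n = "CARD('n)"
  let ?P = "\<lambda>i. i \<le> ?n \<and> V1 \<inter> F i \<noteq> V2 \<inter> F i"
  \<comment> \<open>At the first flag index where V1 and V2 differ, one of them contains a vector
    missing from the other. Either one may be the larger, so both orientations are prepared in
    \<open>orient\<close>.\<close>
  define m where "m = (LEAST i. ?P i)"
  have "?P ?n" using V(3) flag_top[OF F] by auto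
  then have m: "?P m" unfolding m_def by (rule LeastI)
  have F0: "F 0 = {0}"
  proof -
    have "vec.subspace (F 0)" "vec.dim (F 0) = 0" using F by (auto simp: complete_flag_def cspace_def cdim_def)
    then show ?thesis using vec.subspace_0 by (fastforce simp: vec.dim_eq_0)
  qed
  have zero: "0 \<in> V1" "0 \<in> V2" using schubert_cspace(1)[OF V(1)] schubert_cspace(1)[OF V(2)]
    by (auto simp: cspace_def vec.subspace_0)
  have "m \<noteq> 0"
  proof
    assume "m = 0"
    then show False using m F0 zero by auto
  qed
  then obtain j where j: "m = Suc j" by (cases m) auto
  have "\<not> ?P j"
  proof
    assume "?P j"
    then have "m \<le> j" unfolding m_def by (rule Least_le)
    then show False using j by simp
  qed
  then have eqj: "V1 \<inter> F j = V2 \<inter> F j" using m j by auto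
  have orient: "\<exists>V'\<in>schubert k lam F. A \<subseteq> V' \<and> V' \<subseteq> B \<and> V' \<inter> W \<noteq> A"
    if V: "V \<in> schubert k lam F" "U \<in> schubert k lam F" and A: "A \<subseteq> V" "V \<subseteq> B" "A \<subseteq> U" "U \<subseteq> B"
      and VU: "V \<inter> F j = U \<inter> F j" and w: "w \<in> U" "w \<in> F (Suc j)" "w \<notin> V" for V U w
  proof -
    \<comment> \<open>A and V \<inter> F j also lie in U. If they generated V, then V = U by
      dimension; hence there is a hyperplane of V through both.\<close>
    have "\<not> V \<subseteq> vec.span (A \<union> (V \<inter> F j))"
    proof
      assume "V \<subseteq> vec.span (A \<union> (V \<inter> F j))"
      also have "\<dots> \<subseteq> U" using A VU schubert_cspace(1)[OF V(2)]
        by (intro vec.span_minimal) (auto simp: cspace_def)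
      finally have "V = U" using vec.subspace_dim_equal[of V U] schubert_cspace[OF V(1)] schubert_cspace[OF V(2)]
        by (simp add: cspace_def cdim_def)
      then show False using w by simp
    qed
    then obtain v0 where "v0 \<in> V" "v0 \<notin> vec.span (A \<union> (V \<inter> F j))" by blast
    then show ?thesis
      using schubert_line_meets_oriented[OF F V(1) B A(1,2) AB(5) W k w(2) _ w(3)] w(1) A(4) m j by auto
  qed
  from m j obtain w where "w \<in> F (Suc j)" "w \<in> V1 \<and> w \<notin> V2 \<or> w \<in> V2 \<and> w \<notin> V1" by auto
  then show ?thesis using orient[OF V(1,2) AB(1-4) eqj] orient[OF V(2,1) AB(3,4,1,2) eqj[symmetric]] by blast
qed

section \<open>The bijection\<close>

text \<open>Two kinds: unexpected dimensions of kernel or span, where one order of the flags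
  suffices, and the expected dimensions with a non-transversal pair (m1, m2), where all three pairs
  have to be listed.\<close>

definition bad_indices :: "nat \<Rightarrow> nat \<Rightarrow> nat \<Rightarrow> (nat \<times> nat \<times> nat \<times> nat \<times> nat \<times> nat) set" where
  "bad_indices k n d =
     {(a, s, b, m1, m2, m3) \<in> {..k} \<times> {..k} \<times> {..n} \<times> {0,1,2} \<times> {0,1,2} \<times> {0,1,2}.
        s = a \<and> k \<le> b \<and> k \<le> a + d \<and> b \<le> k + d \<and> \<not> (a + d = k \<and> b = k + d) \<and> (m1, m2, m3) = (0, 1, 2) \<or>
        1 \<le> d \<and> d \<le> k \<and> a = k - d \<and> s = Suc (k - d) \<and> b = k + d \<and>
          (m1, m2, m3) \<in> {(0, 1, 2), (0, 2, 1), (1, 2, 0)}}"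

lemma generic_position:
  fixes lams :: "nat \<Rightarrow> nat \<Rightarrow> nat"
  assumes k: "1 \<le> k" "k < CARD('n::finite)"
    and lams: "\<And>m. m \<in> {0,1,2} \<Longrightarrow> partition_in_rect k (CARD('n) - k) (lams m)"
    and size: "part_size k (lams 0) + part_size k (lams 1) + part_size k (lams 2) = k * (CARD('n) - k) + CARD('n) * d"
  shows "\<exists>P :: (nat \<times> nat \<times> 'n \<Rightarrow> complex) \<Rightarrow> complex. polyfun P \<and> (\<exists>x. P x \<noteq> 0) \<and>
    (\<forall>x. P x \<noteq> 0 \<longrightarrow> (\<forall>m\<in>{0,1,2}. complete_flag (flag_of x m)) \<longrightarrow>
      (\<forall>(a, s, b, m1, m2, m3)\<in>bad_indices k (CARD('n)) d. \<not> bad_config k a s b lams m1 m2 m3 x))"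
proof -
  let ?X = "bad_indices k (CARD('n)) d"
  let ?R = "\<lambda>i x. case i of (a, s, b, m1, m2, m3) \<Rightarrow>
     (\<forall>m\<in>{0,1,2}. complete_flag (flag_of x m)) \<and> bad_config k a s b lams m1 m2 m3 x"
  have fin: "finite ?X" unfolding bad_indices_def
    by (rule finite_subset[of _ "{..k} \<times> {..k} \<times> {..CARD('n)} \<times> {0,1,2} \<times> {0,1,2} \<times> {0,1,2}"]) auto
  have "\<exists>P :: (nat \<times> nat \<times> 'n \<Rightarrow> complex) \<Rightarrow> complex. polyfun P \<and> (\<exists>x. P x \<noteq> 0) \<and>
      (\<forall>x. (\<exists>i\<in>?X. ?R i x) \<longrightarrow> P x = 0)"
  proof (rule common_nonzero_polyfun[OF fin])
    fix i assume i: "i \<in> ?X"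
    obtain a s b m1 m2 m3 where ie: "i = (a, s, b, m1, m2, m3)" by (cases i) auto
    have range: "a \<le> k" "s \<le> k" "b \<le> CARD('n)" using i by (simp_all add: ie bad_indices_def)
    have alt: "s = a \<and> k \<le> b \<and> k \<le> a + d \<and> b \<le> k + d \<and> \<not> (a + d = k \<and> b = k + d) \<and> m1 = 0 \<and> m2 = 1 \<and> m3 = 2 \<or>
        1 \<le> d \<and> d \<le> k \<and> a = k - d \<and> s = Suc (k - d) \<and> b = k + d \<and>
          (m1 = 0 \<and> m2 = 1 \<and> m3 = 2 \<or> m1 = 0 \<and> m2 = 2 \<and> m3 = 1 \<or> m1 = 1 \<and> m2 = 2 \<and> m3 = 0)"
      using i unfolding ie bad_indices_def by simp
    have dims: "a \<le> s" "k \<le> b" using alt by linarith+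
    consider "m1 = 0" "m2 = 1" "m3 = 2" | "m1 = 0" "m2 = 2" "m3 = 1" | "m1 = 1" "m2 = 2" "m3 = 0"
      using alt by metis
    then have m: "{m1, m2, m3} = {0, 1, 2} \<and> m1 \<noteq> m2 \<and> m1 \<noteq> m3 \<and> m2 \<noteq> m3 \<and>
      part_size k (lams m1) + part_size k (lams m2) + part_size k (lams m3) = k * (CARD('n) - k) + CARD('n) * d"
      using size by cases (simp_all add: insert_commute)
    note m' = m[THEN conjunct1] m[THEN conjunct2, THEN conjunct1] m[THEN conjunct2, THEN conjunct2, THEN conjunct1]
      m[THEN conjunct2, THEN conjunct2, THEN conjunct2, THEN conjunct1]
    note sum = m[THEN conjunct2, THEN conjunct2, THEN conjunct2, THEN conjunct2]
    have "\<exists>P :: (nat \<times> nat \<times> 'n \<Rightarrow> complex) \<Rightarrow> complex. polyfun P \<and> (\<exists>x. P x \<noteq> 0) \<and>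
      (\<forall>x. ((\<forall>m\<in>{0,1,2}. complete_flag (flag_of x m)) \<and> bad_config k a s b lams m1 m2 m3 x) \<longrightarrow> P x = 0)"
    proof (rule generic_avoids_config[OF _ _ _ _ k(2) m'])
      show "a \<le> s" "s \<le> k" "k \<le> b" "b \<le> CARD('n)" using range dims by simp_all
      show "partition_in_rect k (CARD('n) - k) (lams m)" if "m \<in> {m1, m2, m3}" for m
        using lams that unfolding m'(1) by blast
      show "b * (CARD('n) - b) + a * (b - a) + (s - a) * (b - s) + 2 * ((k - s) * (b - k)) + (k - a) * (b - k)
        < part_size k (lams m1) + part_size k (lams m2) + part_size k (lams m3)"
      proof -
        have "s = a \<and> k \<le> b \<and> k \<le> a + d \<and> b \<le> k + d \<and> \<not> (a + d = k \<and> b = k + d) \<or>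
          1 \<le> d \<and> d \<le> k \<and> a = k - d \<and> s = Suc (k - d) \<and> b = k + d" using alt by blast
        then show ?thesis
        proof (elim disjE conjE)
          assume "s = a" "k \<le> b" "k \<le> a + d" "b \<le> k + d" "\<not> (a + d = k \<and> b = k + d)"
          from count_degenerate[OF range(1) this(2) range(3) k this(3-5)] show ?thesis
            unfolding sum \<open>s = a\<close> .
        next
          assume "1 \<le> d" "d \<le> k" "a = k - d" "s = Suc (k - d)" "b = k + d"
          then show ?thesis unfolding sum using count_nontransversal[of d k "CARD('n)"] range by simp
        qed
      qed
    qed
    then show "\<exists>P :: (nat \<times> nat \<times> 'n \<Rightarrow> complex) \<Rightarrow> complex. polyfun P \<and> (\<exists>x. P x \<noteq> 0) \<and> (\<forall>x. ?R i x \<longrightarrow> P x = 0)"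
      by (simp add: ie)
  qed
  then obtain P :: "(nat \<times> nat \<times> 'n \<Rightarrow> complex) \<Rightarrow> complex" where P: "polyfun P" "\<exists>x. P x \<noteq> 0"
    "\<And>x. \<exists>i\<in>?X. ?R i x \<Longrightarrow> P x = 0" by blast
  show ?thesis
  proof (intro exI[of _ P] conjI P(1,2) allI impI ballI)
    fix x i assume x: "P x \<noteq> 0" "\<forall>m\<in>{0,1,2}. complete_flag (flag_of x m)" and i: "i \<in> ?X"
    then have "\<not> ?R i x" using P(3)[of x] by blast
    then show "case i of (a, s, b, m1, m2, m3) \<Rightarrow> \<not> bad_config k a s b lams m1 m2 m3 x"
      using x(2) by (cases i) auto
  qed
qed

lemma bad_configI:
  assumes "cspace A" "cspace S" "cspace B" "A \<subseteq> S" "S \<subseteq> V1" "S \<subseteq> V2" "A \<subseteq> V3" "V1 \<subseteq> B" "V2 \<subseteq> B" "V3 \<subseteq> B"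
    "V1 \<in> schubert k (lams m1) (flag_of x m1)" "V2 \<in> schubert k (lams m2) (flag_of x m2)"
    "V3 \<in> schubert k (lams m3) (flag_of x m3)"
  shows "bad_config k (cdim A) (cdim S) (cdim B) lams m1 m2 m3 x"
  unfolding bad_config_def using assms by blast

text \<open>General position enters only through \<open>good\<close>; the rest is valid for any
  three complete flags satisfying it.\<close>

lemma bijection_of_generic:
  fixes x :: "nat \<times> nat \<times> 'n::finite \<Rightarrow> complex" and lams :: "nat \<Rightarrow> nat \<Rightarrow> nat" and k d :: nat
  defines "X \<equiv> \<lambda>m. schubert k (lams m) (flag_of x m)"
  assumes k: "1 \<le> k" "k < CARD('n)"
    and F: "\<And>m. m \<in> {0,1,2} \<Longrightarrow> complete_flag (flag_of x m)"
    and good: "\<And>a s b m1 m2 m3. (a, s, b, m1, m2, m3) \<in> bad_indices k (CARD('n)) d \<Longrightarrow>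
        \<not> bad_config k a s b lams m1 m2 m3 x"
  shows "bij_betw (\<lambda>f. (Ker_map f, Span_map f))
     {f. morphism_deg k d f \<and> f (Some 0) \<in> X 0 \<and> f (Some 1) \<in> X 1 \<and> f None \<in> X 2}
     (Wd k d (X 0) \<inter> Wd k d (X 1) \<inter> Wd k d (X 2))"
proof -
  have X: "cspace V" "cdim V = k" if "V \<in> X m" for V m
    using schubert_cspace that unfolding X_def by blast+
  \<comment> \<open>Unexpected dimensions, together with one subspace from each Schubert variety,
    form an excluded configuration with S = A.\<close>
  have degenerate: "cdim A + d = k \<and> cdim B = k + d"
    if "cspace A" "cspace B" "k \<le> cdim A + d" "cdim B \<le> k + d"
      "\<And>m. m \<in> {0,1,2} \<Longrightarrow> V m \<in> X m \<and> A \<subseteq> V m \<and> V m \<subseteq> B" for A B V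
  proof (rule ccontr)
    assume n: "\<not> (cdim A + d = k \<and> cdim B = k + d)"
    have V: "V 0 \<in> X 0" "V 1 \<in> X 1" "V 2 \<in> X 2" "A \<subseteq> V 0" "A \<subseteq> V 1" "A \<subseteq> V 2" "V 0 \<subseteq> B" "V 1 \<subseteq> B" "V 2 \<subseteq> B"
      using that(5) by auto
    have "cdim A \<le> k" "k \<le> cdim B" "cdim B \<le> CARD('n)"
      using vec.dim_subset[OF V(4)] vec.dim_subset[OF V(7)] X(2)[OF V(1)] vec.dim_subset_UNIV[of B]
      by (auto simp: cdim_def vec.dimension_def card_cart_basis)
    then have "(cdim A, cdim A, cdim B, 0, 1, 2) \<in> bad_indices k (CARD('n)) d"
      using that(3,4) n by (simp add: bad_indices_def)
    moreover have "bad_config k (cdim A) (cdim A) (cdim B) lams 0 1 2 x"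
      using bad_configI[OF that(1) that(1) that(2) subset_refl V(4-9)] V(1-3) unfolding X_def by blast
    ultimately show False using good by blast
  qed
  have transversal: "V1 \<inter> V2 = A"
    if A: "cspace A" "cdim A + d = k" and B: "cspace B" "cdim B = k + d"
      and m: "(m1, m2, m3) \<in> {(0, 1, 2), (0, 2, 1), (1, 2, 0)}"
      and V: "V1 \<in> X m1" "V2 \<in> X m2" "V3 \<in> X m3" "A \<subseteq> V1" "V1 \<subseteq> B" "A \<subseteq> V2" "V2 \<subseteq> B" "A \<subseteq> V3" "V3 \<subseteq> B"
    for A B V1 V2 V3 m1 m2 m3
  proof (rule ccontr)
    assume "V1 \<inter> V2 \<noteq> A"
    then obtain v where v: "v \<in> V1" "v \<in> V2" "v \<notin> A" using V by blast
    \<comment> \<open>A common vector outside A provides the space of dimension k - d + 1 for the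
      second kind of excluded configuration.\<close>
    define S where "S = vec.span (insert v A)"
    have S: "cspace S" "cdim S = Suc (k - d)"
      using v A by (auto simp: S_def cspace_def cdim_def vec.dim_insert span_of_subspace)
    have sub: "A \<subseteq> S" "S \<subseteq> V1" "S \<subseteq> V2"
    proof -
      show "A \<subseteq> S" by (auto simp: S_def intro: vec.span_base)
      show "S \<subseteq> V1" "S \<subseteq> V2" unfolding S_def using v V X(1)[OF V(1)] X(1)[OF V(2)]
        by (intro vec.span_minimal; auto simp: cspace_def)+
    qed
    have Sk: "Suc (k - d) \<le> k" using vec.dim_subset[OF sub(2)] S(2) X(2)[OF V(1)] by (simp add: cdim_def)
    have kd: "k + d \<le> CARD('n)"
      using vec.dim_subset_UNIV[of B] B(2) by (simp add: cdim_def vec.dimension_def card_cart_basis)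
    have d: "Suc 0 \<le> d" "d \<le> k" using Sk A(2) by linarith+
    have "(k - d, Suc (k - d), k + d, m1, m2, m3) \<in> bad_indices k (CARD('n)) d"
      using m by (elim insertE emptyE) (simp_all add: bad_indices_def Sk kd d)
    moreover have "bad_config k (k - d) (Suc (k - d)) (k + d) lams m1 m2 m3 x"
    proof -
      have "cdim A = k - d" using A(2) by simp
      moreover have "bad_config k (cdim A) (cdim S) (cdim B) lams m1 m2 m3 x"
        using bad_configI[OF A(1) S(1) B(1) sub V(8,5,7,9)] V(1-3) unfolding X_def by blast
      ultimately show ?thesis using S(2) B(2) by simp
    qed
    ultimately show False using good by blast
  qed
  have transversal_all: "V 0 \<inter> V 1 = A \<and> V 0 \<inter> V 2 = A \<and> V 1 \<inter> V 2 = A"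
    if A: "cspace A" "cdim A + d = k" and B: "cspace B" "cdim B = k + d"
      and V: "\<And>m. m \<in> {0,1,2} \<Longrightarrow> V m \<in> X m \<and> A \<subseteq> V m \<and> V m \<subseteq> B" for A B V
    using transversal[OF A B, of 0 1 2 "V 0" "V 1" "V 2"] transversal[OF A B, of 0 2 1 "V 0" "V 2" "V 1"]
      transversal[OF A B, of 1 2 0 "V 1" "V 2" "V 0"] V[of 0] V[of 1] V[of 2] by auto
  have unique: "V m = V' m"
    if A: "cspace A" "cdim A + d = k" and B: "cspace B" "cdim B = k + d"
      and V: "\<And>m. m \<in> {0,1,2} \<Longrightarrow> V m \<in> X m \<and> A \<subseteq> V m \<and> V m \<subseteq> B"
      and V': "\<And>m. m \<in> {0,1,2} \<Longrightarrow> V' m \<in> X m \<and> A \<subseteq> V' m \<and> V' m \<subseteq> B" and m: "m \<in> {0,1,2}" for A B V V' m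
  proof (rule ccontr)
    assume ne: "V m \<noteq> V' m"
    \<comment> \<open>Any index other than \<open>m\<close> serves: the member \<open>U\<close> of
      the line can replace V m, and its failure to be transversal to V l contradicts
      \<open>transversal_all\<close>.\<close>
    define l :: nat where "l = (if m = 0 then 1 else 0)"
    have l: "l \<in> {0,1,2}" "l \<noteq> m" by (auto simp: l_def)
    have "\<exists>U\<in>schubert k (lams m) (flag_of x m). A \<subseteq> U \<and> U \<subseteq> B \<and> U \<inter> V l \<noteq> A"
      using F[OF m] _ _ ne
    proof (rule schubert_line_meets)
      show "V m \<in> schubert k (lams m) (flag_of x m)" "V' m \<in> schubert k (lams m) (flag_of x m)"
        using V[OF m] V'[OF m] by (auto simp: X_def)
      show "cspace (V l)" "cdim (V l) = k" using X V[OF l(1)] by auto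
    qed (use A B V[OF m] V'[OF m] V[OF l(1)] k in auto)
    then obtain U where U: "U \<in> X m" "A \<subseteq> U" "U \<subseteq> B" "U \<inter> V l \<noteq> A" by (auto simp: X_def)
    have "(V(m := U)) j \<in> X j \<and> A \<subseteq> (V(m := U)) j \<and> (V(m := U)) j \<subseteq> B" if "j \<in> {0,1,2}" for j
      using V[OF that] U by auto
    from transversal_all[OF A B this] have "U \<inter> V l = A"
      using m by (elim insertE emptyE) (simp_all add: l_def Int_commute)
    with U(4) show False by simp
  qed
  have in_Wd: "(A, B) \<in> Wd k d (X 0) \<inter> Wd k d (X 1) \<inter> Wd k d (X 2) \<Longrightarrow>
      \<exists>V. \<forall>m\<in>{0,1,2}. V m \<in> X m \<and> A \<subseteq> V m \<and> V m \<subseteq> B" for A B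
  proof -
    assume "(A, B) \<in> Wd k d (X 0) \<inter> Wd k d (X 1) \<inter> Wd k d (X 2)"
    then obtain V0 V1 V2 where "V0 \<in> X 0" "V1 \<in> X 1" "V2 \<in> X 2" "A \<subseteq> V0" "V0 \<subseteq> B" "A \<subseteq> V1" "V1 \<subseteq> B" "A \<subseteq> V2" "V2 \<subseteq> B"
      unfolding Wd_def by auto
    then show ?thesis
      by (intro exI[of _ "\<lambda>m. if m = 0 then V0 else if m = 1 then V1 else V2"]) auto
  qed
  have frame: "\<exists>b. is_basis_of (k + d) b B \<and> is_basis_of (k - d) b A \<and>
      is_basis_of k (pencil k d b (Some 0)) (V 0) \<and> is_basis_of k (pencil k d b (Some 1)) (V 1) \<and>
      is_basis_of k (pencil k d b None) (V 2)"
    if A: "cspace A" "cdim A + d = k" and B: "cspace B" "cdim B = k + d"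
      and V: "\<And>m. m \<in> {0,1,2} \<Longrightarrow> V m \<in> X m \<and> A \<subseteq> V m \<and> V m \<subseteq> B" for A B V
  proof -
    have dA: "cdim A = k - d" "d \<le> k" using A(2) by auto
    have sub: "cspace (V (i - 1)) \<and> cdim (V (i - 1)) = k \<and> A \<subseteq> V (i - 1) \<and> V (i - 1) \<subseteq> B" if "i \<in> {1,2,3}" for i
      using V[of "i - 1"] X that by auto
    note int = transversal_all[OF A B V]
    show ?thesis
      by (rule three_point_frame[OF dA(2) A(1) dA(1) B, of "\<lambda>i. V (i - 1)"])
        (use sub int in \<open>auto simp: numeral_2_eq_2 numeral_3_eq_3\<close>)
  qed
  define D where "D = {f. morphism_deg k d f \<and> f (Some 0) \<in> X 0 \<and> f (Some 1) \<in> X 1 \<and> f None \<in> X 2}"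
  define pt where "pt m = (if m = 0 then Some 0 else if m = 1 then Some 1 else None :: complex option)" for m :: nat
  have D: "cspace (Ker_map f)" "cdim (Ker_map f) + d = k" "cspace (Span_map f)" "cdim (Span_map f) = k + d"
     "\<And>m. m \<in> {0,1,2} \<Longrightarrow> f (pt m) \<in> X m \<and> Ker_map f \<subseteq> f (pt m) \<and> f (pt m) \<subseteq> Span_map f"
     if "f \<in> D" for f
  proof -
    have f: "morphism_deg k d f" using that by (simp add: D_def)
    note KS = Ker_Span_dim[OF f]
    show fm: "f (pt m) \<in> X m \<and> Ker_map f \<subseteq> f (pt m) \<and> f (pt m) \<subseteq> Span_map f" if "m \<in> {0,1,2}" for m
      using that \<open>f \<in> D\<close> KS(5,6) by (auto simp: D_def pt_def)
    show "cspace (Ker_map f)" "cspace (Span_map f)" using KS by auto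
    show "cdim (Ker_map f) + d = k" "cdim (Span_map f) = k + d"
      using degenerate[OF KS(1-4), of "\<lambda>m. f (pt m)"] fm by auto
  qed
  have "inj_on (\<lambda>f. (Ker_map f, Span_map f)) D"
  proof (rule inj_onI)
    fix f g assume fg: "f \<in> D" "g \<in> D" and eq: "(Ker_map f, Span_map f) = (Ker_map g, Span_map g)"
    have g: "f (pt m) = g (pt m)" if "m \<in> {0,1,2}" for m
      using unique[OF D(1-4)[OF fg(1)], of "\<lambda>m. f (pt m)" "\<lambda>m. g (pt m)"] D(5)[OF fg(1)] D(5)[OF fg(2)] that eq by auto
    obtain b where b: "is_basis_of (k + d) b (Span_map f)" "is_basis_of (k - d) b (Ker_map f)"
      "is_basis_of k (pencil k d b (Some 0)) (f (pt 0))" "is_basis_of k (pencil k d b (Some 1)) (f (pt 1))"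
      "is_basis_of k (pencil k d b None) (f (pt 2))"
      using frame[OF D(1-4)[OF fg(1)], of "\<lambda>m. f (pt m)"] D(5)[OF fg(1)] by blast
    \<comment> \<open>Applied to \<open>f\<close> and to \<open>g\<close>: kernel and span agree by
      assumption and the values at 0, 1, infinity by \<open>unique\<close>, so both curves are the
      same pencil.\<close>
    have "h = (\<lambda>x. vec.span (pencil k d b x ` {..<k}))"
      if h: "h \<in> D" "Ker_map h = Ker_map f" "Span_map h = Span_map f" "\<And>m. m \<in> {0,1,2} \<Longrightarrow> h (pt m) = f (pt m)" for h
    proof (rule morphism_eq_pencil[OF _ _ b(1,2)])
      have mh: "morphism_deg k d h" using h(1) by (simp add: D_def)
      then show "morphism_deg k d h" .
      show "Ker_map f \<subseteq> h x" "h x \<subseteq> Span_map f" for x using Ker_Span_dim(5,6)[OF mh] h(2,3) by auto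
      show "0 < k" "d \<le> k" using k(1) D(2)[OF fg(1)] by auto
      show "is_basis_of k (pencil k d b (Some 0)) (h (Some 0))" "is_basis_of k (pencil k d b (Some 1)) (h (Some 1))"
        "is_basis_of k (pencil k d b None) (h None)"
        using b(3-5) h(4)[of 0] h(4)[of 1] h(4)[of 2] by (auto simp: pt_def)
    qed
    from this[OF fg(1)] this[OF fg(2)] g eq show "f = g" by auto
  qed
  moreover have "(\<lambda>f. (Ker_map f, Span_map f)) ` D = Wd k d (X 0) \<inter> Wd k d (X 1) \<inter> Wd k d (X 2)"
  proof (intro equalityI subsetI)
    fix y assume "y \<in> (\<lambda>f. (Ker_map f, Span_map f)) ` D"
    then obtain f where f: "f \<in> D" "y = (Ker_map f, Span_map f)" by blast
    note Df = D[OF f(1)]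
    have dA: "cdim (Ker_map f) = k - d" "d \<le> k" using Df(2) by auto
    have "k + d \<le> CARD('n)"
      using vec.dim_subset_UNIV[of "Span_map f"] Df(4) by (simp add: cdim_def vec.dimension_def card_cart_basis)
    moreover have "Ker_map f \<subseteq> Span_map f" using Df(5)[of 0] by auto
    ultimately have "(Ker_map f, Span_map f) \<in> Yd k d" using Df dA by (simp add: Yd_def)
    then have "(Ker_map f, Span_map f) \<in> Wd k d (X m)" if "m \<in> {0,1,2}" for m
      using Df(5)[OF that] unfolding Wd_def by blast
    then show "y \<in> Wd k d (X 0) \<inter> Wd k d (X 1) \<inter> Wd k d (X 2)" using f by simp
  next
    fix y assume y: "y \<in> Wd k d (X 0) \<inter> Wd k d (X 1) \<inter> Wd k d (X 2)"
    obtain A B where AB: "y = (A, B)" by (cases y)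
    have "(A, B) \<in> Yd k d" using y by (auto simp: AB Wd_def)
    then have A: "cspace A" "cdim A + d = k" and B: "cspace B" "cdim B = k + d" and d: "d \<le> k" by (auto simp: Yd_def)
    obtain V where V: "\<And>m. m \<in> {0,1,2} \<Longrightarrow> V m \<in> X m \<and> A \<subseteq> V m \<and> V m \<subseteq> B" using in_Wd y AB by metis
    obtain b where b: "is_basis_of (k + d) b B" "is_basis_of (k - d) b A"
      "is_basis_of k (pencil k d b (Some 0)) (V 0)" "is_basis_of k (pencil k d b (Some 1)) (V 1)"
      "is_basis_of k (pencil k d b None) (V 2)"
      using frame[OF A B V] by blast
    define f where "f = (\<lambda>x. vec.span (pencil k d b x ` {..<k}))"
    have f: "morphism_deg k d f" unfolding f_def by (rule pencil_morphism[OF b(1) d])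
    have fV: "f (Some 0) = V 0" "f (Some 1) = V 1" "f None = V 2"
      using b(3-5) by (auto simp: f_def is_basis_of_def)
    then have fD: "f \<in> D" using f V[of 0] V[of 1] V[of 2] by (simp add: D_def)
    have bf: "b i \<in> f x" if "i < k - d" for i x
    proof -
      have "pencil k d b x i = b i" using that by (simp add: pencil_def)
      then show ?thesis unfolding f_def using that by (metis diff_le_self imageI lessThan_iff order_less_le_trans vec.span_base)
    qed
    have A_span: "A = vec.span (b ` {..<k-d})" using b(2) by (simp add: is_basis_of_def)
    have "A \<subseteq> f x" for x
      unfolding A_span using bf[of _ x] unfolding f_def by (intro vec.span_minimal) auto
    then have "A \<subseteq> Ker_map f" by (auto simp: Ker_map_def)
    \<comment> \<open>One inclusion suffices, since all elements of \<open>D\<close> have a kernel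
      of dimension k - d; the span is treated in the same way.\<close>
    then have KA: "Ker_map f = A"
      using vec.subspace_dim_equal[of A "Ker_map f"] A D(1,2)[OF fD] by (simp add: cspace_def cdim_def)
    have "pencil k d b x i \<in> B" if "i < k" for x i
      using that basis_mem[OF b(1)] B(1)
      by (auto simp: pencil_def cspace_def split: option.split intro!: vec.subspace_add vec.subspace_scale)
    then have "f x \<subseteq> B" for x unfolding f_def using B(1) by (intro vec.span_minimal) (auto simp: cspace_def)
    then have "Span_map f \<subseteq> B" unfolding Span_map_def using B(1) by (intro vec.span_minimal) (auto simp: cspace_def)
    then have SB: "Span_map f = B"
      using vec.subspace_dim_equal[of "Span_map f" B] B D(3,4)[OF fD] by (simp add: cspace_def cdim_def)
    show "y \<in> (\<lambda>f. (Ker_map f, Span_map f)) ` D" using fD KA SB AB by blast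
  qed
  ultimately show ?thesis unfolding bij_betw_def D_def by blast
qed

theorem mainTheorem2:
  fixes k d :: nat and lam mu nu :: "nat \<Rightarrow> nat"
  assumes "1 \<le> k" and "k < CARD('n)"
    and "partition_in_rect k (CARD('n) - k) lam"
    and "partition_in_rect k (CARD('n) - k) mu"
    and "partition_in_rect k (CARD('n) - k) nu"
    and "part_size k lam + part_size k mu + part_size k nu = k * (CARD('n) - k) + CARD('n) * d"
  shows "\<exists>P :: (nat \<times> nat \<times> 'n \<Rightarrow> complex) \<Rightarrow> complex.
     polyfun P \<and> (\<exists>a. P a \<noteq> 0) \<and>
     (\<forall>a. P a \<noteq> 0 \<longrightarrow>
        complete_flag (flag_of a 0) \<longrightarrow> complete_flag (flag_of a 1) \<longrightarrow> complete_flag (flag_of a 2) \<longrightarrow>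
        bij_betw (\<lambda>f. (Ker_map f, Span_map f))
          {f :: complex option \<Rightarrow> (complex^'n) set. morphism_deg k d f
              \<and> f (Some 0) \<in> schubert k lam (flag_of a 0)
              \<and> f (Some 1) \<in> schubert k mu (flag_of a 1)
              \<and> f None \<in> schubert k nu (flag_of a 2)}
          (Wd k d (schubert k lam (flag_of a 0)) \<inter> Wd k d (schubert k mu (flag_of a 1))
             \<inter> Wd k d (schubert k nu (flag_of a 2))))"
proof -
  \<comment> \<open>The partitions are indexed like the flags, so that the roles of the flags can be
    permuted in \<open>bad_indices\<close>.\<close>
  define lams where "lams m = (if m = 0 then lam else if m = 1 then mu else nu)" for m :: nat
  have l: "lams 0 = lam" "lams 1 = mu" "lams 2 = nu" by (auto simp: lams_def)
  have lp: "partition_in_rect k (CARD('n) - k) (lams m)" for m using assms(3-5) by (simp add: lams_def)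
  have ls: "part_size k (lams 0) + part_size k (lams 1) + part_size k (lams 2) = k * (CARD('n) - k) + CARD('n) * d"
    using assms(6) by (simp only: l)
  obtain P :: "(nat \<times> nat \<times> 'n \<Rightarrow> complex) \<Rightarrow> complex" where P: "polyfun P" "\<exists>x. P x \<noteq> 0"
    "\<forall>x. P x \<noteq> 0 \<longrightarrow> (\<forall>m\<in>{0,1,2}. complete_flag (flag_of x m)) \<longrightarrow>
      (\<forall>(a, s, b, m1, m2, m3)\<in>bad_indices k (CARD('n)) d. \<not> bad_config k a s b lams m1 m2 m3 x)"
    using generic_position[OF assms(1,2) lp ls] by blast
  show ?thesis
  proof (intro exI[of _ P] conjI P(1,2) allI impI)
    fix a assume a: "P a \<noteq> 0" "complete_flag (flag_of a 0)" "complete_flag (flag_of a 1)" "complete_flag (flag_of a 2)"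
    then have F: "\<And>m. m \<in> {0,1,2} \<Longrightarrow> complete_flag (flag_of a m)" by auto
    have "\<not> bad_config k a' s b lams m1 m2 m3 a"
      if "(a', s, b, m1, m2, m3) \<in> bad_indices k (CARD('n)) d" for a' s b m1 m2 m3
      using P(3)[rule_format, OF a(1) F] that by blast
    from bijection_of_generic[OF assms(1,2) F this, unfolded l]
    show "bij_betw (\<lambda>f. (Ker_map f, Span_map f))
          {f :: complex option \<Rightarrow> (complex^'n) set. morphism_deg k d f
              \<and> f (Some 0) \<in> schubert k lam (flag_of a 0)
              \<and> f (Some 1) \<in> schubert k mu (flag_of a 1)
              \<and> f None \<in> schubert k nu (flag_of a 2)}
          (Wd k d (schubert k lam (flag_of a 0)) \<inter> Wd k d (schubert k mu (flag_of a 1))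
             \<inter> Wd k d (schubert k nu (flag_of a 2)))" .
  qed
qed

end
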